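(* Suppose that $m_-(x)/m_+(x)\to1$ as $x\to\infty$. Then $$\limsup_{x\to\infty}\frac{\bar a(x)m(x)}{x}<\infty\quad\text{if and only if}\quad \liminf_{t\downarrow0}\frac{\alpha(t)+|\gamma(t)|}{\eta(1/t)}>0 .$$
   Context: Let $X,X_1,X_2,\dots$ be i.i.d. integer-valued random variables and $S_n=X_1+\dots+X_n$, $S_0=0$. Standing assumptions: the random walk $S$ is irreducible as a Markov chain on $\mathbb Z$, $EX=0$, and $EX^2=\infty$. The potential function is $a(x)=\sum_{n=0}^\infty\big(P[S_n=0]-P[S_n=-x]\big)$, $x\in\mathbb Z$ (the series converges), and $\bar a(x)=\frac12[a(x)+a(-x)]$. For real $x\ge0$, $t\ge0$: $\mu_-(x)=P[X<-x]$, $\mu_+(x)=P[X>x]$, $\mu=\mu_++\mu_-$; $\eta_\pm(x)=\int_x^\infty\mu_\pm(y)\,dy$, $\eta=\eta_++\eta_-$; $m_\pm(x)=\int_0^x\eta_\pm(s)\,ds$, $m=m_++m_-$; $\alpha(t)=\int_0^\infty\mu(y)\sin(ty)\,dy$ (as an improper integral); $\beta_\pm(t)=\int_0^\infty\mu_\pm(y)(1-\cos ty)\,dy$; $\gamma(t)=\beta_+(t)-\beta_-(t)$. *)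

theory Defs
  imports "HOL-Probability.Probability"
begin

text \<open>
  The sequence \<open>X\<close> encodes the i.i.d. family as follows: \<open>X 0\<close> is the generic copy of the step
  and \<open>X 1, X 2, \<dots>\<close> are the steps of the walk.
\<close>

definition walk :: "(nat \<Rightarrow> 'w \<Rightarrow> int) \<Rightarrow> nat \<Rightarrow> 'w \<Rightarrow> int" where
  "walk X n \<omega> = (\<Sum>k=1..n. X k \<omega>)"

definition iid_int :: "'w measure \<Rightarrow> (nat \<Rightarrow> 'w \<Rightarrow> int) \<Rightarrow> bool" where
  "iid_int M X \<longleftrightarrow>
     prob_space.indep_vars M (\<lambda>_. count_space UNIV) X UNIV \<and>
     (\<forall>k. distr M (count_space UNIV) (X k) = distr M (count_space UNIV) (X 0))"

definition irreducible_walk :: "'w measure \<Rightarrow> (nat \<Rightarrow> 'w \<Rightarrow> int) \<Rightarrow> bool" where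
  "irreducible_walk M X \<longleftrightarrow>
     (\<forall>x y. \<exists>n. measure M {\<omega> \<in> space M. x + walk X n \<omega> = y} > 0)"

definition potential :: "'w measure \<Rightarrow> (nat \<Rightarrow> 'w \<Rightarrow> int) \<Rightarrow> int \<Rightarrow> real" where
  "potential M X x =
     (\<Sum>n. measure M {\<omega> \<in> space M. walk X n \<omega> = 0}
         - measure M {\<omega> \<in> space M. walk X n \<omega> = - x})"

definition sym_potential :: "'w measure \<Rightarrow> (nat \<Rightarrow> 'w \<Rightarrow> int) \<Rightarrow> int \<Rightarrow> real" where
  "sym_potential M X x = (potential M X x + potential M X (- x)) / 2"

definition mu_minus :: "'w measure \<Rightarrow> ('w \<Rightarrow> int) \<Rightarrow> real \<Rightarrow> real" where
  "mu_minus M Y x = measure M {\<omega> \<in> space M. real_of_int (Y \<omega>) < - x}"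

definition mu_plus :: "'w measure \<Rightarrow> ('w \<Rightarrow> int) \<Rightarrow> real \<Rightarrow> real" where
  "mu_plus M Y x = measure M {\<omega> \<in> space M. real_of_int (Y \<omega>) > x}"

definition mu :: "'w measure \<Rightarrow> ('w \<Rightarrow> int) \<Rightarrow> real \<Rightarrow> real" where
  "mu M Y x = mu_plus M Y x + mu_minus M Y x"

definition eta_minus :: "'w measure \<Rightarrow> ('w \<Rightarrow> int) \<Rightarrow> real \<Rightarrow> real" where
  "eta_minus M Y x = (LBINT y:{x..}. mu_minus M Y y)"

definition eta_plus :: "'w measure \<Rightarrow> ('w \<Rightarrow> int) \<Rightarrow> real \<Rightarrow> real" where
  "eta_plus M Y x = (LBINT y:{x..}. mu_plus M Y y)"

definition eta :: "'w measure \<Rightarrow> ('w \<Rightarrow> int) \<Rightarrow> real \<Rightarrow> real" where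
  "eta M Y x = eta_plus M Y x + eta_minus M Y x"

definition m_minus :: "'w measure \<Rightarrow> ('w \<Rightarrow> int) \<Rightarrow> real \<Rightarrow> real" where
  "m_minus M Y x = (LBINT s:{0..x}. eta_minus M Y s)"

definition m_plus :: "'w measure \<Rightarrow> ('w \<Rightarrow> int) \<Rightarrow> real \<Rightarrow> real" where
  "m_plus M Y x = (LBINT s:{0..x}. eta_plus M Y s)"

definition m_total :: "'w measure \<Rightarrow> ('w \<Rightarrow> int) \<Rightarrow> real \<Rightarrow> real" where
  "m_total M Y x = m_plus M Y x + m_minus M Y x"

definition alpha :: "'w measure \<Rightarrow> ('w \<Rightarrow> int) \<Rightarrow> real \<Rightarrow> real" where
  "alpha M Y t = Lim at_top (\<lambda>R. LBINT y:{0..R}. mu M Y y * sin (t * y))"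

definition beta_minus :: "'w measure \<Rightarrow> ('w \<Rightarrow> int) \<Rightarrow> real \<Rightarrow> real" where
  "beta_minus M Y t = (LBINT y:{0..}. mu_minus M Y y * (1 - cos (t * y)))"

definition beta_plus :: "'w measure \<Rightarrow> ('w \<Rightarrow> int) \<Rightarrow> real \<Rightarrow> real" where
  "beta_plus M Y t = (LBINT y:{0..}. mu_plus M Y y * (1 - cos (t * y)))"

definition gamma :: "'w measure \<Rightarrow> ('w \<Rightarrow> int) \<Rightarrow> real \<Rightarrow> real" where
  "gamma M Y t = beta_plus M Y t - beta_minus M Y t"

end

theory Submission
  imports Defs
begin

text \<open>
  Let \<open>\<phi>\<close> be the characteristic function of the step \<open>X\<close> and let \<open>h\<close> be the Huber function, \<open>h z = z^2 / 2\<close> for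
  \<open>|z| \<le> 1\<close> and \<open>h z = |z| - 1/2\<close> otherwise. Everything is read off from \<open>cdef t = E (1 - cos (t X))\<close>,
  \<open>smean t = E (sin (t X))\<close> and \<open>hmean t = E (h (t X))\<close>. Fubini turns the analytic data of the theorem into these
  expectations: for \<open>t > 0\<close>, \<open>t * \<alpha> t = cdef t\<close>, \<open>t * \<gamma> t = - smean t\<close> and \<open>t^2 * m (1/t) = hmean t\<close>. The rate
  \<open>x / m x\<close> is therefore \<open>rate t = t / hmean t\<close> at \<open>t = 1/x\<close>. Since \<open>h z\<close> is squeezed, up to constants, between
  \<open>(|z| - 1)^+\<close> and \<open>(1 - cos z) + (|z| - 1)^+\<close>, the liminf condition says precisely that \<open>cdef + |smean|\<close> is at
  least a multiple of \<open>hmean\<close> near \<open>0\<close> (\<open>liminf_pos_iff\<close>).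

  The potential. Fourier inversion gives \<open>(a x + a (- x)) / 2 = (1/\<pi>) \<integral>_0^\<pi> (1 - cos (x t)) Re (1 / (1 - \<phi> t)) dt\<close>
  (\<open>sym_potential_eq_fpot\<close>), but first the series defining \<open>a\<close> has to converge. If \<open>A_N x\<close> is a partial sum, dominated
  convergence handles \<open>A_N x - x * A_N 1\<close>, whose Fourier kernel vanishes to second order at \<open>0\<close>, whereas
  \<open>1 - \<phi> t\<close> is at least of order \<open>t^2\<close>. A maximum principle gives \<open>A_N \<ge> 0\<close>; applied at \<open>x\<close> and at
  \<open>- x\<close> it confines the limit points of \<open>A_N 1\<close> to an interval of length \<open>(a x + a (- x)) / x\<close>, and that
  tends to \<open>0\<close> because \<open>E X^2 = \<infinity>\<close>.

  The liminf condition implies the bound (\<open>fpot_upper_bound\<close>). It makes the kernel \<open>Re (1 / (1 - \<phi>))\<close> at most a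
  multiple of \<open>k / hmean^2\<close>, where \<open>k t = E (min 1 ((t X)^2))\<close>; and \<open>k / hmean^2\<close> is, up to a constant factor, the
  rate of decrease of \<open>rate\<close>, so its integral over \<open>[1/x, \<pi>]\<close> is of the order of \<open>rate (1/x)\<close>. The part of the
  integral over \<open>[0, 1/x]\<close> is handled by \<open>1 - cos (x t) \<le> (x t)^2 / 2\<close>.

  The bound implies the liminf condition (\<open>cos_defect_lower_bound\<close>). Averaging over \<open>x\<close> removes the factor
  \<open>1 - cos (x t)\<close>, so the integral of the kernel over \<open>[s, \<pi>]\<close> is at most a constant times \<open>rate s\<close>
  (\<open>rinv_integral_le_of_fpot_bound\<close>). The balance \<open>m_- / m_+ \<rightarrow> 1\<close> forces
  \<open>smean = o(hmean)\<close> (\<open>smean_small_of_balance\<close>). Suppose now that \<open>cdef s\<close> is tiny relative to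
  \<open>hmean s\<close>, and move to larger \<open>t\<close> until \<open>rate\<close> has halved. If \<open>cdef / hmean\<close> stays below \<open>\<delta>\<close> on the way, the
  denominator \<open>cdef^2 + smean^2\<close> is at most \<open>2 \<delta>^2 hmean^2\<close>, and the kernel integrates to at least
  \<open>rate s / \<delta>^2\<close> up to a constant. Otherwise \<open>cdef / hmean\<close> climbs from \<open>\<epsilon>\<close> to \<open>\<delta>\<close>; it is Lipschitz in
  \<open>log t\<close>, so the integral of \<open>1 / (2 cdef)\<close> over the climb is at least of order \<open>rate s * log (\<delta>/\<epsilon>)\<close>
  (\<open>cos_defect_crossing\<close>). Both contradict the bound once \<open>\<delta>\<close> and then \<open>\<epsilon>\<close> are small.
\<close>

section \<open>Expectations as integrals of tails\<close>

context prob_space begin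

text \<open>Fubini for \<open>{(\<omega>, y). a \<le> y < Y \<omega>}\<close>: this one formula converts every integral of a tail \<open>P[Y > y]\<close> in the
  definitions of \<open>\<eta>\<close>, \<open>\<alpha>\<close> and \<open>\<beta>\<close> into an expectation. Integrability of \<open>Y\<close> makes a bounded
  \<open>h\<close> admissible on the unbounded range.\<close>

lemma integral_tail_mult:
  fixes Y :: "'a \<Rightarrow> real" and h :: "real \<Rightarrow> real"
  assumes Y: "integrable M Y" and [measurable]: "h \<in> borel_measurable borel"
    and K: "\<And>y. \<bar>h y\<bar> \<le> K"
  shows "(LBINT y:{a..}. prob {\<omega> \<in> space M. Y \<omega> > y} * h y)
           = (\<integral>\<omega>. (LBINT y:{a..<Y \<omega>}. h y) \<partial>M)" (is "?L = ?R")
    and "set_integrable lborel {a..} (\<lambda>y. prob {\<omega> \<in> space M. Y \<omega> > y} * h y)" (is ?I)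
proof -
  interpret L: pair_sigma_finite M lborel ..
  have [measurable]: "Y \<in> borel_measurable M" using Y by auto
  define f where "f = (\<lambda>(\<omega>,y). indicator {a..} y * (if y < Y \<omega> then h y else 0))"
  have [measurable]: "f \<in> borel_measurable (M \<Otimes>\<^sub>M lborel)" unfolding f_def by measurable
  have f_eq: "f (\<omega>, y) = indicator {a..<Y \<omega>} y * h y" for \<omega> y
    by (auto simp: f_def indicator_def)
  have si: "set_integrable lborel {a..<b} h" for b
    unfolding set_integrable_def
  proof (rule Bochner_Integration.integrable_bound)
    show "integrable lborel (\<lambda>y. K * indicator {a..<b} y)"
      by (cases "a \<le> b") auto
    show "AE y in lborel. norm (indicator {a..<b} y *\<^sub>R h y) \<le> norm (K * indicator {a..<b} y)"
      using K order_trans[OF K abs_ge_self] by (intro AE_I2) (auto simp: indicator_def)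
  qed simp
  have *: "(\<integral>y. norm (f (\<omega>, y)) \<partial>lborel) \<le> K * (\<bar>Y \<omega>\<bar> + \<bar>a\<bar>)" for \<omega>
  proof -
    have K0: "K \<ge> 0" using K[of 0] by linarith
    have "(\<integral>y. norm (f (\<omega>, y)) \<partial>lborel) \<le> (\<integral>y. K * indicator {a..<Y \<omega>} y \<partial>lborel)"
    proof (rule integral_mono)
      show "integrable lborel (\<lambda>y. norm (f (\<omega>, y)))"
        using si[of "Y \<omega>"] by (simp add: f_eq set_integrable_def)
      show "integrable lborel (\<lambda>y. K * indicator {a..<Y \<omega>} y)"
        by (cases "a \<le> Y \<omega>") auto
    qed (use K in \<open>auto simp: f_eq indicator_def\<close>)
    also have "\<dots> = K * max 0 (Y \<omega> - a)"
      by (cases "a \<le> Y \<omega>") auto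
    also have "\<dots> \<le> K * (\<bar>Y \<omega>\<bar> + \<bar>a\<bar>)" using K0 by (intro mult_left_mono) auto
    finally show ?thesis .
  qed
  have int: "integrable (M \<Otimes>\<^sub>M lborel) f"
  proof (rule L.Fubini_integrable)
    show "integrable M (\<lambda>\<omega>. \<integral>y. norm (f (\<omega>, y)) \<partial>lborel)"
    proof (rule Bochner_Integration.integrable_bound)
      show "integrable M (\<lambda>\<omega>. K * (\<bar>Y \<omega>\<bar> + \<bar>a\<bar>))" using Y by auto
      show "AE \<omega> in M. norm (\<integral>y. norm (f (\<omega>, y)) \<partial>lborel) \<le> norm (K * (\<bar>Y \<omega>\<bar> + \<bar>a\<bar>))"
      proof (rule AE_I2)
        fix \<omega>
        have "0 \<le> (\<integral>y. norm (f (\<omega>, y)) \<partial>lborel)" by (rule integral_nonneg_AE) auto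
        with *[of \<omega>] show "norm (\<integral>y. norm (f (\<omega>, y)) \<partial>lborel) \<le> norm (K * (\<bar>Y \<omega>\<bar> + \<bar>a\<bar>))"
          by (metis abs_of_nonneg order_trans real_norm_def)
      qed
    qed simp
  qed (use si in \<open>auto simp: f_eq set_integrable_def\<close>)
  have inner: "(\<integral>\<omega>. f (\<omega>, y) \<partial>M) = indicator {a..} y * (prob {\<omega> \<in> space M. Y \<omega> > y} * h y)" for y
  proof -
    have "(\<integral>\<omega>. f (\<omega>, y) \<partial>M) = (\<integral>\<omega>. (indicator {a..} y * h y) * indicator {\<omega> \<in> space M. Y \<omega> > y} \<omega> \<partial>M)"
      by (rule Bochner_Integration.integral_cong) (auto simp: f_def indicator_def)
    also have "\<dots> = indicator {a..} y * h y * prob {\<omega> \<in> space M. Y \<omega> > y}"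
      using sets.sets_into_space[of "{\<omega> \<in> space M. Y \<omega> > y}" M]
      by (simp add: Bochner_Integration.integral_mult_right_zero Int_absorb2)
    finally show ?thesis by simp
  qed
  have "(\<integral>y. (\<integral>\<omega>. f (\<omega>, y) \<partial>M) \<partial>lborel) = (\<integral>\<omega>. (\<integral>y. f (\<omega>, y) \<partial>lborel) \<partial>M)"
    using L.Fubini_integral[of "\<lambda>a b. f (a, b)"] int by (simp add: case_prod_unfold)
  then show "?L = ?R" unfolding inner by (simp add: set_lebesgue_integral_def f_eq)
  have "integrable lborel (\<lambda>y. \<integral>\<omega>. f (\<omega>, y) \<partial>M)"
    using L.integrable_snd[of "\<lambda>a b. f (a, b)"] int by (simp add: case_prod_unfold)
  then show ?I unfolding inner by (simp add: set_integrable_def)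
qed

end

lemma LBINT_Icc_eq_Ico:
  fixes f :: "real \<Rightarrow> real"
  shows "(LBINT y:{a..c}. f y) = (LBINT y:{a..<c}. f y)"
  unfolding set_lebesgue_integral_def
  by (rule integral_discrete_difference[where X="{c}"]) (auto simp: indicator_def)

lemma LBINT_FTC_Icc:
  fixes F f :: "real \<Rightarrow> real"
  assumes "\<And>x. a \<le> x \<Longrightarrow> x \<le> c \<Longrightarrow> (F has_real_derivative f x) (at x)" "continuous_on {a..c} f" "a \<le> c"
  shows "(LBINT y:{a..c}. f y) = F c - F a"
  unfolding set_lebesgue_integral_def
  by (rule integral_FTC_atLeastAtMost)
     (use assms in \<open>auto simp: has_real_derivative_iff_has_vector_derivative[symmetric]
          intro: DERIV_subset has_field_derivative_at_within\<close>)

text \<open>The maximum covers the case \<open>c < a\<close>, in which the interval is empty.\<close>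

lemma LBINT_FTC_Ico:
  fixes F f :: "real \<Rightarrow> real"
  assumes "\<And>x. (F has_real_derivative f x) (at x)" "continuous_on UNIV f"
  shows "(LBINT y:{a..<c}. f y) = F (max a c) - F a"
proof (cases "a < c")
  case True
  have "(LBINT y:{a..c}. f y) = F c - F a"
    using True assms by (intro LBINT_FTC_Icc) (auto intro: continuous_on_subset)
  then show ?thesis using True by (simp add: LBINT_Icc_eq_Ico)
qed (auto simp: set_lebesgue_integral_def)

lemma (in prob_space) set_integral_expectation_swap:
  fixes f :: "real \<Rightarrow> real \<Rightarrow> 'b::{banach, second_countable_topology}"
  assumes [measurable]: "(\<lambda>p. f (fst p) (snd p)) \<in> borel_measurable (borel \<Otimes>\<^sub>M borel)"
    and [measurable]: "Y \<in> borel_measurable M"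
    and g: "integrable M g"
    and bound: "\<And>\<omega> s. s \<in> {a..b} \<Longrightarrow> norm (f (Y \<omega>) s) \<le> g \<omega>"
  shows "(LBINT s:{a..b}. (\<integral>\<omega>. f (Y \<omega>) s \<partial>M)) = (\<integral>\<omega>. (LBINT s:{a..b}. f (Y \<omega>) s) \<partial>M)"
    and "set_integrable lborel {a..b} (\<lambda>s. \<integral>\<omega>. f (Y \<omega>) s \<partial>M)"
    and "integrable M (\<lambda>\<omega>. LBINT s:{a..b}. f (Y \<omega>) s)"
proof -
  interpret L: pair_sigma_finite M lborel ..
  define F where "F = (\<lambda>(\<omega>,s). indicator {a..b} s *\<^sub>R f (Y \<omega>) s)"
  have "(\<lambda>p. (Y (fst p), snd p)) \<in> measurable (M \<Otimes>\<^sub>M lborel) (borel \<Otimes>\<^sub>M borel)"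
    by measurable
  from measurable_compose[OF this assms(1)]
  have [measurable]: "(\<lambda>p. f (Y (fst p)) (snd p)) \<in> borel_measurable (M \<Otimes>\<^sub>M lborel)"
    by simp
  have [measurable]: "F \<in> borel_measurable (M \<Otimes>\<^sub>M lborel)"
    unfolding F_def case_prod_unfold by measurable
  have nb: "norm (F (\<omega>, s)) \<le> g \<omega> * indicator {a..b} s" for \<omega> s
    using bound by (auto simp: F_def indicator_def)
  have gi: "integrable lborel (\<lambda>s. g \<omega> * indicator {a..b} s)" for \<omega>
    by (cases "a \<le> b") auto
  have [measurable]: "f (Y \<omega>) \<in> borel_measurable borel" for \<omega>
    using measurable_compose[OF measurable_Pair1'[of "Y \<omega>" borel borel] assms(1)] by simp
  have Fm: "(\<lambda>s. F (\<omega>, s)) \<in> borel_measurable lborel" for \<omega>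
    by (simp add: F_def)
  have si: "integrable lborel (\<lambda>s. F (\<omega>, s))" for \<omega>
    by (rule Bochner_Integration.integrable_bound[OF gi[of \<omega>]])
       (use Fm nb order_trans[OF nb abs_ge_self] in auto)
  have int: "integrable (M \<Otimes>\<^sub>M lborel) F"
  proof (rule L.Fubini_integrable)
    show "integrable M (\<lambda>\<omega>. \<integral>s. norm (F (\<omega>, s)) \<partial>lborel)"
    proof (rule Bochner_Integration.integrable_bound)
      show "integrable M (\<lambda>\<omega>. g \<omega> * (\<integral>s. indicator {a..b} s \<partial>lborel))"
        using g by auto
      have "norm (\<integral>s. norm (F (\<omega>, s)) \<partial>lborel) \<le> norm (g \<omega> * (\<integral>s. indicator {a..b} s \<partial>lborel))" for \<omega>
      proof -
        have "0 \<le> (\<integral>s. norm (F (\<omega>, s)) \<partial>lborel)" by (rule integral_nonneg_AE) auto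
        moreover have "(\<integral>s. norm (F (\<omega>, s)) \<partial>lborel) \<le> (\<integral>s. g \<omega> * indicator {a..b} s \<partial>lborel)"
          by (rule integral_mono) (use si gi nb in auto)
        moreover have "(\<integral>s. g \<omega> * indicator {a..b} s \<partial>lborel) = g \<omega> * (\<integral>s. indicator {a..b} s \<partial>lborel)"
          by (rule Bochner_Integration.integral_mult_right_zero)
        ultimately show ?thesis by (metis abs_of_nonneg order_trans real_norm_def abs_ge_self)
      qed
      then show "AE \<omega> in M. norm (\<integral>s. norm (F (\<omega>, s)) \<partial>lborel) \<le> norm (g \<omega> * (\<integral>s. indicator {a..b} s \<partial>lborel))"
        by auto
    qed simp
  qed (use si in auto)
  have inner: "(\<integral>\<omega>. F (\<omega>, s) \<partial>M) = indicator {a..b} s *\<^sub>R (\<integral>\<omega>. f (Y \<omega>) s \<partial>M)" for s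
    by (simp add: F_def)
  have "(\<integral>s. (\<integral>\<omega>. F (\<omega>, s) \<partial>M) \<partial>lborel) = (\<integral>\<omega>. (\<integral>s. F (\<omega>, s) \<partial>lborel) \<partial>M)"
    using L.Fubini_integral[of "\<lambda>a b. F (a, b)"] int by (simp add: case_prod_unfold)
  then show "(LBINT s:{a..b}. (\<integral>\<omega>. f (Y \<omega>) s \<partial>M)) = (\<integral>\<omega>. (LBINT s:{a..b}. f (Y \<omega>) s) \<partial>M)"
    by (simp add: inner set_lebesgue_integral_def F_def)
  have "integrable lborel (\<lambda>s. \<integral>\<omega>. F (\<omega>, s) \<partial>M)"
    using L.integrable_snd[of "\<lambda>a b. F (a, b)"] int by (simp add: case_prod_unfold)
  then show "set_integrable lborel {a..b} (\<lambda>s. \<integral>\<omega>. f (Y \<omega>) s \<partial>M)"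
    by (simp add: inner set_integrable_def)
  have "integrable M (\<lambda>\<omega>. \<integral>s. F (\<omega>, s) \<partial>lborel)"
    using L.integrable_fst[of "\<lambda>a b. F (a, b)"] int by (simp add: case_prod_unfold)
  then show "integrable M (\<lambda>\<omega>. LBINT s:{a..b}. f (Y \<omega>) s)"
    by (simp add: F_def set_lebesgue_integral_def)
qed

section \<open>The data of the theorem as expectations of the step\<close>

text \<open>The Huber function. It enters because \<open>m' = \<eta>\<close> and \<open>\<eta>' = - \<mu>\<close>, so that \<open>m L\<close> is the expectation at \<open>X\<close> of
  the even function that is quadratic up to \<open>L\<close> and linear with matching slope beyond.\<close>

definition huber :: "real \<Rightarrow> real \<Rightarrow> real" where
  "huber L x = (if \<bar>x\<bar> \<le> L then x\<^sup>2 / 2 else L * \<bar>x\<bar> - L\<^sup>2 / 2)"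

lemma huber_measurable [measurable]:
  "(\<lambda>p. huber (fst p) (snd p)) \<in> borel_measurable (borel \<Otimes>\<^sub>M borel)"
  unfolding huber_def by measurable

lemma huber_measurable' [measurable (raw)]:
  assumes [measurable]: "f \<in> borel_measurable N" "g \<in> borel_measurable N"
  shows "(\<lambda>x. huber (f x) (g x)) \<in> borel_measurable N"
  unfolding huber_def by measurable

lemma huber_0 [simp]: "0 \<le> L \<Longrightarrow> huber L 0 = 0"
  by (simp add: huber_def)

lemma huber_minus [simp]: "huber L (- x) = huber L x"
  by (simp add: huber_def)

lemma huber_abs [simp]: "huber L \<bar>x\<bar> = huber L x"
  by (simp add: huber_def)

lemma huber_nonneg: "0 \<le> L \<Longrightarrow> 0 \<le> huber L x"
proof -
  assume L: "0 \<le> L"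
  have "L\<^sup>2 / 2 \<le> L * \<bar>x\<bar>" if "L \<le> \<bar>x\<bar>"
  proof -
    have "L * L \<le> L * \<bar>x\<bar>" using that L by (intro mult_left_mono)
    moreover have "0 \<le> L * L" by simp
    ultimately show ?thesis unfolding power2_eq_square by linarith
  qed
  then show ?thesis by (auto simp: huber_def)
qed

lemma huber_le_linear: "0 \<le> L \<Longrightarrow> huber L x \<le> L * \<bar>x\<bar>"
proof -
  assume L: "0 \<le> L"
  have "x\<^sup>2 / 2 \<le> L * \<bar>x\<bar>" if "\<bar>x\<bar> \<le> L"
  proof -
    have "\<bar>x\<bar> * \<bar>x\<bar> \<le> L * \<bar>x\<bar>" using that by (intro mult_right_mono) auto
    moreover have "\<bar>x\<bar> * \<bar>x\<bar> = x\<^sup>2" by (simp add: power2_eq_square)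
    moreover have "0 \<le> x\<^sup>2" by simp
    ultimately show ?thesis by linarith
  qed
  then show ?thesis by (auto simp: huber_def)
qed

text \<open>The kink of \<open>max 0\<close> is smoothed out by the square; only the point \<open>s = y\<close> needs an argument of its own.\<close>

lemma DERIV_half_square_pos_part:
  "((\<lambda>s. - (max 0 (y - s))\<^sup>2 / 2) has_real_derivative max 0 (y - s)) (at (s::real))"
proof -
  have *: "((\<lambda>z. (max 0 z)\<^sup>2 / 2) has_real_derivative max 0 z) (at z)" for z :: real
  proof (cases z "0::real" rule: linorder_cases)
    case less
    have "((\<lambda>z::real. 0) has_real_derivative 0) (at z)" by simp
    then have "((\<lambda>z. (max 0 z)\<^sup>2 / 2) has_real_derivative 0) (at z)"
      by (rule has_field_derivative_transform_within_open[of _ _ _ "{..<0}"]) (use less in auto)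
    with less show ?thesis by simp
  next
    case greater
    have "((\<lambda>z::real. z\<^sup>2 / 2) has_real_derivative z) (at z)"
      by (auto intro!: derivative_eq_intros)
    then have "((\<lambda>z. (max 0 z)\<^sup>2 / 2) has_real_derivative z) (at z)"
      by (rule has_field_derivative_transform_within_open[of _ _ _ "{0<..}"]) (use greater in auto)
    with greater show ?thesis by simp
  next
    case equal
    have "((\<lambda>h::real. (max 0 h)\<^sup>2 / 2 / h) \<longlongrightarrow> 0) (at 0)"
    proof (rule Lim_null_comparison)
      show "\<forall>\<^sub>F h::real in at 0. norm ((max 0 h)\<^sup>2 / 2 / h) \<le> \<bar>h\<bar>"
        by (intro always_eventually) (auto simp: max_def power2_eq_square)
      show "((\<lambda>h::real. \<bar>h\<bar>) \<longlongrightarrow> 0) (at 0)"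
        by (auto intro!: tendsto_eq_intros)
    qed
    with equal show ?thesis by (simp add: DERIV_def)
  qed
  have "((\<lambda>s. y - s) has_real_derivative -1) (at s)"
    by (auto intro!: derivative_eq_intros)
  from DERIV_minus[OF DERIV_chain2[where f = "\<lambda>z. (max 0 z)\<^sup>2 / 2", OF *[of "y - s"] this]]
  show ?thesis by simp
qed

lemma LBINT_pos_part_eq_huber:
  assumes "0 \<le> x"
  shows "(LBINT s:{0..x}. max 0 (y - s)) = huber x (max 0 y)"
proof -
  have "(LBINT s:{0..x}. max 0 (y - s)) = - (max 0 (y - x))\<^sup>2 / 2 - - (max 0 (y - 0))\<^sup>2 / 2"
    by (rule LBINT_FTC_Icc[OF DERIV_half_square_pos_part]) (use assms in \<open>auto intro!: continuous_intros\<close>)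
  also have "\<dots> = huber x (max 0 y)"
    using assms by (auto simp: huber_def max_def power2_eq_square field_simps)
  finally show ?thesis .
qed

locale integrable_step = prob_space M for M :: "'w measure" +
  fixes X :: "'w \<Rightarrow> int"
  assumes integrable_X: "integrable M (\<lambda>\<omega>. real_of_int (X \<omega>))"
begin

lemma measurable_X [measurable]: "(\<lambda>\<omega>. real_of_int (X \<omega>)) \<in> borel_measurable M"
  using integrable_X by auto

lemma mu_plus_eq: "mu_plus M X y = prob {\<omega> \<in> space M. real_of_int (X \<omega>) > y}"
  and mu_minus_eq: "mu_minus M X y = prob {\<omega> \<in> space M. - real_of_int (X \<omega>) > y}"
  unfolding mu_plus_def mu_minus_def by (auto intro!: arg_cong[of _ _ prob])

lemma tail_expectation:
  assumes Y: "integrable M Y" and F: "\<And>x. (F has_real_derivative f x) (at x)"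
    and cont: "continuous_on UNIV f" and K: "\<And>y. \<bar>f y\<bar> \<le> K"
  shows "(LBINT y:{a..}. prob {\<omega> \<in> space M. Y \<omega> > y} * f y) = (\<integral>\<omega>. F (max a (Y \<omega>)) - F a \<partial>M)"
  using integral_tail_mult(1)[where h = f and a = a, OF Y _ K] borel_measurable_continuous_onI[OF cont]
  by (simp add: LBINT_FTC_Ico[OF F cont])

lemma tail_expectation_bounded:
  assumes Y: "integrable M Y" and F: "\<And>x. (F has_real_derivative f x) (at x)"
    and cont: "continuous_on UNIV f" and K: "\<And>y. \<bar>f y\<bar> \<le> K"
  shows "(LBINT y:{a..R}. prob {\<omega> \<in> space M. Y \<omega> > y} * f y) = (\<integral>\<omega>. F (max a (min R (Y \<omega>))) - F a \<partial>M)"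
    and "set_integrable lborel {a..R} (\<lambda>y. prob {\<omega> \<in> space M. Y \<omega> > y} * f y)"
proof -
  have [measurable]: "f \<in> borel_measurable borel"
    by (rule borel_measurable_continuous_onI[OF cont])
  have K': "\<bar>indicator {..<R} y * f y\<bar> \<le> K" for y
    using K[of y] K[of 0] by (auto simp: indicator_def)
  have "(LBINT y:{a..R}. prob {\<omega> \<in> space M. Y \<omega> > y} * f y) =
      (LBINT y:{a..<R}. prob {\<omega> \<in> space M. Y \<omega> > y} * f y)"
    by (rule LBINT_Icc_eq_Ico)
  also have "\<dots> = (LBINT y:{a..}. prob {\<omega> \<in> space M. Y \<omega> > y} * (indicator {..<R} y * f y))"
    unfolding set_lebesgue_integral_def
    by (rule Bochner_Integration.integral_cong) (auto simp: indicator_def)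
  also have "\<dots> = (\<integral>\<omega>. (LBINT y:{a..<Y \<omega>}. indicator {..<R} y * f y) \<partial>M)"
    by (rule integral_tail_mult(1)[OF Y _ K']) simp
  also have "\<dots> = (\<integral>\<omega>. (LBINT y:{a..<min R (Y \<omega>)}. f y) \<partial>M)"
    unfolding set_lebesgue_integral_def
    by (intro Bochner_Integration.integral_cong) (auto simp: indicator_def)
  finally show "(LBINT y:{a..R}. prob {\<omega> \<in> space M. Y \<omega> > y} * f y) = (\<integral>\<omega>. F (max a (min R (Y \<omega>))) - F a \<partial>M)"
    by (simp add: LBINT_FTC_Ico[OF F cont])
  have "set_integrable lborel {a..} (\<lambda>y. prob {\<omega> \<in> space M. Y \<omega> > y} * f y)"
    by (rule integral_tail_mult(2)[OF Y _ K]) simp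
  then show "set_integrable lborel {a..R} (\<lambda>y. prob {\<omega> \<in> space M. Y \<omega> > y} * f y)"
    by (rule set_integrable_subset) auto
qed

lemma eta_plus_eq: "eta_plus M X x = expectation (\<lambda>\<omega>. max 0 (real_of_int (X \<omega>) - x))"
  and eta_minus_eq: "eta_minus M X x = expectation (\<lambda>\<omega>. max 0 (- real_of_int (X \<omega>) - x))"
proof -
  have *: "(LBINT y:{x..}. prob {\<omega> \<in> space M. Y \<omega> > y}) = expectation (\<lambda>\<omega>. max 0 (Y \<omega> - x))"
    if "integrable M Y" for Y
  proof -
    have "(LBINT y:{x..}. prob {\<omega> \<in> space M. Y \<omega> > y} * 1) = expectation (\<lambda>\<omega>. max x (Y \<omega>) - x)"
      by (rule tail_expectation[OF that, where F = "\<lambda>y. y" and K = 1]) auto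
    also have "\<dots> = expectation (\<lambda>\<omega>. max 0 (Y \<omega> - x))"
      by (rule Bochner_Integration.integral_cong) auto
    finally show ?thesis by simp
  qed
  show "eta_plus M X x = expectation (\<lambda>\<omega>. max 0 (real_of_int (X \<omega>) - x))"
    unfolding eta_plus_def mu_plus_eq by (rule *) (rule integrable_X)
  show "eta_minus M X x = expectation (\<lambda>\<omega>. max 0 (- real_of_int (X \<omega>) - x))"
    unfolding eta_minus_def mu_minus_eq by (rule *) (use integrable_X in auto)
qed

lemma eta_eq:
  assumes "0 \<le> x"
  shows "eta M X x = expectation (\<lambda>\<omega>. max 0 (\<bar>real_of_int (X \<omega>)\<bar> - x))"
proof -
  have i: "integrable M (\<lambda>\<omega>. max 0 (real_of_int (X \<omega>) - x))"
      "integrable M (\<lambda>\<omega>. max 0 (- real_of_int (X \<omega>) - x))"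
    using integrable_X by auto
  have "eta M X x = expectation (\<lambda>\<omega>. max 0 (real_of_int (X \<omega>) - x) + max 0 (- real_of_int (X \<omega>) - x))"
    by (simp add: eta_def eta_plus_eq eta_minus_eq Bochner_Integration.integral_add[OF i])
  also have "\<dots> = expectation (\<lambda>\<omega>. max 0 (\<bar>real_of_int (X \<omega>)\<bar> - x))"
    using assms by (intro Bochner_Integration.integral_cong) auto
  finally show ?thesis .
qed

lemma integrable_huber:
  assumes "0 \<le> L" and Y: "integrable M Y"
  shows "integrable M (\<lambda>\<omega>. huber L (Y \<omega>))"
proof (rule Bochner_Integration.integrable_bound)
  have [measurable]: "Y \<in> borel_measurable M" using Y by auto
  show "(\<lambda>\<omega>. huber L (Y \<omega>)) \<in> borel_measurable M" by simp
  show "integrable M (\<lambda>\<omega>. L * \<bar>Y \<omega>\<bar>)" using Y by auto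
  show "AE \<omega> in M. norm (huber L (Y \<omega>)) \<le> norm (L * \<bar>Y \<omega>\<bar>)"
    using huber_le_linear[OF assms(1)] huber_nonneg[OF assms(1)] assms(1)
    by (auto simp: abs_mult)
qed

lemma m_plus_eq:
    "0 \<le> x \<Longrightarrow> m_plus M X x = expectation (\<lambda>\<omega>. huber x (max 0 (real_of_int (X \<omega>))))" (is "_ \<Longrightarrow> ?P")
  and m_minus_eq:
    "0 \<le> x \<Longrightarrow> m_minus M X x = expectation (\<lambda>\<omega>. huber x (max 0 (- real_of_int (X \<omega>))))" (is "_ \<Longrightarrow> ?N")
proof -
  assume x: "0 \<le> x"
  have *: "(LBINT s:{0..x}. expectation (\<lambda>\<omega>. max 0 (Y \<omega> - s))) = expectation (\<lambda>\<omega>. huber x (max 0 (Y \<omega>)))"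
    if Y: "integrable M Y" for Y :: "'w \<Rightarrow> real"
  proof -
    have "(LBINT s:{0..x}. expectation (\<lambda>\<omega>. max 0 (Y \<omega> - s))) = expectation (\<lambda>\<omega>. LBINT s:{0..x}. max 0 (Y \<omega> - s))"
      by (rule set_integral_expectation_swap(1)[where f = "\<lambda>y s. max 0 (y - s)" and g = "\<lambda>\<omega>. \<bar>Y \<omega>\<bar>"])
         (use Y in auto)
    then show ?thesis by (simp add: LBINT_pos_part_eq_huber[OF x])
  qed
  show ?P unfolding m_plus_def eta_plus_eq by (rule *) (rule integrable_X)
  show ?N unfolding m_minus_def eta_minus_eq by (rule *) (use integrable_X in auto)
qed

lemma m_total_eq:
  assumes "0 \<le> x"
  shows "m_total M X x = expectation (\<lambda>\<omega>. huber x (real_of_int (X \<omega>)))"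
proof -
  have i: "integrable M (\<lambda>\<omega>. huber x (max 0 (real_of_int (X \<omega>))))"
      "integrable M (\<lambda>\<omega>. huber x (max 0 (- real_of_int (X \<omega>))))"
    using integrable_X by (auto intro!: integrable_huber assms)
  have "m_total M X x = expectation (\<lambda>\<omega>. huber x (max 0 (real_of_int (X \<omega>))) + huber x (max 0 (- real_of_int (X \<omega>))))"
    using assms by (simp add: m_total_def m_plus_eq m_minus_eq Bochner_Integration.integral_add[OF i])
  also have "\<dots> = expectation (\<lambda>\<omega>. huber x (real_of_int (X \<omega>)))"
    using assms by (intro Bochner_Integration.integral_cong) (auto simp: max_def)
  finally show ?thesis .
qed

text \<open>\<open>\<integral>_0^R \<mu>(y) sin (t y) dy\<close> is the expectation of \<open>(1 - cos (t min(R, |X|))) / t\<close>, which for each outcome is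
  constant in \<open>R\<close> from \<open>|X|\<close> on; so the improper integral converges by dominated convergence.\<close>

lemma alpha_eq:
  assumes t: "0 < t"
  shows "alpha M X t = expectation (\<lambda>\<omega>. 1 - cos (t * real_of_int (X \<omega>))) / t"
proof -
  define F where "F = (\<lambda>y. - cos (t * y) / t)"
  have F: "(F has_real_derivative sin (t * y)) (at y)" for y
    unfolding F_def using t by (auto intro!: derivative_eq_intros)
  have c: "continuous_on UNIV (\<lambda>y. sin (t * y))" by (intro continuous_intros)
  have X': "integrable M (\<lambda>\<omega>. - real_of_int (X \<omega>))" using integrable_X by auto
  note P = tail_expectation_bounded[OF integrable_X F c abs_sin_le_one, where a = 0]
  note N = tail_expectation_bounded[OF X' F c abs_sin_le_one, where a = 0]
  have [measurable]: "F \<in> borel_measurable borel"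
    unfolding F_def by measurable
  have Fb: "\<bar>F y\<bar> \<le> 1 / t" for y
    using t by (auto simp: F_def divide_right_mono)
  have i: "integrable M (\<lambda>\<omega>. F (Y \<omega>) - F 0)" if [measurable]: "Y \<in> borel_measurable M" for Y
    by (rule integrable_const_bound[where B = "2 / t"])
       (use Fb order_trans[OF abs_triangle_ineq4 add_mono[OF Fb Fb]] in auto)
  have eq: "(LBINT y:{0..R}. mu M X y * sin (t * y)) =
      expectation (\<lambda>\<omega>. (1 - cos (t * min R \<bar>real_of_int (X \<omega>)\<bar>)) / t)" if "0 \<le> R" for R
  proof -
    have "(LBINT y:{0..R}. mu M X y * sin (t * y)) =
        (\<integral>\<omega>. F (max 0 (min R (real_of_int (X \<omega>)))) - F 0 \<partial>M) + (\<integral>\<omega>. F (max 0 (min R (- real_of_int (X \<omega>)))) - F 0 \<partial>M)"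
      unfolding mu_def mu_plus_eq mu_minus_eq distrib_right
      by (subst set_integral_add) (use P N in auto)
    also have "\<dots> = expectation (\<lambda>\<omega>. (F (max 0 (min R (real_of_int (X \<omega>)))) - F 0) + (F (max 0 (min R (- real_of_int (X \<omega>)))) - F 0))"
      by (rule Bochner_Integration.integral_add[symmetric]; rule i) measurable
    also have "\<dots> = expectation (\<lambda>\<omega>. (1 - cos (t * min R \<bar>real_of_int (X \<omega>)\<bar>)) / t)"
      using that by (intro Bochner_Integration.integral_cong; cases "R = 0")
        (auto simp: F_def max_def min_def diff_divide_distrib)
    finally show ?thesis .
  qed
  have "((\<lambda>R. expectation (\<lambda>\<omega>. (1 - cos (t * min R \<bar>real_of_int (X \<omega>)\<bar>)) / t)) \<longlongrightarrow>
      expectation (\<lambda>\<omega>. (1 - cos (t * real_of_int (X \<omega>))) / t)) at_top"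
  proof (rule integral_dominated_convergence_at_top[where w = "\<lambda>_. 2 / t"])
    show "AE \<omega> in M. ((\<lambda>R. (1 - cos (t * min R \<bar>real_of_int (X \<omega>)\<bar>)) / t) \<longlongrightarrow> (1 - cos (t * real_of_int (X \<omega>))) / t) at_top"
    proof (rule AE_I2)
      fix \<omega>
      have "\<forall>\<^sub>F R in at_top. (1 - cos (t * min R \<bar>real_of_int (X \<omega>)\<bar>)) / t = (1 - cos (t * real_of_int (X \<omega>))) / t"
        using eventually_ge_at_top[of "\<bar>real_of_int (X \<omega>)\<bar>"]
        by eventually_elim (auto simp: min_def abs_if)
      then show "((\<lambda>R. (1 - cos (t * min R \<bar>real_of_int (X \<omega>)\<bar>)) / t) \<longlongrightarrow> (1 - cos (t * real_of_int (X \<omega>))) / t) at_top"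
        by (rule tendsto_eventually)
    qed
    have "\<bar>1 - cos x\<bar> \<le> 2" for x :: real
      using cos_ge_minus_one[of x] cos_le_one[of x] by linarith
    then show "\<forall>\<^sub>F R in at_top. AE \<omega> in M. norm ((1 - cos (t * min R \<bar>real_of_int (X \<omega>)\<bar>)) / t) \<le> 2 / t"
      using t by (auto intro!: always_eventually AE_I2 divide_right_mono)
  qed (simp_all)
  then have "((\<lambda>R. LBINT y:{0..R}. mu M X y * sin (t * y)) \<longlongrightarrow>
      expectation (\<lambda>\<omega>. (1 - cos (t * real_of_int (X \<omega>))) / t)) at_top"
    by (rule Lim_transform_eventually) (use eventually_ge_at_top[of 0] in eventually_elim, use eq in auto)
  then show ?thesis
    unfolding alpha_def by (subst tendsto_Lim) auto
qed

text \<open>The tail formula yields \<open>X - sin (t X) / t\<close>, split into positive and negative part; the zero mean removes the linear term.\<close>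

lemma gamma_eq:
  assumes t: "0 < t" and mean0: "expectation (\<lambda>\<omega>. real_of_int (X \<omega>)) = 0"
  shows "gamma M X t = - expectation (\<lambda>\<omega>. sin (t * real_of_int (X \<omega>))) / t"
proof -
  define F where "F = (\<lambda>y. y - sin (t * y) / t)"
  have F: "(F has_real_derivative (1 - cos (t * y))) (at y)" for y
    unfolding F_def using t by (auto intro!: derivative_eq_intros)
  have c: "continuous_on UNIV (\<lambda>y. 1 - cos (t * y))" by (intro continuous_intros)
  have b: "\<bar>1 - cos (t * y)\<bar> \<le> 2" for y
    using cos_ge_minus_one[of "t * y"] cos_le_one[of "t * y"] by linarith
  have X': "integrable M (\<lambda>\<omega>. - real_of_int (X \<omega>))" using integrable_X by auto
  have isin: "integrable M (\<lambda>\<omega>. sin (t * Y \<omega>) / t)" if [measurable]: "Y \<in> borel_measurable M" for Y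
    by (rule integrable_const_bound[where B = "1 / t"]) (use t in \<open>auto simp: divide_right_mono\<close>)
  have i: "integrable M (\<lambda>\<omega>. F (max 0 (Y \<omega>)) - F 0)" if "integrable M Y" for Y
    unfolding F_def using that by (auto intro!: isin Bochner_Integration.integrable_diff)
  have "gamma M X t = (\<integral>\<omega>. F (max 0 (real_of_int (X \<omega>))) - F 0 \<partial>M) - (\<integral>\<omega>. F (max 0 (- real_of_int (X \<omega>))) - F 0 \<partial>M)"
    unfolding gamma_def beta_plus_def beta_minus_def mu_plus_eq mu_minus_eq
    by (simp add: tail_expectation[OF integrable_X F c b] tail_expectation[OF X' F c b])
  also have "\<dots> = expectation (\<lambda>\<omega>. (F (max 0 (real_of_int (X \<omega>))) - F 0) - (F (max 0 (- real_of_int (X \<omega>))) - F 0))"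
    by (rule Bochner_Integration.integral_diff[symmetric]; rule i) (use integrable_X X' in auto)
  also have "\<dots> = expectation (\<lambda>\<omega>. real_of_int (X \<omega>) - sin (t * real_of_int (X \<omega>)) / t)"
    by (intro Bochner_Integration.integral_cong) (auto simp: F_def max_def)
  also have "\<dots> = - expectation (\<lambda>\<omega>. sin (t * real_of_int (X \<omega>))) / t"
    by (subst Bochner_Integration.integral_diff) (use integrable_X isin mean0 in auto)
  finally show ?thesis .
qed

end

section \<open>Pointwise inequalities for the cosine and the Huber function\<close>

lemma huber_1_alt: "huber 1 z = ((max 0 (\<bar>z\<bar> - 1))\<^sup>2 * (-1) + z\<^sup>2) / 2"
  by (auto simp: huber_def max_def power2_eq_square algebra_simps)

lemma one_minus_cos_le_2: "1 - cos (x::real) \<le> 2" 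
  using cos_ge_minus_one[of x] by linarith

lemma one_minus_cos_le_sq: "1 - cos (x::real) \<le> x\<^sup>2 / 2"
proof -
  have "1 - cos x = 2 * (sin (x/2))\<^sup>2" using cos_double_sin[of "x/2"] by simp
  also have "\<dots> \<le> 2 * (x/2)\<^sup>2"
    using abs_sin_x_le_abs_x[of "x/2"] by (intro mult_left_mono) (auto simp only: abs_le_square_iff)
  finally show ?thesis by (simp add: power2_eq_square)
qed

lemma abs_sin_minus_le_cube:
  assumes "0 \<le> (y::real)" shows "\<bar>sin y - y\<bar> \<le> y ^ 3 / 6"
proof -
  have "(\<Sum>m<3. sin_coeff m * y ^ m) = y" by (simp add: numeral_3_eq_3 sin_coeff_def)
  moreover have "inverse (fact 3) * \<bar>y\<bar> ^ 3 = y ^ 3 / 6" using assms by (simp add: fact_numeral)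
  ultimately show ?thesis using Maclaurin_sin_bound[of y 3] by (simp only:)
qed

text \<open>With \<open>1 - cos x = 2 (sin (x/2))^2\<close> and \<open>sin y \<ge> y - y^3/6 \<ge> 5 y / 6\<close> on \<open>[0, 1]\<close>, the constant is
  \<open>25/72 > 1/3\<close>.\<close>

lemma one_minus_cos_ge_sq:
  assumes "\<bar>x\<bar> \<le> (2::real)" shows "x\<^sup>2 / 3 \<le> 1 - cos x"
proof -
  define y where "y = \<bar>x\<bar> / 2"
  have y: "0 \<le> y" "y \<le> 1" using assms by (auto simp: y_def)
  have "\<bar>sin y - y\<bar> \<le> y ^ 3 / 6" using abs_sin_minus_le_cube y by simp
  moreover have "y ^ 3 \<le> y"
    using power_decreasing[of 1 3 y] y by simp
  ultimately have s: "5 / 6 * y \<le> sin y" by linarith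
  have "1 - cos x = 2 * (sin y)\<^sup>2" using cos_double_sin[of y] by (simp add: y_def)
  moreover have "(5 / 6 * y)\<^sup>2 \<le> (sin y)\<^sup>2" using s y(1) by (intro power_mono) auto
  moreover have "(5/6 * y)\<^sup>2 = 25 / 144 * x\<^sup>2"
    by (simp add: y_def power2_eq_square)
  moreover have "0 \<le> x\<^sup>2" by simp
  ultimately show ?thesis by linarith
qed

lemma one_minus_cos_le_min: "1 - cos (x::real) \<le> 2 * min 1 (x\<^sup>2)"
  using one_minus_cos_le_2[of x] one_minus_cos_le_sq[of x] zero_le_power2[of x] by linarith

text \<open>The cosine controls \<open>h\<close> where \<open>z\<close> is small, but oscillates for large \<open>z\<close>, where the excess over \<open>1\<close> takes over.\<close>

lemma huber_1_le_cos_excess: "huber 1 z / 3 \<le> (1 - cos z) + max 0 (\<bar>z\<bar> - 1)"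
proof -
  consider "\<bar>z\<bar> \<le> 1" | "1 < \<bar>z\<bar>" "\<bar>z\<bar> \<le> 2" | "2 < \<bar>z\<bar>" by linarith
  then show ?thesis
  proof cases
    case 1
    then have "huber 1 z = z\<^sup>2 / 2" by (simp add: huber_def)
    moreover have "0 \<le> max 0 (\<bar>z\<bar> - 1)" by simp
    ultimately show ?thesis using 1 one_minus_cos_ge_sq[of z] cos_le_one[of z] by linarith
  next
    case 2
    have "1 * \<bar>z\<bar> \<le> \<bar>z\<bar> * \<bar>z\<bar>" using 2 by (intro mult_right_mono) auto
    then have "\<bar>z\<bar> \<le> z\<^sup>2" by (simp add: power2_eq_square)
    then show ?thesis using 2 one_minus_cos_ge_sq[of z] by (simp add: huber_def)
  next
    case 3
    then have "huber 1 z = \<bar>z\<bar> - 1/2" by (simp add: huber_def)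
    then show ?thesis using 3 cos_le_one[of z] by linarith
  qed
qed

lemma excess_le_huber_1: "max 0 (\<bar>z\<bar> - 1) \<le> huber 1 z"
  by (auto simp: huber_def max_def)

lemma huber_1_le_abs: "huber 1 z \<le> \<bar>z\<bar>"
  using huber_le_linear[of 1 z] by simp

lemma min_sq_le_huber_1: "min 1 (z\<^sup>2) \<le> 2 * huber 1 z"
  by (auto simp: huber_def min_def)

lemma huber_1_le_sq: "huber 1 z \<le> z\<^sup>2 / 2"
proof -
  have "0 \<le> (\<bar>z\<bar> - 1)\<^sup>2" by simp
  then have "2 * \<bar>z\<bar> - 1 \<le> z\<^sup>2" by (simp add: power2_eq_square algebra_simps)
  then show ?thesis by (auto simp: huber_def)
qed

text \<open>The first bound is convexity with \<open>h 0 = 0\<close>. In the mean the two bounds say that \<open>E (h (t X))\<close> grows at least linearly and at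
  most quadratically in \<open>t\<close>, which makes all quantities comparable within a block \<open>[s, 4s]\<close>.\<close>

lemma huber_1_scale:
  assumes "1 \<le> l"
  shows "l * huber 1 z \<le> huber 1 (l * z)" and "huber 1 (l * z) \<le> l\<^sup>2 * huber 1 z"
proof -
  define y where "y = \<bar>z\<bar>"
  have y0: "0 \<le> y" by (simp add: y_def)
  have hz: "huber 1 z = (if y \<le> 1 then y * y / 2 else y - 1/2)"
    by (simp add: huber_def y_def power2_eq_square)
  have hl: "huber 1 (l * z) = (if l * y \<le> 1 then (l * y) * (l * y) / 2 else l * y - 1/2)"
    using assms by (simp add: huber_def y_def power2_eq_square abs_mult mult_ac)
  have yl: "y \<le> l * y" using assms y0 by (simp add: mult_left_le_one_le mult_le_cancel_right1)
  consider "l * y \<le> 1" | "1 < l * y" "y \<le> 1" | "1 < y" by linarith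
  then have "l * huber 1 z \<le> huber 1 (l * z) \<and> huber 1 (l * z) \<le> l\<^sup>2 * huber 1 z"
  proof cases
    case 1
    have "l * (y * y) \<le> l * (l * (y * y))" using assms y0
      by (intro mult_left_mono) (auto simp: mult_le_cancel_right1)
    then show ?thesis using 1 yl by (simp add: hz hl power2_eq_square mult_ac)
  next
    case 2
    have "0 \<le> (l * y - 1) * (l * y - 1)" by simp
    then have a: "2 * (l * y) - 1 \<le> l * l * (y * y)" by (simp add: algebra_simps)
    have "(l * y) * y \<le> (l * y) * 1" using 2 by (intro mult_left_mono) auto
    then have "l * y * y \<le> 2 * (l * y) - 1" using 2 by simp
    then show ?thesis using 2 a by (simp add: hz hl power2_eq_square mult_ac)
  next
    case 3
    then have ly: "1 < l * y" using yl by linarith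
    have "l * y - l / 2 \<le> l * y - 1 / 2" using assms by simp
    moreover have "l * y - 1/2 \<le> l * l * (y - 1/2)"
    proof -
      have "0 \<le> (l - 1) * (l * y - (l + 1)/2)"
      proof (rule mult_nonneg_nonneg)
        have "l * 1 \<le> l * y" using 3 assms by (intro mult_left_mono) auto
        then have "l \<le> l * y" by simp
        moreover have "(l + 1) / 2 \<le> l" using assms by (simp add: field_simps)
        ultimately show "0 \<le> l * y - (l + 1)/2" by linarith
      qed (use assms in simp)
      also have "\<dots> = l * l * (y - 1/2) - (l * y - 1/2)" by (simp add: field_simps)
      finally show ?thesis by simp
    qed
    ultimately show ?thesis using 3 ly by (simp add: hz hl power2_eq_square right_diff_distrib)
  qed
  then show "l * huber 1 z \<le> huber 1 (l * z)" and "huber 1 (l * z) \<le> l\<^sup>2 * huber 1 z" by auto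
qed

text \<open>A discrete form of \<open>z h'(z) - h(z) = min(1, z^2) / 2\<close>. It identifies the truncated second moment, up to constants, with
  the increment of \<open>hmean t / t\<close> over a quadrupling block, without differentiating under the expectation.\<close>

lemma huber_1_quadruple:
  shows "min 1 (z\<^sup>2) \<le> huber 1 (4 * z) - 4 * huber 1 z"
    and "huber 1 (4 * z) - 4 * huber 1 z \<le> 6 * min 1 (z\<^sup>2)"
proof -
  define y where "y = \<bar>z\<bar>"
  have y0: "0 \<le> y" and zy: "z\<^sup>2 = y * y" by (auto simp: y_def power2_eq_square)
  have hz: "huber 1 z = (if y \<le> 1 then y * y / 2 else y - 1/2)"
    by (simp add: huber_def y_def power2_eq_square)
  have hl: "huber 1 (4 * z) = (if 4 * y \<le> 1 then 8 * (y * y) else 4 * y - 1/2)"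
    by (simp add: huber_def y_def power2_eq_square abs_mult)
  consider "4 * y \<le> 1" | "1 < 4 * y" "y \<le> 1" | "1 < y" by linarith
  then have "min 1 (y * y) \<le> huber 1 (4 * z) - 4 * huber 1 z \<and> huber 1 (4 * z) - 4 * huber 1 z \<le> 6 * min 1 (y * y)"
  proof cases
    case 1
    then have "y * y \<le> 1" using y0 mult_le_one[of y y] by simp
    then show ?thesis using 1 y0 by (simp add: hz hl)
  next
    case 2
    then have yy: "y * y \<le> 1" using y0 mult_le_one[of y y] by simp
    have "0 \<le> (y - 1/4) * (y - 1/4)" by simp
    then have a: "4 * y - 1/2 - 2 * (y * y) \<le> 6 * (y * y)" by (simp add: algebra_simps)
    have "0 \<le> (1 - y) * (3 * y - 1/2)" using 2 by (intro mult_nonneg_nonneg) auto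
    also have "\<dots> = 3 * y - 1/2 - 3 * (y * y) + y / 2" by (simp add: field_simps)
    finally have "y * y \<le> 4 * y - 1/2 - 2 * (y * y)" using 2 by linarith
    then show ?thesis using 2 yy a by (simp add: hz hl)
  next
    case 3
    then have yy: "1 \<le> y * y" using mult_mono[of 1 y 1 y] by simp
    then show ?thesis using 3 by (simp add: hz hl)
  qed
  then show "min 1 (z\<^sup>2) \<le> huber 1 (4 * z) - 4 * huber 1 z"
    and "huber 1 (4 * z) - 4 * huber 1 z \<le> 6 * min 1 (z\<^sup>2)" by (auto simp: zy)
qed

text \<open>The difference is \<open>2 sin(..) sin(..)\<close>; one sine is of order \<open>(s - t) x\<close> and the other of order \<open>min(1, t x)\<close>.
  Keeping the second factor gives a Lipschitz constant proportional to \<open>h\<close>, which the trivial bound \<open>(s - t) |x|\<close>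
  would not.\<close>

lemma abs_cos_diff_le_huber_1:
  assumes "0 < t" "t \<le> s" "s \<le> 2 * t"
  shows "\<bar>cos (t * x) - cos (s * x)\<bar> \<le> 4 * ((s - t) / t) * huber 1 (t * x)"
proof -
  define z where "z = t * x"
  define d where "d = (s - t) / t"
  have d: "0 \<le> d" "d \<le> 1" using assms by (auto simp: d_def field_simps)
  have sx: "s * x = z + d * z" using assms by (simp add: z_def d_def field_simps)
  have "cos (t * x) - cos (s * x) = 2 * sin (z + d * z / 2) * sin (d * z / 2)"
    using cos_diff_cos[of z "z + d * z"] by (simp add: sx z_def[symmetric] add_divide_distrib)
  then have "\<bar>cos (t * x) - cos (s * x)\<bar> = 2 * \<bar>sin (z + d * z / 2)\<bar> * \<bar>sin (d * z / 2)\<bar>"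
    by (simp add: abs_mult)
  also have "\<dots> \<le> 2 * \<bar>sin (z + d * z / 2)\<bar> * (d * \<bar>z\<bar> / 2)"
    using abs_sin_x_le_abs_x[of "d * z / 2"] d by (intro mult_left_mono) (auto simp: abs_mult)
  also have "\<dots> \<le> 2 * min 1 (2 * \<bar>z\<bar>) * (d * \<bar>z\<bar> / 2)"
  proof (intro mult_right_mono mult_left_mono)
    have "\<bar>sin (z + d * z / 2)\<bar> \<le> \<bar>z + d * z / 2\<bar>" by (rule abs_sin_x_le_abs_x)
    also have "\<dots> \<le> \<bar>z\<bar> + \<bar>d * z / 2\<bar>" by (rule abs_triangle_ineq)
    also have "\<bar>d * z / 2\<bar> \<le> \<bar>z\<bar>"
      using d mult_right_mono[of d 1 "\<bar>z\<bar>"] by (auto simp: abs_mult)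
    finally show "\<bar>sin (z + d * z / 2)\<bar> \<le> min 1 (2 * \<bar>z\<bar>)" by simp
  qed (use d in auto)
  also have "\<dots> = d * (min 1 (2 * \<bar>z\<bar>) * \<bar>z\<bar>)" by simp
  also have "\<dots> \<le> d * (4 * huber 1 z)"
  proof (rule mult_left_mono)
    show "min 1 (2 * \<bar>z\<bar>) * \<bar>z\<bar> \<le> 4 * huber 1 z"
    proof (cases "\<bar>z\<bar> \<le> 1")
      case True
      have "min 1 (2 * \<bar>z\<bar>) * \<bar>z\<bar> \<le> (2 * \<bar>z\<bar>) * \<bar>z\<bar>" by (intro mult_right_mono) auto
      also have "\<dots> = 4 * huber 1 z" using True by (simp add: huber_def power2_eq_square)
      finally show ?thesis .
    qed (auto simp: huber_def)
  qed (use d in auto)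
  also have "\<dots> = 4 * ((s - t) / t) * huber 1 (t * x)" by (simp add: d_def z_def)
  finally show ?thesis .
qed

lemma integral_one_minus_cos:
  fixes a b y :: real
  assumes "a \<le> b" "y \<noteq> 0"
  shows "(LBINT t:{a..b}. 1 - cos (t * y)) = (b - a) - (sin (b * y) - sin (a * y)) / y"
proof -
  have "(LBINT t:{a..b}. 1 - cos (t * y)) = (b - sin (b * y) / y) - (a - sin (a * y) / y)"
    by (rule LBINT_FTC_Icc[where F = "\<lambda>t. t - sin (t * y) / y"])
       (use assms in \<open>auto intro!: derivative_eq_intros continuous_intros\<close>)
  then show ?thesis by (simp add: diff_divide_distrib)
qed

text \<open>Pointwise \<open>1 - cos\<close> may vanish, but not on average over a block \<open>[s, 4s]\<close>: for \<open>|s y| \<le> 1\<close> the initial part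
  \<open>[s, 2s]\<close> already suffices, and for \<open>|s y| > 1\<close> the oscillating part of the integral is at most \<open>2 s\<close> out of \<open>3 s\<close>.\<close>

lemma integral_one_minus_cos_ge:
  fixes s y :: real
  assumes s: "0 < s"
  shows "s / 3 * min 1 ((s * y)\<^sup>2) \<le> (LBINT t:{s..4 * s}. 1 - cos (t * y))"
proof (cases "\<bar>s * y\<bar> \<le> 1")
  case True
  have int: "set_integrable lborel {a..b} (\<lambda>t. 1 - cos (t * y))" for a b
    by (rule borel_integrable_compact[OF compact_Icc, folded set_integrable_def])
       (auto intro!: continuous_intros simp: indicator_def)
  have "s / 3 * min 1 ((s * y)\<^sup>2) \<le> s * ((s * y)\<^sup>2 / 3)"
    using s by simp
  also have "\<dots> = (LBINT t:{s..2 * s}. (s * y)\<^sup>2 / 3)"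
    using s by (simp add: set_integral_const)
  also have "\<dots> \<le> (LBINT t:{s..2 * s}. 1 - cos (t * y))"
  proof (rule set_integral_mono)
    show "set_integrable lborel {s..2 * s} (\<lambda>t. (s * y)\<^sup>2 / 3)"
      by (rule borel_integrable_compact[OF compact_Icc, folded set_integrable_def])
         (auto intro!: continuous_intros simp: indicator_def)
    show "set_integrable lborel {s..2 * s} (\<lambda>t. 1 - cos (t * y))" by (rule int)
    fix t assume t: "t \<in> {s..2 * s}"
    have b: "\<bar>t * y\<bar> \<le> \<bar>2 * s * y\<bar>" "\<bar>s * y\<bar> \<le> \<bar>t * y\<bar>"
      using t s unfolding abs_mult by (auto intro!: mult_right_mono)
    have "(s * y)\<^sup>2 \<le> (t * y)\<^sup>2" using b(2) by (simp add: abs_le_square_iff)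
    moreover have "\<bar>t * y\<bar> \<le> 2" using b(1) True by (simp add: abs_mult)
    ultimately show "(s * y)\<^sup>2 / 3 \<le> 1 - cos (t * y)"
      using one_minus_cos_ge_sq[of "t * y"] by linarith
  qed
  also have "\<dots> \<le> (LBINT t:{s..4 * s}. 1 - cos (t * y))"
    unfolding set_lebesgue_integral_def
    by (rule integral_mono) (use int s in \<open>auto simp: set_integrable_def indicator_def\<close>)
  finally show ?thesis .
next
  case False
  then have y: "y \<noteq> 0" by auto
  have "\<bar>(sin (4 * s * y) - sin (s * y)) / y\<bar> \<le> 2 / \<bar>y\<bar>"
    using abs_sin_le_one[of "4 * s * y"] abs_sin_le_one[of "s * y"]
    unfolding abs_divide by (intro divide_right_mono) linarith+
  also have "\<dots> \<le> 2 * s"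
    using False y s by (simp add: abs_mult field_simps)
  finally have "s \<le> (4 * s - s) - (sin (4 * s * y) - sin (s * y)) / y" by linarith
  also have "\<dots> = (LBINT t:{s..4 * s}. 1 - cos (t * y))"
    using integral_one_minus_cos[of s "4 * s" y] s y by simp
  finally have "s \<le> (LBINT t:{s..4 * s}. 1 - cos (t * y))" .
  moreover have "s / 3 * min 1 ((s * y)\<^sup>2) \<le> s / 3 * 1" using s by (intro mult_left_mono) auto
  ultimately show ?thesis using s by linarith
qed

text \<open>The sum telescopes after multiplication by \<open>2 sin (t/2)\<close>, which is at least \<open>t / 3\<close>.\<close>

lemma sum_cos_le:
  assumes t: "0 < t" "t \<le> pi"
  shows "(\<Sum>z=1..n. cos (real z * t)) \<le> 3 / t"
proof -
  define y where "y = t / 2"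
  have y: "0 < y" "y \<le> 2" using t pi_less_4 by (auto simp: y_def)
  have "\<bar>sin y - y\<bar> \<le> y ^ 3 / 6" using abs_sin_minus_le_cube y by simp
  moreover have "y ^ 3 \<le> 4 * y"
  proof -
    have "y\<^sup>2 \<le> 2\<^sup>2" using y by (intro power_mono) auto
    then have "y * y\<^sup>2 \<le> y * 4" using y by (intro mult_left_mono) auto
    then show ?thesis by (simp add: power3_eq_cube power2_eq_square)
  qed
  ultimately have sy: "y / 3 \<le> sin y" by linarith
  have tele: "2 * sin y * (\<Sum>z=1..n. cos (real z * t)) = sin (real n * t + y) - sin y"
  proof (induction n)
    case (Suc n)
    have "2 * sin y * cos (real (Suc n) * t) = sin (real (Suc n) * t + y) - sin (real (Suc n) * t - y)"
      by (simp add: sin_add sin_diff)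
    also have "real (Suc n) * t - y = real n * t + y" by (simp add: y_def algebra_simps)
    finally show ?case using Suc by (simp add: distrib_left)
  qed simp
  have spos: "0 < sin y" using sy y by linarith
  have "2 * sin y * (\<Sum>z=1..n. cos (real z * t)) \<le> 1"
    unfolding tele using sin_le_one[of "real n * t + y"] spos by linarith
  then have "(\<Sum>z=1..n. cos (real z * t)) \<le> 1 / (2 * sin y)"
    using spos by (simp add: field_simps)
  also have "\<dots> \<le> 1 / (2 * (y / 3))"
    using sy y by (intro divide_left_mono) auto
  also have "\<dots> = 3 / t" by (simp add: y_def)
  finally show ?thesis .
qed

section \<open>Cosine defect, sine mean and Huber mean\<close>

context integrable_step
begin

text \<open>For \<open>t > 0\<close> these are \<open>t * \<alpha> t\<close>, \<open>- t * \<gamma> t\<close>, \<open>t^2 * m (1/t)\<close> and twice \<open>t^2\<close> times the truncated moment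
  \<open>\<integral>_0^(1/t) y \<mu>(y) dy\<close>; \<open>rate t\<close> is the rate \<open>x / m x\<close> at \<open>x = 1/t\<close>, and \<open>rinv t\<close> is
  \<open>Re (1 / (1 - \<phi> t))\<close> for the characteristic function \<open>\<phi>\<close> of the step. As \<open>0 / 0 = 0\<close>, the value \<open>rinv 0\<close> is
  \<open>0\<close>.\<close>

definition cdef :: "real \<Rightarrow> real" where
  "cdef t = expectation (\<lambda>\<omega>. 1 - cos (t * real_of_int (X \<omega>)))"
definition smean :: "real \<Rightarrow> real" where
  "smean t = expectation (\<lambda>\<omega>. sin (t * real_of_int (X \<omega>)))"
definition hmean :: "real \<Rightarrow> real" where
  "hmean t = expectation (\<lambda>\<omega>. huber 1 (t * real_of_int (X \<omega>)))"
definition sqmean :: "real \<Rightarrow> real" where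
  "sqmean t = expectation (\<lambda>\<omega>. min 1 ((t * real_of_int (X \<omega>))\<^sup>2))"
definition rate :: "real \<Rightarrow> real" where
  "rate t = t / hmean t"
definition rinv :: "real \<Rightarrow> real" where
  "rinv t = cdef t / ((cdef t)\<^sup>2 + (smean t)\<^sup>2)"

lemma integrable_cos_defect [simp]: "integrable M (\<lambda>\<omega>. 1 - cos (t * real_of_int (X \<omega>)))"
  using one_minus_cos_le_2 by (intro integrable_const_bound[where B = 2]) auto

lemma integrable_sin [simp]: "integrable M (\<lambda>\<omega>. sin (t * real_of_int (X \<omega>)))"
  by (intro integrable_const_bound[where B = 1]) auto

lemma integrable_huber_1 [simp]: "integrable M (\<lambda>\<omega>. huber 1 (t * real_of_int (X \<omega>)))"
  by (intro integrable_huber) (use integrable_X in auto)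

lemma integrable_min_sq [simp]: "integrable M (\<lambda>\<omega>. min 1 ((t * real_of_int (X \<omega>))\<^sup>2))"
  by (intro integrable_const_bound[where B = 1]) auto

lemma cdef_nonneg: "0 \<le> cdef t" unfolding cdef_def by (rule integral_nonneg_AE) auto
lemma hmean_nonneg: "0 \<le> hmean t" unfolding hmean_def by (rule integral_nonneg_AE) (auto simp: huber_nonneg)
lemma sqmean_nonneg: "0 \<le> sqmean t" unfolding sqmean_def by (rule integral_nonneg_AE) auto
lemma rinv_nonneg: "0 \<le> rinv t" unfolding rinv_def using cdef_nonneg by simp

lemma cdef_minus [simp]: "cdef (- t) = cdef t" by (simp add: cdef_def)
lemma smean_minus [simp]: "smean (- t) = - smean t" by (simp add: smean_def)
lemma rinv_minus [simp]: "rinv (- t) = rinv t" by (simp add: rinv_def)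

lemma t_eta_eq:
  assumes "0 < t"
  shows "t * eta M X (1 / t) = expectation (\<lambda>\<omega>. max 0 (\<bar>t * real_of_int (X \<omega>)\<bar> - 1))"
proof -
  have "t * eta M X (1 / t) = expectation (\<lambda>\<omega>. t * max 0 (\<bar>real_of_int (X \<omega>)\<bar> - 1 / t))"
    using assms by (simp add: eta_eq)
  also have "\<dots> = expectation (\<lambda>\<omega>. max 0 (\<bar>t * real_of_int (X \<omega>)\<bar> - 1))"
    using assms by (intro Bochner_Integration.integral_cong) (auto simp: max_def field_simps abs_mult)
  finally show ?thesis .
qed

lemma integrable_excess [simp]: "integrable M (\<lambda>\<omega>. max 0 (\<bar>t * real_of_int (X \<omega>)\<bar> - 1))"
  using integrable_X by auto

lemma hmean_le_cdef_eta:
  assumes "0 < t"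
  shows "hmean t / 3 \<le> cdef t + t * eta M X (1 / t)"
proof -
  have "hmean t / 3 = expectation (\<lambda>\<omega>. huber 1 (t * real_of_int (X \<omega>)) / 3)" by (simp add: hmean_def)
  also have "\<dots> \<le> expectation (\<lambda>\<omega>. (1 - cos (t * real_of_int (X \<omega>))) + max 0 (\<bar>t * real_of_int (X \<omega>)\<bar> - 1))"
    by (intro integral_mono Bochner_Integration.integrable_add huber_1_le_cos_excess) auto
  also have "\<dots> = cdef t + t * eta M X (1 / t)"
    using assms unfolding t_eta_eq[OF assms] cdef_def by (subst Bochner_Integration.integral_add) auto
  finally show ?thesis .
qed

lemma t_eta_le_hmean: "0 < t \<Longrightarrow> t * eta M X (1 / t) \<le> hmean t"
  unfolding t_eta_eq hmean_def by (intro integral_mono excess_le_huber_1) auto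

lemma m_total_eq_hmean:
  assumes "0 < x" shows "m_total M X x = x\<^sup>2 * hmean (1 / x)"
proof -
  have "x\<^sup>2 * hmean (1 / x) = expectation (\<lambda>\<omega>. x\<^sup>2 * huber 1 (1 / x * real_of_int (X \<omega>)))"
    by (simp add: hmean_def)
  also have "\<dots> = expectation (\<lambda>\<omega>. huber x (real_of_int (X \<omega>)))"
    using assms by (intro Bochner_Integration.integral_cong)
      (auto simp: huber_def field_simps power2_eq_square abs_mult)
  finally show ?thesis using assms by (simp add: m_total_eq)
qed

lemma hmean_scale:
  assumes "1 \<le> l"
  shows "l * hmean t \<le> hmean (l * t)" and "hmean (l * t) \<le> l\<^sup>2 * hmean t"
proof -
  have "l * hmean t = expectation (\<lambda>\<omega>. l * huber 1 (t * real_of_int (X \<omega>)))" by (simp add: hmean_def)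
  also have "\<dots> \<le> hmean (l * t)"
    unfolding hmean_def using huber_1_scale(1)[OF assms]
    by (intro integral_mono integrable_huber_1) (auto simp: mult.assoc)
  finally show "l * hmean t \<le> hmean (l * t)" .
  have "hmean (l * t) \<le> expectation (\<lambda>\<omega>. l\<^sup>2 * huber 1 (t * real_of_int (X \<omega>)))"
    unfolding hmean_def using huber_1_scale(2)[OF assms]
    by (intro integral_mono integrable_huber_1) (auto simp: mult.assoc)
  then show "hmean (l * t) \<le> l\<^sup>2 * hmean t" by (simp add: hmean_def)
qed

lemma sqmean_le_hmean: "sqmean t \<le> 2 * hmean t"
proof -
  have "sqmean t \<le> expectation (\<lambda>\<omega>. 2 * huber 1 (t * real_of_int (X \<omega>)))"
    unfolding sqmean_def by (intro integral_mono min_sq_le_huber_1) auto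
  then show ?thesis by (simp add: hmean_def)
qed

lemma cdef_le_sqmean: "cdef t \<le> 2 * sqmean t"
proof -
  have "cdef t \<le> expectation (\<lambda>\<omega>. 2 * min 1 ((t * real_of_int (X \<omega>))\<^sup>2))"
    unfolding cdef_def by (intro integral_mono one_minus_cos_le_min) auto
  then show ?thesis by (simp add: sqmean_def)
qed

lemma hmean_le_abs: "hmean t \<le> \<bar>t\<bar> * expectation (\<lambda>\<omega>. \<bar>real_of_int (X \<omega>)\<bar>)"
proof -
  have "hmean t \<le> expectation (\<lambda>\<omega>. \<bar>t\<bar> * \<bar>real_of_int (X \<omega>)\<bar>)"
    unfolding hmean_def using huber_1_le_abs
    by (intro integral_mono) (use integrable_X in \<open>auto simp: abs_mult[symmetric]\<close>)
  then show ?thesis by simp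
qed

lemma sqmean_quadruple: "sqmean t \<le> hmean (4 * t) - 4 * hmean t" "hmean (4 * t) - 4 * hmean t \<le> 6 * sqmean t"
proof -
  have e: "hmean (4 * t) - 4 * hmean t = expectation (\<lambda>\<omega>. huber 1 (4 * (t * real_of_int (X \<omega>))) - 4 * huber 1 (t * real_of_int (X \<omega>)))"
    using integrable_huber_1[of "4 * t"]
    by (subst Bochner_Integration.integral_diff) (auto simp: hmean_def mult.assoc)
  have i: "integrable M (\<lambda>\<omega>. huber 1 (4 * (t * real_of_int (X \<omega>))) - 4 * huber 1 (t * real_of_int (X \<omega>)))"
    using integrable_huber_1[of "4 * t"] by (auto simp: mult.assoc)
  show "sqmean t \<le> hmean (4 * t) - 4 * hmean t"
    unfolding e unfolding sqmean_def by (intro integral_mono huber_1_quadruple i) auto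
  have "hmean (4 * t) - 4 * hmean t \<le> expectation (\<lambda>\<omega>. 6 * min 1 ((t * real_of_int (X \<omega>))\<^sup>2))"
    unfolding e by (intro integral_mono huber_1_quadruple i) auto
  then show "hmean (4 * t) - 4 * hmean t \<le> 6 * sqmean t" by (simp add: sqmean_def)
qed

lemma sqmean_mono_scale:
  assumes "1 \<le> l" shows "sqmean (l * t) \<le> l\<^sup>2 * sqmean t"
proof -
  have "min 1 ((l * z)\<^sup>2) \<le> l\<^sup>2 * min 1 (z\<^sup>2)" for z
  proof -
    have "1 \<le> l\<^sup>2" using assms by simp
    then show ?thesis by (auto simp: min_def power_mult_distrib)
  qed
  then have "sqmean (l * t) \<le> expectation (\<lambda>\<omega>. l\<^sup>2 * min 1 ((t * real_of_int (X \<omega>))\<^sup>2))"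
    unfolding sqmean_def by (intro integral_mono integrable_min_sq) (auto simp: mult.assoc)
  then show ?thesis by (simp add: sqmean_def)
qed

text \<open>Measured in units of \<open>hmean t\<close>, the cosine defect is Lipschitz in \<open>log t\<close> over one doubling.\<close>

lemma cdef_diff_le:
  assumes "0 < t" "t \<le> s" "s \<le> 2 * t"
  shows "\<bar>cdef s - cdef t\<bar> \<le> 4 * ((s - t) / t) * hmean t"
proof -
  have "cdef s - cdef t = expectation (\<lambda>\<omega>. (1 - cos (s * real_of_int (X \<omega>))) - (1 - cos (t * real_of_int (X \<omega>))))"
    unfolding cdef_def by (rule Bochner_Integration.integral_diff[symmetric]) auto
  also have "\<bar>\<dots>\<bar> \<le> expectation (\<lambda>\<omega>. \<bar>(1 - cos (s * real_of_int (X \<omega>))) - (1 - cos (t * real_of_int (X \<omega>)))\<bar>)"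
    by (rule integral_abs_bound)
  also have "\<dots> \<le> expectation (\<lambda>\<omega>. 4 * ((s - t) / t) * huber 1 (t * real_of_int (X \<omega>)))"
    using abs_cos_diff_le_huber_1[OF assms]
    by (intro integral_mono integrable_abs Bochner_Integration.integrable_diff integrable_cos_defect) auto
  finally show ?thesis by (simp add: hmean_def)
qed

text \<open>Dominated convergence; the linear growth condition covers both the bounded integrands and \<open>h\<close>.\<close>

lemma continuous_expectation:
  fixes f :: "real \<Rightarrow> real"
  assumes c: "continuous_on UNIV f" and b: "\<And>z. \<bar>f z\<bar> \<le> 2 + \<bar>z\<bar>"
  shows "continuous_on A (\<lambda>t. expectation (\<lambda>\<omega>. f (t * real_of_int (X \<omega>))))"
proof -
  have [measurable]: "f \<in> borel_measurable borel" by (rule borel_measurable_continuous_onI[OF c])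
  have "isCont (\<lambda>t. expectation (\<lambda>\<omega>. f (t * real_of_int (X \<omega>)))) t" for t
    unfolding continuous_at_sequentially
  proof safe
    fix x assume x: "x \<longlonglongrightarrow> t"
    obtain B where B: "\<And>n. \<bar>x n\<bar> \<le> B"
      using Bseq_eq_bounded[of x] convergent_imp_Bseq[of x] x
      by (auto simp: Bseq_def convergent_def)
    show "((\<lambda>t. expectation (\<lambda>\<omega>. f (t * real_of_int (X \<omega>)))) \<circ> x) \<longlonglongrightarrow> expectation (\<lambda>\<omega>. f (t * real_of_int (X \<omega>)))"
      unfolding comp_def
    proof (rule integral_dominated_convergence[where w = "\<lambda>\<omega>. 2 + B * \<bar>real_of_int (X \<omega>)\<bar>"])
      show "AE \<omega> in M. (\<lambda>i. f (x i * real_of_int (X \<omega>))) \<longlonglongrightarrow> f (t * real_of_int (X \<omega>))"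
        using c x by (intro AE_I2 continuous_on_tendsto_compose[OF c]) (auto intro!: tendsto_intros)
      show "AE \<omega> in M. norm (f (x i * real_of_int (X \<omega>))) \<le> 2 + B * \<bar>real_of_int (X \<omega>)\<bar>" for i
      proof (rule AE_I2)
        fix \<omega>
        have "\<bar>f (x i * real_of_int (X \<omega>))\<bar> \<le> 2 + \<bar>x i\<bar> * \<bar>real_of_int (X \<omega>)\<bar>"
          using b by (simp add: abs_mult[symmetric])
        also have "\<dots> \<le> 2 + B * \<bar>real_of_int (X \<omega>)\<bar>"
          using B by (intro add_left_mono mult_right_mono) auto
        finally show "norm (f (x i * real_of_int (X \<omega>))) \<le> 2 + B * \<bar>real_of_int (X \<omega>)\<bar>" by simp
      qed
    qed (use integrable_X in auto)
  qed
  then show ?thesis by (simp add: continuous_at_imp_continuous_on)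
qed

lemma continuous_cdef: "continuous_on A cdef"
  unfolding cdef_def
proof (intro continuous_expectation[where f = "\<lambda>z. 1 - cos z"])
  show "\<bar>1 - cos z\<bar> \<le> 2 + \<bar>z\<bar>" for z :: real
    using one_minus_cos_le_2[of z] cos_le_one[of z] by linarith
qed (intro continuous_intros)

lemma continuous_smean: "continuous_on A smean"
  unfolding smean_def
proof (intro continuous_expectation[where f = sin])
  show "\<bar>sin z\<bar> \<le> 2 + \<bar>z\<bar>" for z :: real
    using abs_sin_le_one[of z] abs_ge_zero[of z] by linarith
qed (intro continuous_intros)

lemma continuous_hmean: "continuous_on A hmean"
  unfolding hmean_def
proof (intro continuous_expectation[where f = "huber 1"])
  show "continuous_on UNIV (huber 1)"
    unfolding huber_1_alt[abs_def] by (intro continuous_intros) auto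
  show "\<bar>huber 1 z\<bar> \<le> 2 + \<bar>z\<bar>" for z
    using huber_1_le_abs[of z] huber_nonneg[of 1 z] by simp
qed

lemma continuous_sqmean: "continuous_on A sqmean"
  unfolding sqmean_def
proof (intro continuous_expectation[where f = "\<lambda>z. min 1 (z\<^sup>2)"])
  show "\<bar>min 1 (z\<^sup>2)\<bar> \<le> 2 + \<bar>z\<bar>" for z :: real
    using zero_le_power2[of z] abs_ge_zero[of z] unfolding min_def by (cases "1 \<le> z\<^sup>2") simp_all
qed (intro continuous_intros)

lemma LBINT_cdef_ge:
  assumes s: "0 < s"
  shows "s / 3 * sqmean s \<le> (LBINT t:{s..4 * s}. cdef t)"
proof -
  note sw = set_integral_expectation_swap[where f = "\<lambda>x t. 1 - cos (t * x)" and g = "\<lambda>_. 2"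
      and Y = "\<lambda>\<omega>. real_of_int (X \<omega>)" and a = s and b = "4 * s"]
  have 1: "(LBINT t:{s..4 * s}. cdef t) = expectation (\<lambda>\<omega>. LBINT t:{s..4 * s}. 1 - cos (t * real_of_int (X \<omega>)))"
    unfolding cdef_def by (rule sw(1)) (auto simp: one_minus_cos_le_2)
  have "s / 3 * sqmean s = expectation (\<lambda>\<omega>. s / 3 * min 1 ((s * real_of_int (X \<omega>))\<^sup>2))"
    by (simp add: sqmean_def)
  also have "\<dots> \<le> expectation (\<lambda>\<omega>. LBINT t:{s..4 * s}. 1 - cos (t * real_of_int (X \<omega>)))"
    by (intro integral_mono sw(3) integral_one_minus_cos_ge s) (auto simp: one_minus_cos_le_2)
  finally show ?thesis by (simp add: 1)
qed

end

section \<open>Steps of infinite variance\<close>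

lemma set_integrable_Icc_continuous:
  fixes f :: "real \<Rightarrow> real"
  shows "continuous_on {a..b} f \<Longrightarrow> set_integrable lborel {a..b} f"
  unfolding set_integrable_def by (rule borel_integrable_compact) (rule compact_Icc)

lemma LBINT_Icc_split:
  fixes f :: "real \<Rightarrow> real"
  assumes "set_integrable lborel {a..c} f" "a \<le> b" "b \<le> c"
  shows "(LBINT t:{a..c}. f t) = (LBINT t:{a..b}. f t) + (LBINT t:{b..c}. f t)"
proof -
  have "(LBINT t:{a..c}. f t) = (LBINT t:{a..<b} \<union> {b..c}. f t)"
    using assms(2,3) by (simp add: ivl_disj_un)
  also have "\<dots> = (LBINT t:{a..<b}. f t) + (LBINT t:{b..c}. f t)"
  proof (rule set_integral_Un)
    show "set_integrable lborel {a..<b} f" "set_integrable lborel {b..c} f"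
      using assms(2,3) by (auto intro!: set_integrable_subset[OF assms(1)])
  qed auto
  finally show ?thesis by (simp add: LBINT_Icc_eq_Ico[of a b])
qed

lemma set_integral_mono_set_nonneg:
  fixes f :: "real \<Rightarrow> real"
  assumes "set_integrable lborel B f" "A \<in> sets borel" "A \<subseteq> B" "\<And>t. t \<in> B \<Longrightarrow> 0 \<le> f t"
  shows "(LBINT t:A. f t) \<le> (LBINT t:B. f t)"
proof -
  have "set_integrable lborel A f" by (rule set_integrable_subset[OF assms(1)]) (use assms in auto)
  then show ?thesis using assms unfolding set_lebesgue_integral_def set_integrable_def
    by (intro integral_mono) (auto simp: indicator_def)
qed

lemma LBINT_indicator_mult:
  fixes f :: "real \<Rightarrow> real"
  assumes "A \<subseteq> B"
  shows "(LBINT t:B. indicator A t * f t) = (LBINT t:A. f t)"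
    and "set_integrable lborel B (\<lambda>t. indicator A t * f t) \<longleftrightarrow> set_integrable lborel A f"
proof -
  have *: "(\<lambda>t. indicator B t *\<^sub>R (indicator A t * f t)) = (\<lambda>t. indicator A t *\<^sub>R f t)"
    using assms by (auto simp: indicator_def fun_eq_iff)
  show "(LBINT t:B. indicator A t * f t) = (LBINT t:A. f t)"
    and "set_integrable lborel B (\<lambda>t. indicator A t * f t) \<longleftrightarrow> set_integrable lborel A f"
    unfolding set_lebesgue_integral_def set_integrable_def * by auto
qed

text \<open>The positivity of \<open>cdef\<close> on \<open>(0, \<pi>]\<close> is all that the analysis needs to know about irreducibility: it keeps
  \<open>1 - \<phi>\<close> away from \<open>0\<close> except at the origin.\<close>

locale heavy_step = integrable_step +
  assumes mean_zero: "expectation (\<lambda>\<omega>. real_of_int (X \<omega>)) = 0"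
    and infinite_second_moment: "(\<integral>\<^sup>+\<omega>. ennreal ((real_of_int (X \<omega>))\<^sup>2) \<partial>M) = \<infinity>"
    and cdef_pos: "\<And>t. 0 < t \<Longrightarrow> t \<le> pi \<Longrightarrow> 0 < cdef t"
begin

lemma truncated_second_moment_unbounded:
  "\<exists>L>0. K \<le> expectation (\<lambda>\<omega>. (real_of_int (X \<omega>))\<^sup>2 * indicator {x. \<bar>x\<bar> \<le> L} (real_of_int (X \<omega>)))"
proof -
  define f where "f n \<omega> = (real_of_int (X \<omega>))\<^sup>2 * indicator {x. \<bar>x\<bar> \<le> real n} (real_of_int (X \<omega>))" for n \<omega>
  have fm [measurable]: "f n \<in> borel_measurable M" for n
    unfolding f_def by measurable
  have fi: "integrable M (f n)" for n
  proof (rule integrable_const_bound[where B = "(real n)\<^sup>2"])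
    show "AE \<omega> in M. norm (f n \<omega>) \<le> (real n)\<^sup>2"
      by (intro AE_I2) (auto simp: f_def indicator_def abs_le_square_iff[symmetric])
  qed simp
  have inc: "incseq (\<lambda>n \<omega>. ennreal (f n \<omega>))"
    by (auto simp: incseq_def le_fun_def f_def indicator_def intro!: ennreal_leI)
  have sup: "(SUP n. ennreal (f n \<omega>)) = ennreal ((real_of_int (X \<omega>))\<^sup>2)" for \<omega>
  proof (rule antisym)
    show "(SUP n. ennreal (f n \<omega>)) \<le> ennreal ((real_of_int (X \<omega>))\<^sup>2)"
      by (rule SUP_least) (auto simp: f_def indicator_def intro!: ennreal_leI)
    obtain n where n: "\<bar>real_of_int (X \<omega>)\<bar> \<le> real n" using real_arch_simple by blast
    have "ennreal ((real_of_int (X \<omega>))\<^sup>2) = ennreal (f n \<omega>)" using n by (simp add: f_def)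
    also have "\<dots> \<le> (SUP n. ennreal (f n \<omega>))" by (rule SUP_upper) simp
    finally show "ennreal ((real_of_int (X \<omega>))\<^sup>2) \<le> (SUP n. ennreal (f n \<omega>))" .
  qed
  have "(SUP n. \<integral>\<^sup>+\<omega>. ennreal (f n \<omega>) \<partial>M) = \<infinity>"
    using nn_integral_monotone_convergence_SUP[OF inc, of M] infinite_second_moment by (simp add: sup)
  then have "ennreal K < (SUP n. \<integral>\<^sup>+\<omega>. ennreal (f n \<omega>) \<partial>M)"
    by (simp only: infinity_ennreal_def ennreal_less_top)
  then obtain n where "ennreal K < (\<integral>\<^sup>+\<omega>. ennreal (f n \<omega>) \<partial>M)"
    by (auto simp: less_SUP_iff)
  also have "(\<integral>\<^sup>+\<omega>. ennreal (f n \<omega>) \<partial>M) = ennreal (expectation (f n))"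
    by (rule nn_integral_eq_integral[OF fi]) (auto simp: f_def)
  finally have K: "K \<le> expectation (f n)"
    by (metis ennreal_less_iff ennreal_neg integral_nonneg_AE le_cases less_eq_real_def not_less not_less_zero)
  have "expectation (f n) \<le> expectation (f (Suc n))"
    by (intro integral_mono fi) (auto simp: f_def indicator_def)
  with K show ?thesis
    by (intro exI[of _ "real (Suc n)"]) (auto simp: f_def[abs_def])
qed

text \<open>The infinite second moment in Fourier terms: outcomes with \<open>|t X| \<le> 2\<close> contribute \<open>t^2 X^2 / 3\<close> each, and the
  truncated second moment is unbounded.\<close>

lemma cdef_superquadratic:
  "\<exists>\<tau>>0. \<tau> \<le> pi \<and> (\<forall>t. 0 < t \<and> t \<le> \<tau> \<longrightarrow> K * t\<^sup>2 \<le> cdef t)"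
proof -
  obtain L where L: "L > 0" and KL: "3 * K \<le> expectation (\<lambda>\<omega>. (real_of_int (X \<omega>))\<^sup>2 * indicator {x. \<bar>x\<bar> \<le> L} (real_of_int (X \<omega>)))"
    using truncated_second_moment_unbounded[of "3 * K"] by blast
  have "K * t\<^sup>2 \<le> cdef t" if t: "0 < t" "t \<le> 2 / L" for t
  proof -
    have tL: "t * L \<le> 2" using t L by (simp add: field_simps)
    have "3 * K * (t\<^sup>2 / 3) \<le> expectation (\<lambda>\<omega>. (real_of_int (X \<omega>))\<^sup>2 * indicator {x. \<bar>x\<bar> \<le> L} (real_of_int (X \<omega>))) * (t\<^sup>2 / 3)"
      by (intro mult_right_mono KL) auto
    also have "\<dots> = expectation (\<lambda>\<omega>. (real_of_int (X \<omega>))\<^sup>2 * indicator {x. \<bar>x\<bar> \<le> L} (real_of_int (X \<omega>)) * (t\<^sup>2 / 3))"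
      by simp
    also have "\<dots> \<le> cdef t"
      unfolding cdef_def
    proof (rule integral_mono)
      show "integrable M (\<lambda>\<omega>. (real_of_int (X \<omega>))\<^sup>2 * indicator {x. \<bar>x\<bar> \<le> L} (real_of_int (X \<omega>)) * (t\<^sup>2 / 3))"
      proof (rule integrable_const_bound[where B = "L\<^sup>2 * (t\<^sup>2 / 3)"])
        show "AE \<omega> in M. norm ((real_of_int (X \<omega>))\<^sup>2 * indicator {x. \<bar>x\<bar> \<le> L} (real_of_int (X \<omega>)) * (t\<^sup>2 / 3)) \<le> L\<^sup>2 * (t\<^sup>2 / 3)"
          using L by (intro AE_I2) (auto simp: indicator_def abs_mult abs_le_square_iff[symmetric] intro!: mult_right_mono)
      qed simp
      show "(real_of_int (X \<omega>))\<^sup>2 * indicator {x. \<bar>x\<bar> \<le> L} (real_of_int (X \<omega>)) * (t\<^sup>2 / 3) \<le> 1 - cos (t * real_of_int (X \<omega>))" for \<omega>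
      proof (cases "\<bar>real_of_int (X \<omega>)\<bar> \<le> L")
        case True
        then have "\<bar>t * real_of_int (X \<omega>)\<bar> \<le> t * L" using t by (simp add: abs_mult)
        with tL have "\<bar>t * real_of_int (X \<omega>)\<bar> \<le> 2" by linarith
        from one_minus_cos_ge_sq[OF this] show ?thesis
          using True by (simp add: power_mult_distrib mult_ac)
      qed auto
    qed simp
    finally show ?thesis by simp
  qed
  then show ?thesis
    using L by (intro exI[of _ "min pi (2 / L)"]) auto
qed

lemma cdef_ge_sq: "\<exists>c>0. \<forall>t. 0 \<le> t \<and> t \<le> pi \<longrightarrow> c * t\<^sup>2 \<le> cdef t"
proof -
  obtain \<tau> where \<tau>: "\<tau> > 0" "\<tau> \<le> pi" and near: "\<And>t. 0 < t \<Longrightarrow> t \<le> \<tau> \<Longrightarrow> 1 * t\<^sup>2 \<le> cdef t"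
    using cdef_superquadratic[of 1] by blast
  obtain t0 where t0: "t0 \<in> {\<tau>..pi}" "\<And>t. t \<in> {\<tau>..pi} \<Longrightarrow> cdef t0 \<le> cdef t"
    using continuous_attains_inf[OF compact_Icc _ continuous_cdef, of \<tau> pi] \<tau> by auto
  have p: "cdef t0 > 0" using cdef_pos t0(1) \<tau> by auto
  define c where "c = min 1 (cdef t0 / pi\<^sup>2)"
  have c: "c > 0" "c \<le> 1" "c * pi\<^sup>2 \<le> cdef t0" using p by (auto simp: c_def min_def field_simps)
  have "c * t\<^sup>2 \<le> cdef t" if t: "0 \<le> t" "t \<le> pi" for t
  proof -
    consider "t = 0" | "0 < t" "t \<le> \<tau>" | "\<tau> \<le> t" using t by linarith
    then show ?thesis
    proof cases
      case 1 then show ?thesis by (simp add: cdef_nonneg)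
    next
      case 2
      have "c * t\<^sup>2 \<le> 1 * t\<^sup>2" using c by (intro mult_right_mono) auto
      with near[OF 2] show ?thesis by linarith
    next
      case 3
      have "c * t\<^sup>2 \<le> c * pi\<^sup>2" using c t by (intro mult_left_mono power_mono) auto
      moreover have "cdef t0 \<le> cdef t" using t0(2)[of t] 3 t by simp
      ultimately show ?thesis using c by linarith
    qed
  qed
  with c show ?thesis by blast
qed

lemma cdef_le_hmean: "cdef t \<le> 4 * hmean t"
  using cdef_le_sqmean[of t] sqmean_le_hmean[of t] by linarith

lemma hmean_pos: assumes "0 < t" shows "0 < hmean t"
proof (cases "t \<le> pi")
  case True
  then show ?thesis using cdef_le_hmean[of t] cdef_pos[of t] assms by linarith
next
  case False
  have "0 < hmean pi" using cdef_le_hmean[of pi] cdef_pos[of pi] by simp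
  then have "0 < t / pi * hmean pi" using assms by simp
  also have "\<dots> \<le> hmean (t / pi * pi)" by (rule hmean_scale) (use False in simp)
  finally show ?thesis by simp
qed

text \<open>Scaling by \<open>t / s\<close> with denominators cleared: \<open>hmean t / t\<close> increases, \<open>hmean t / t^2\<close> decreases, \<open>hmean\<close> increases.\<close>

lemma hmean_mono_ratio:
  assumes "0 < s" "s \<le> t" shows "t * hmean s \<le> s * hmean t" "hmean t * s\<^sup>2 \<le> t\<^sup>2 * hmean s" "hmean s \<le> hmean t"
proof -
  have 1: "1 \<le> t / s" using assms by simp
  from hmean_scale[OF 1, of s] assms
  show a: "t * hmean s \<le> s * hmean t" "hmean t * s\<^sup>2 \<le> t\<^sup>2 * hmean s"
    by (simp_all add: field_simps)
  have "s * hmean s \<le> t * hmean s" using assms hmean_nonneg by (intro mult_right_mono) auto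
  with a have "s * hmean s \<le> s * hmean t" by linarith
  then show "hmean s \<le> hmean t" using assms by simp
qed

lemma rate_pos: "0 < t \<Longrightarrow> 0 < rate t"
  using hmean_pos by (simp add: rate_def)

lemma rate_antimono: "0 < s \<Longrightarrow> s \<le> t \<Longrightarrow> rate t \<le> rate s"
  using hmean_mono_ratio(1)[of s t] hmean_pos[of s] hmean_pos[of t] by (simp add: rate_def field_simps)

lemma rate_scale: assumes "0 < s" "1 \<le> l" shows "rate s \<le> l * rate (l * s)"
proof -
  have p: "0 < hmean s" "0 < hmean (l * s)" using assms hmean_pos by simp_all
  have "s / hmean s \<le> s * l\<^sup>2 / hmean (l * s)"
    using mult_left_mono[OF hmean_scale(2)[OF assms(2), of s], of s] p assms
    by (simp add: divide_le_eq pos_le_divide_eq mult_ac)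
  then show ?thesis by (simp add: rate_def power2_eq_square mult_ac)
qed

lemma rate_lower_bound: "\<exists>c>0. \<forall>t>0. c \<le> rate t"
proof -
  define E where "E = expectation (\<lambda>\<omega>. \<bar>real_of_int (X \<omega>)\<bar>)"
  have "hmean 1 \<le> E" using hmean_le_abs[of 1] by (simp add: E_def)
  then have E: "E > 0" using hmean_pos[of 1] by simp
  have "1 / E \<le> rate t" if "t > 0" for t
    using hmean_le_abs[of t] that hmean_pos[OF that] E by (simp add: rate_def E_def[symmetric] field_simps)
  then show ?thesis using E by (intro exI[of _ "1 / E"]) auto
qed

text \<open>\<open>m x / x\<close> tends to \<open>0\<close>: \<open>h (t X) / t\<close> is dominated by \<open>|X|\<close> and tends to \<open>0\<close> as
  \<open>t \<rightarrow> 0\<close>.\<close>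

lemma rate_unbounded: "\<exists>\<tau>>0. \<forall>t. 0 < t \<and> t \<le> \<tau> \<longrightarrow> K \<le> rate t"
proof -
  have lim: "(\<lambda>n. expectation (\<lambda>\<omega>. huber 1 (1 / real (Suc n) * real_of_int (X \<omega>)) * real (Suc n))) \<longlonglongrightarrow> expectation (\<lambda>\<omega>. 0)"
  proof (rule integral_dominated_convergence[where w = "\<lambda>\<omega>. \<bar>real_of_int (X \<omega>)\<bar>"])
    show "AE \<omega> in M. (\<lambda>n. huber 1 (1 / real (Suc n) * real_of_int (X \<omega>)) * real (Suc n)) \<longlonglongrightarrow> 0"
    proof (rule AE_I2, rule Lim_null_comparison)
      fix \<omega>
      show "\<forall>\<^sub>F n in sequentially. norm (huber 1 (1 / real (Suc n) * real_of_int (X \<omega>)) * real (Suc n))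
          \<le> (real_of_int (X \<omega>))\<^sup>2 / 2 * inverse (real (Suc n))"
      proof (rule always_eventually, rule allI)
        fix n
        have "huber 1 (1 / real (Suc n) * real_of_int (X \<omega>)) * real (Suc n)
            \<le> (1 / real (Suc n) * real_of_int (X \<omega>))\<^sup>2 / 2 * real (Suc n)"
          by (intro mult_right_mono huber_1_le_sq) auto
        also have "\<dots> = (real_of_int (X \<omega>))\<^sup>2 / 2 * inverse (real (Suc n))"
        proof -
          have "(1 / c * x)\<^sup>2 / 2 * c = x\<^sup>2 / 2 * inverse c" if "0 < c" for c x :: real
            using that by (simp add: power2_eq_square field_simps)
          then show ?thesis by (simp del: of_nat_Suc)
        qed
        finally show "norm (huber 1 (1 / real (Suc n) * real_of_int (X \<omega>)) * real (Suc n))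
            \<le> (real_of_int (X \<omega>))\<^sup>2 / 2 * inverse (real (Suc n))"
          using huber_nonneg[of 1] by (simp add: abs_mult)
      qed
      show "(\<lambda>n. (real_of_int (X \<omega>))\<^sup>2 / 2 * inverse (real (Suc n))) \<longlonglongrightarrow> 0"
        using tendsto_mult_right_zero[OF LIMSEQ_inverse_real_of_nat] by blast
    qed
    show "AE \<omega> in M. norm (huber 1 (1 / real (Suc n) * real_of_int (X \<omega>)) * real (Suc n)) \<le> \<bar>real_of_int (X \<omega>)\<bar>" for n
    proof (rule AE_I2)
      fix \<omega>
      have "huber 1 (1 / real (Suc n) * real_of_int (X \<omega>)) * real (Suc n)
          \<le> \<bar>1 / real (Suc n) * real_of_int (X \<omega>)\<bar> * real (Suc n)"
        by (intro mult_right_mono huber_1_le_abs) auto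
      also have "\<dots> = \<bar>real_of_int (X \<omega>)\<bar>" by (simp add: abs_mult)
      finally show "norm (huber 1 (1 / real (Suc n) * real_of_int (X \<omega>)) * real (Suc n)) \<le> \<bar>real_of_int (X \<omega>)\<bar>"
        using huber_nonneg[of 1] by (simp add: abs_mult)
    qed
  qed (use integrable_X in auto)
  have "(\<lambda>n. hmean (1 / real (Suc n)) * real (Suc n)) \<longlonglongrightarrow> 0"
    using lim by (simp add: hmean_def)
  moreover have "0 < 1 / (\<bar>K\<bar> + 1)" by simp
  ultimately have "\<forall>\<^sub>F n in sequentially. hmean (1 / real (Suc n)) * real (Suc n) < 1 / (\<bar>K\<bar> + 1)"
    by (rule order_tendstoD(2))
  then obtain n where n: "hmean (1 / real (Suc n)) * real (Suc n) < 1 / (\<bar>K\<bar> + 1)"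
    by (auto simp: eventually_sequentially)
  define \<tau> where "\<tau> = 1 / real (Suc n)"
  have \<tau>: "\<tau> > 0" by (simp add: \<tau>_def)
  have "(\<bar>K\<bar> + 1) * hmean \<tau> < \<tau>"
    using n by (simp add: \<tau>_def field_simps)
  then have "\<bar>K\<bar> + 1 < rate \<tau>" using hmean_pos[OF \<tau>] by (simp add: rate_def field_simps)
  then have "K \<le> rate t" if "0 < t" "t \<le> \<tau>" for t
    using rate_antimono[OF that] by linarith
  with \<tau> show ?thesis by blast
qed

section \<open>Integrals over quadrupling blocks\<close>

lemma rate_diff:
  assumes "0 < s"
  shows "rate s - rate (4 * s) = s * (hmean (4 * s) - 4 * hmean s) / (hmean s * hmean (4 * s))"
  using assms hmean_pos[of s] hmean_pos[of "4 * s"] by (simp add: rate_def field_simps)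

lemma continuous_quotients:
  assumes "0 < a"
  shows "continuous_on {a..b} (\<lambda>t. sqmean t / (hmean t)\<^sup>2)" "continuous_on {a..b} (\<lambda>t. cdef t / (hmean t)\<^sup>2)"
    and "b \<le> pi \<Longrightarrow> continuous_on {a..b} rinv"
proof -
  have nz: "hmean t \<noteq> 0" if "t \<in> {a..b}" for t using hmean_pos[of t] that assms by simp
  show "continuous_on {a..b} (\<lambda>t. sqmean t / (hmean t)\<^sup>2)" "continuous_on {a..b} (\<lambda>t. cdef t / (hmean t)\<^sup>2)"
    using nz by (auto intro!: continuous_intros continuous_sqmean continuous_hmean continuous_cdef)
  assume "b \<le> pi"
  then have "cdef t \<noteq> 0" if "t \<in> {a..b}" for t using cdef_pos[of t] that assms by simp
  then show "continuous_on {a..b} rinv"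
    unfolding rinv_def[abs_def]
    by (auto intro!: continuous_intros continuous_smean continuous_cdef simp: sum_power2_eq_zero_iff)
qed

text \<open>On a block every quantity is comparable with its value at \<open>s\<close>, so the integral is about \<open>s * sqmean s / (hmean s)^2\<close>, and so
  is the drop of \<open>rate\<close> by the quadrupling inequality.\<close>

lemma block_upper:
  assumes s: "0 < s"
  shows "(LBINT t:{s..4 * s}. sqmean t / (hmean t)\<^sup>2) \<le> 768 * (rate s - rate (4 * s))"
proof -
  have qs: "0 < hmean s" using hmean_pos s by simp
  have q4: "0 < hmean (4 * s)" "hmean (4 * s) \<le> 16 * hmean s" using hmean_pos[of "4 * s"] s hmean_scale(2)[of 4 s] by auto
  have "(LBINT t:{s..4 * s}. sqmean t / (hmean t)\<^sup>2) \<le> (LBINT t:{s..4 * s}. 16 * sqmean s / (hmean s)\<^sup>2)"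
  proof (rule set_integral_mono)
    show "set_integrable lborel {s..4 * s} (\<lambda>t. sqmean t / (hmean t)\<^sup>2)"
      by (intro set_integrable_Icc_continuous continuous_quotients s)
    show "set_integrable lborel {s..4 * s} (\<lambda>t. 16 * sqmean s / (hmean s)\<^sup>2)"
      by (intro set_integrable_Icc_continuous continuous_intros)
    fix t assume t: "t \<in> {s..4 * s}"
    have ts: "1 \<le> t / s" "t / s \<le> 4" using t s by (auto simp: field_simps)
    have "sqmean t \<le> (t / s)\<^sup>2 * sqmean s" using sqmean_mono_scale[OF ts(1), of s] s by simp
    also have "\<dots> \<le> 4\<^sup>2 * sqmean s" using ts sqmean_nonneg by (intro mult_right_mono power_mono) auto
    finally have "sqmean t \<le> 16 * sqmean s" by simp
    moreover have "(hmean s)\<^sup>2 \<le> (hmean t)\<^sup>2" using hmean_mono_ratio(3)[of s t] t s qs by (intro power_mono) auto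
    ultimately show "sqmean t / (hmean t)\<^sup>2 \<le> 16 * sqmean s / (hmean s)\<^sup>2"
      using qs sqmean_nonneg[of t] sqmean_nonneg[of s] by (intro frac_le) auto
  qed
  also have "\<dots> = 48 * s * sqmean s / (hmean s)\<^sup>2" using s by (simp add: set_integral_const)
  also have "\<dots> \<le> 768 * (rate s - rate (4 * s))"
  proof -
    have "s * sqmean s / (16 * (hmean s)\<^sup>2) \<le> s * (hmean (4 * s) - 4 * hmean s) / (hmean s * hmean (4 * s))"
    proof (rule frac_le)
      show "s * sqmean s \<le> s * (hmean (4 * s) - 4 * hmean s)" using sqmean_quadruple(1)[of s] s by (intro mult_left_mono) auto
      show "hmean s * hmean (4 * s) \<le> 16 * (hmean s)\<^sup>2"
        using mult_left_mono[OF q4(2), of "hmean s"] qs by (simp add: power2_eq_square)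
      show "0 \<le> s * (hmean (4 * s) - 4 * hmean s)" using sqmean_quadruple(1)[of s] sqmean_nonneg[of s] s by simp
    qed (use qs q4 in auto)
    then have "768 * (s * sqmean s / (16 * (hmean s)\<^sup>2)) \<le> 768 * (rate s - rate (4 * s))"
      unfolding rate_diff[OF s] by linarith
    then show ?thesis by simp
  qed
  finally show ?thesis .
qed

text \<open>The reverse comparison has the cosine defect itself in the integral: on average over the block it is at least a multiple of
  \<open>sqmean s\<close>.\<close>

lemma block_lower:
  assumes s: "0 < s"
  shows "rate s - rate (4 * s) \<le> 1152 * (LBINT t:{s..4 * s}. cdef t / (hmean t)\<^sup>2)"
proof -
  have qs: "0 < hmean s" using hmean_pos s by simp
  have q4: "0 < hmean (4 * s)" "hmean (4 * s) \<le> 16 * hmean s" "4 * hmean s \<le> hmean (4 * s)"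
    using hmean_pos[of "4 * s"] s hmean_scale[of 4 s] by auto
  have "rate s - rate (4 * s) \<le> s * (6 * sqmean s) / (hmean s * (4 * hmean s))"
    unfolding rate_diff[OF s] using sqmean_quadruple[of s] sqmean_nonneg[of s] q4 qs s
    by (intro frac_le mult_left_mono) auto
  also have "\<dots> = 1152 * (s / 3 * sqmean s / (16 * hmean s)\<^sup>2)"
    using qs by (simp add: power2_eq_square field_simps)
  also have "s / 3 * sqmean s / (16 * hmean s)\<^sup>2 \<le> (LBINT t:{s..4 * s}. cdef t) / (16 * hmean s)\<^sup>2"
    by (intro divide_right_mono LBINT_cdef_ge s) auto
  also have "\<dots> = (LBINT t:{s..4 * s}. cdef t / (16 * hmean s)\<^sup>2)" by simp
  also have "\<dots> \<le> (LBINT t:{s..4 * s}. cdef t / (hmean t)\<^sup>2)"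
  proof (rule set_integral_mono)
    show "set_integrable lborel {s..4 * s} (\<lambda>t. cdef t / (16 * hmean s)\<^sup>2)"
      using qs by (intro set_integrable_Icc_continuous continuous_intros continuous_cdef) auto
    show "set_integrable lborel {s..4 * s} (\<lambda>t. cdef t / (hmean t)\<^sup>2)"
      by (intro set_integrable_Icc_continuous continuous_quotients s)
    fix t assume t: "t \<in> {s..4 * s}"
    then have t0: "0 < t" using s by simp
    have "hmean t \<le> hmean (4 * s)" using hmean_mono_ratio(3)[OF t0] t by auto
    with q4 have "(hmean t)\<^sup>2 \<le> (16 * hmean s)\<^sup>2" using hmean_nonneg by (intro power_mono) auto
    then show "cdef t / (16 * hmean s)\<^sup>2 \<le> cdef t / (hmean t)\<^sup>2"
      using cdef_nonneg hmean_pos[OF t0] by (intro frac_le) auto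
  qed
  finally show ?thesis by simp
qed

lemma blocks_upper:
  assumes s: "0 < s"
  shows "(LBINT t:{s..4 ^ n * s}. sqmean t / (hmean t)\<^sup>2) \<le> 768 * (rate s - rate (4 ^ n * s))"
proof (induction n)
  case (Suc n)
  have e: "s \<le> 4 ^ n * s" "4 ^ n * s \<le> 4 ^ Suc n * s" "0 < 4 ^ n * s" using s by auto
  have "(LBINT t:{s..4 ^ Suc n * s}. sqmean t / (hmean t)\<^sup>2) = (LBINT t:{s..4 ^ n * s}. sqmean t / (hmean t)\<^sup>2) + (LBINT t:{4 ^ n * s..4 ^ Suc n * s}. sqmean t / (hmean t)\<^sup>2)"
    by (rule LBINT_Icc_split[OF set_integrable_Icc_continuous e(1,2)]) (rule continuous_quotients[OF s])
  with Suc block_upper[OF e(3)] show ?case by (simp add: mult.assoc)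
qed (simp add: set_lebesgue_integral_def, subst integral_discrete_difference[where X = "{s}" and g = "\<lambda>_. 0"], auto simp: indicator_def)

lemma blocks_lower:
  assumes s: "0 < s"
  shows "rate s - rate (4 ^ n * s) \<le> 1152 * (LBINT t:{s..4 ^ n * s}. cdef t / (hmean t)\<^sup>2)"
proof (induction n)
  case (Suc n)
  have e: "s \<le> 4 ^ n * s" "4 ^ n * s \<le> 4 ^ Suc n * s" "0 < 4 ^ n * s" using s by auto
  have "(LBINT t:{s..4 ^ Suc n * s}. cdef t / (hmean t)\<^sup>2) = (LBINT t:{s..4 ^ n * s}. cdef t / (hmean t)\<^sup>2) + (LBINT t:{4 ^ n * s..4 ^ Suc n * s}. cdef t / (hmean t)\<^sup>2)"
    by (rule LBINT_Icc_split[OF set_integrable_Icc_continuous e(1,2)]) (rule continuous_quotients[OF s])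
  with Suc block_lower[OF e(3)] show ?case by (simp add: mult.assoc)
qed (simp add: set_lebesgue_integral_def, subst integral_discrete_difference[where X = "{s}" and g = "\<lambda>_. 0"], auto simp: indicator_def)

section \<open>The Fourier integral of the potential\<close>

text \<open>The symmetrized potential as a Fourier integral; \<open>sym_potential_eq_fpot\<close> identifies it with the defining series.\<close>

definition fpot :: "real \<Rightarrow> real" where
  "fpot x = (LBINT t:{0..pi}. (1 - cos (x * t)) * rinv t) / pi"

lemma borel_measurable_rinv [measurable]: "rinv \<in> borel_measurable borel"
proof -
  have [measurable]: "cdef \<in> borel_measurable borel" "smean \<in> borel_measurable borel"
    by (auto intro!: borel_measurable_continuous_onI continuous_cdef continuous_smean)
  show ?thesis unfolding rinv_def[abs_def] by measurable
qed

lemma rinv_le_inverse_cdef: "rinv t \<le> 1 / cdef t"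
proof (cases "cdef t = 0")
  case False
  then have "0 < cdef t" using cdef_nonneg[of t] by simp
  then have "cdef t / ((cdef t)\<^sup>2 + (smean t)\<^sup>2) \<le> cdef t / (cdef t)\<^sup>2" by (intro divide_left_mono mult_pos_pos add_pos_nonneg) auto
  also have "cdef t / (cdef t)\<^sup>2 = 1 / cdef t" using False by (simp add: power2_eq_square)
  finally show ?thesis by (simp add: rinv_def)
qed (simp add: rinv_def)

text \<open>The quadratic lower bound on \<open>cdef\<close> cancels the quadratic zero of \<open>1 - cos (x t)\<close>, so the singularity of
  \<open>rinv\<close> at \<open>0\<close> is harmless.\<close>

lemma one_minus_cos_rinv_le:
  assumes K: "0 < K" "K * t\<^sup>2 \<le> cdef t"
  shows "(1 - cos (x * t)) * rinv t \<le> x\<^sup>2 / (2 * K)"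
proof (cases "t = 0")
  case False
  have "(1 - cos (x * t)) * rinv t \<le> (x * t)\<^sup>2 / 2 * (1 / cdef t)"
    using one_minus_cos_le_sq rinv_le_inverse_cdef rinv_nonneg by (intro mult_mono) auto
  also have "\<dots> \<le> (x * t)\<^sup>2 / 2 * (1 / (K * t\<^sup>2))"
    using K False by (intro mult_left_mono divide_left_mono) (auto intro!: mult_pos_pos order.strict_trans2[OF _ K(2)])
  also have "\<dots> = x\<^sup>2 / (2 * K)" using K False by (simp add: power_mult_distrib)
  finally show ?thesis .
qed (use K in simp)

lemma integrable_fpot: "set_integrable lborel {0..pi} (\<lambda>t. (1 - cos (x * t)) * rinv t)"
proof -
  obtain c where c: "c > 0" "\<And>t. 0 \<le> t \<Longrightarrow> t \<le> pi \<Longrightarrow> c * t\<^sup>2 \<le> cdef t"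
    using cdef_ge_sq by blast
  show ?thesis unfolding set_integrable_def
  proof (rule Bochner_Integration.integrable_bound)
    show "integrable lborel (\<lambda>t. indicator {0..pi} t * (x\<^sup>2 / (2 * c)))" by simp
    have "\<bar>indicator {0..pi} t * ((1 - cos (x * t)) * rinv t)\<bar> \<le> indicator {0..pi} t * (x\<^sup>2 / (2 * c))" for t
      using one_minus_cos_rinv_le[OF c(1) c(2)[of t], of x] rinv_nonneg[of t]
      by (auto simp: indicator_def)
    then show "AE t in lborel. norm (indicator {0..pi} t *\<^sub>R ((1 - cos (x * t)) * rinv t)) \<le> norm (indicator {0..pi} t * (x\<^sup>2 / (2 * c)))"
      unfolding real_norm_def real_scaleR_def by (intro AE_I2 order_trans[OF _ abs_ge_self])
  qed simp
qed

lemma integrable_rinv: "0 < s \<Longrightarrow> set_integrable lborel {s..pi} rinv"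
  by (intro set_integrable_Icc_continuous continuous_quotients) auto

lemma fpot_nonneg: "0 \<le> fpot x"
  unfolding fpot_def set_lebesgue_integral_def
  by (intro divide_nonneg_nonneg integral_nonneg_AE AE_I2) (auto simp: indicator_def rinv_nonneg)

lemma fpot_le_of_dominated:
  assumes B: "set_integrable lborel {0..pi} B"
    and le: "\<And>t. 0 < t \<Longrightarrow> t \<le> pi \<Longrightarrow> (1 - cos (x * t)) * rinv t \<le> B t"
  shows "fpot x * pi \<le> (LBINT t:{0..pi}. B t)"
proof -
  have "(LBINT t:{0..pi}. (1 - cos (x * t)) * rinv t) \<le> (LBINT t:{0..pi}. B t)"
    unfolding set_lebesgue_integral_def
  proof (rule integral_mono_AE)
    show "AE t in lborel. indicator {0..pi} t *\<^sub>R ((1 - cos (x * t)) * rinv t) \<le> indicator {0..pi} t *\<^sub>R B t"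
      using AE_lborel_singleton[of 0] by eventually_elim (use le in \<open>auto simp: indicator_def\<close>)
  qed (use B integrable_fpot in \<open>auto simp: set_integrable_def\<close>)
  then show ?thesis by (simp add: fpot_def)
qed

lemma rinv_tail_le: "(1 - cos (x * t)) * rinv t \<le> 2 * rinv t"
  using one_minus_cos_le_2 rinv_nonneg by (intro mult_right_mono) auto

text \<open>Since \<open>cdef t / t^2\<close> exceeds any \<open>K\<close> near \<open>0\<close>, the integrand is at most \<open>x^2 / (2 K)\<close> up to \<open>1/x\<close> and
  \<open>2 / (K t^2)\<close> beyond, and each of the two pieces integrates to \<open>O(x / K)\<close>. The range away from \<open>0\<close> contributes
  a constant.\<close>

lemma fpot_sublinear:
  assumes "0 < e"
  shows "\<exists>x0. \<forall>x\<ge>x0. fpot x \<le> e * x"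
proof -
  \<comment> \<open>The bound below is \<open>\<pi> * fpot x \<le> 3 x / K + O(1)\<close>, and \<open>3/2 + 1 < \<pi>\<close>.\<close>
  define K where "K = 2 / e"
  have K: "0 < K" using assms by (simp add: K_def)
  obtain \<tau> where \<tau>: "\<tau> > 0" "\<tau> \<le> pi" and uK: "\<And>t. 0 < t \<Longrightarrow> t \<le> \<tau> \<Longrightarrow> K * t\<^sup>2 \<le> cdef t"
    using cdef_superquadratic[of K] by blast
  define D where "D = (LBINT t:{\<tau>..pi}. 2 * rinv t)"
  have D: "0 \<le> D" unfolding D_def set_lebesgue_integral_def
    by (intro integral_nonneg_AE AE_I2) (auto simp: indicator_def rinv_nonneg)
  have main: "fpot x * pi \<le> 3 * x / K + D" if x: "1 / \<tau> \<le> x" for x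
  proof -
    have x0: "0 < x" using x \<tau> by (intro order.strict_trans2[OF _ x]) simp
    then have "1 / x \<le> \<tau>" using x \<tau> by (simp add: field_simps)
    note x0 = x0 this
    define B where "B t = (indicator {0..1 / x} t * (x\<^sup>2 / (2 * K)) + indicator {1 / x..\<tau>} t * (2 / K * (1 / t\<^sup>2)))
      + indicator {\<tau>..pi} t * (2 * rinv t)" for t
    have c: "continuous_on {1 / x..\<tau>} (\<lambda>t. 2 / K * (1 / t\<^sup>2))"
      using x0 by (intro continuous_intros) auto
    have s1: "set_integrable lborel {0..pi} (\<lambda>t. indicator {0..1 / x} t * (x\<^sup>2 / (2 * K)))"
      using x0 \<tau> by (subst LBINT_indicator_mult) (auto intro!: set_integrable_Icc_continuous continuous_intros)
    have s2: "set_integrable lborel {0..pi} (\<lambda>t. indicator {1 / x..\<tau>} t * (2 / K * (1 / t\<^sup>2)))"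
      using x0 \<tau> c by (subst LBINT_indicator_mult) (auto intro!: set_integrable_Icc_continuous)
    have s3: "set_integrable lborel {0..pi} (\<lambda>t. indicator {\<tau>..pi} t * (2 * rinv t))"
      using x0 \<tau> integrable_rinv[of \<tau>] by (subst LBINT_indicator_mult) auto
    have "fpot x * pi \<le> (LBINT t:{0..pi}. B t)"
    proof (rule fpot_le_of_dominated)
      show "set_integrable lborel {0..pi} B"
        unfolding B_def by (intro set_integral_add s1 s2 s3)
      fix t assume t: "0 < t" "t \<le> pi"
      have i0: "0 \<le> indicator {0..1 / x} t * (x\<^sup>2 / (2 * K))" "0 \<le> indicator {1 / x..\<tau>} t * (2 / K * (1 / t\<^sup>2))"
          "0 \<le> indicator {\<tau>..pi} t * (2 * rinv t)"
        using K rinv_nonneg by (auto intro!: mult_nonneg_nonneg)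
      consider "t \<le> 1 / x" | "1 / x \<le> t" "t \<le> \<tau>" | "\<tau> \<le> t" by linarith
      then show "(1 - cos (x * t)) * rinv t \<le> B t"
      proof cases
        case 1
        then have "(1 - cos (x * t)) * rinv t \<le> x\<^sup>2 / (2 * K)"
          using one_minus_cos_rinv_le[OF K uK] t x0 by auto
        moreover have "B t = x\<^sup>2 / (2 * K) + indicator {1 / x..\<tau>} t * (2 / K * (1 / t\<^sup>2)) + indicator {\<tau>..pi} t * (2 * rinv t)"
          using 1 t by (simp add: B_def)
        ultimately show ?thesis using i0 by linarith
      next
        case 2
        have "(1 - cos (x * t)) * rinv t \<le> 2 * (1 / cdef t)"
          using rinv_tail_le[of x t] rinv_le_inverse_cdef[of t] by linarith
        also have "\<dots> \<le> 2 * (1 / (K * t\<^sup>2))"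
          using uK[of t] K t 2 by (intro mult_left_mono divide_left_mono mult_pos_pos order.strict_trans2[OF _ uK]) auto
        also have "\<dots> = 2 / K * (1 / t\<^sup>2)" by simp
        finally have "(1 - cos (x * t)) * rinv t \<le> 2 / K * (1 / t\<^sup>2)" .
        moreover have "B t = indicator {0..1 / x} t * (x\<^sup>2 / (2 * K)) + 2 / K * (1 / t\<^sup>2) + indicator {\<tau>..pi} t * (2 * rinv t)"
          using 2 t by (simp add: B_def)
        ultimately show ?thesis using i0 by linarith
      next
        case 3
        then show ?thesis using rinv_tail_le[of x t] t i0 unfolding B_def by simp
      qed
    qed
    also have "\<dots> = (LBINT t:{0..1 / x}. x\<^sup>2 / (2 * K)) + (LBINT t:{1 / x..\<tau>}. 2 / K * (1 / t\<^sup>2)) + D"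
    proof -
      have sub: "{0..1 / x} \<subseteq> {0..pi}" "{1 / x..\<tau>} \<subseteq> {0..pi}" "{\<tau>..pi} \<subseteq> {0..pi}" using x0 \<tau> by auto
      show ?thesis unfolding B_def D_def
        by (simp only: set_integral_add(2)[OF set_integral_add(1)[OF s1 s2] s3] set_integral_add(2)[OF s1 s2]
            LBINT_indicator_mult(1)[OF sub(1)] LBINT_indicator_mult(1)[OF sub(2)] LBINT_indicator_mult(1)[OF sub(3)])
    qed
    also have "(LBINT t:{1 / x..\<tau>}. 2 / K * (1 / t\<^sup>2)) = (- 2 / K * (1 / \<tau>)) - (- 2 / K * (1 / (1 / x)))"
    proof (rule LBINT_FTC_Icc[where F = "\<lambda>t. - 2 / K * (1 / t)"])
      fix t assume "1 / x \<le> t"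
      then have "t > 0" using x0 by (meson divide_pos_pos less_le_trans zero_less_one)
      then show "((\<lambda>t. - 2 / K * (1 / t)) has_real_derivative 2 / K * (1 / t\<^sup>2)) (at t)"
        using K by (auto intro!: derivative_eq_intros simp: power2_eq_square)
    qed (use c x0 K in auto)
    also have "(LBINT t:{0..1 / x}. x\<^sup>2 / (2 * K)) = x / (2 * K)"
      using x0 by (simp add: set_integral_const power2_eq_square)
    also have "x / (2 * K) + (- 2 / K * (1 / \<tau>) - - 2 / K * (1 / (1 / x))) + D \<le> 3 * x / K + D"
      using x0 K \<tau> by (simp add: field_simps)
    finally show ?thesis .
  qed
  show ?thesis
  proof (intro exI allI impI)
    fix x assume x: "max (1 / \<tau>) (D / e) \<le> x"
    have "fpot x * pi \<le> 3 * x / K + D" using main x by simp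
    also have "3 * x / K = 3 / 2 * (e * x)" by (simp add: K_def)
    also have "D \<le> e * x" using x assms by (simp add: field_simps)
    finally have "fpot x * pi \<le> 5 / 2 * (e * x)" by simp
    moreover have "0 \<le> e * x" using \<open>D \<le> e * x\<close> D by linarith
    moreover have "5 / 2 \<le> pi" using pi_gt3 by simp
    ultimately have "fpot x * pi \<le> (e * x) * pi"
      using mult_left_mono[of "5/2" pi "e * x"] by linarith
    then show "fpot x \<le> e * x" by simp
  qed
qed

section \<open>The liminf condition bounds the potential\<close>

text \<open>Under the lower bound on \<open>cdef + |smean|\<close> the kernel \<open>rinv\<close> is at most a multiple of \<open>sqmean / hmean^2\<close>. Below \<open>1/x\<close> the
  integrand is then bounded by a multiple of \<open>1 / hmean (1/x)\<close>; above \<open>1/x\<close> the block estimate applies; away from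
  \<open>0\<close> the contribution is a constant, which is absorbed because \<open>rate\<close> is bounded below.\<close>

lemma fpot_upper_bound:
  assumes \<delta>: "0 < \<delta>" and \<tau>: "0 < \<tau>" "\<tau> \<le> pi"
    and H: "\<And>t. 0 < t \<Longrightarrow> t \<le> \<tau> \<Longrightarrow> \<delta> * hmean t \<le> cdef t + \<bar>smean t\<bar>"
  shows "\<exists>C. \<forall>x\<ge>1. fpot x \<le> C * rate (1 / x)"
proof -
  \<comment> \<open>From \<open>(a + b)^2 \<le> 2 (a^2 + b^2)\<close> and \<open>cdef \<le> 2 sqmean\<close>.\<close>
  define C where "C = 4 / \<delta>\<^sup>2"
  have C: "0 < C" using \<delta> by (simp add: C_def)
  have rkC: "rinv t \<le> C * (sqmean t / (hmean t)\<^sup>2)" if t: "0 < t" "t \<le> \<tau>" for t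
  proof -
    have q: "0 < hmean t" using hmean_pos t by simp
    have "0 \<le> (cdef t - \<bar>smean t\<bar>)\<^sup>2" by simp
    then have "(cdef t + \<bar>smean t\<bar>)\<^sup>2 \<le> 2 * ((cdef t)\<^sup>2 + (smean t)\<^sup>2)"
      by (simp add: power2_sum power2_diff)
    moreover have "(\<delta> * hmean t)\<^sup>2 \<le> (cdef t + \<bar>smean t\<bar>)\<^sup>2"
      using H[OF t] \<delta> q by (intro power_mono) auto
    ultimately have "(\<delta> * hmean t)\<^sup>2 \<le> 2 * ((cdef t)\<^sup>2 + (smean t)\<^sup>2)" by (rule order_trans[rotated])
    then have "(\<delta> * hmean t)\<^sup>2 / 2 \<le> (cdef t)\<^sup>2 + (smean t)\<^sup>2" by simp
    then have "rinv t \<le> 2 * sqmean t / ((\<delta> * hmean t)\<^sup>2 / 2)"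
      unfolding rinv_def using cdef_le_sqmean[of t] cdef_nonneg[of t] sqmean_nonneg[of t] \<delta> q
      by (intro frac_le) auto
    also have "\<dots> = C * (sqmean t / (hmean t)\<^sup>2)" by (simp add: C_def power_mult_distrib)
    finally show ?thesis .
  qed
  define D where "D = (LBINT t:{\<tau>..pi}. 2 * rinv t)"
  have D: "0 \<le> D" unfolding D_def set_lebesgue_integral_def
    by (intro integral_nonneg_AE AE_I2) (auto simp: indicator_def rinv_nonneg)
  obtain c0 where c0: "c0 > 0" "\<And>t. t > 0 \<Longrightarrow> c0 \<le> rate t" using rate_lower_bound by blast
  have main: "fpot x * pi \<le> (C + 2 * C * 768 + D / c0) * rate (1 / x)" if x: "1 \<le> x" for x
  proof -
    define s where "s = 1 / x"
    have s: "0 < s" "s \<le> 1" "x * s = 1" using x by (auto simp: s_def field_simps)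
    then have s: "0 < s" "s \<le> pi" "x * s = 1" using pi_gt3 by auto
    obtain n :: nat where n: "\<tau> / s < 4 ^ n" using real_arch_pow[of 4 "\<tau> / s"] by auto
    define b where "b = min pi (4 ^ n * s)"
    have bs: "\<tau> \<le> b" "s \<le> b" "b \<le> pi" "b \<le> 4 ^ n * s"
      using n s \<tau> by (auto simp: b_def field_simps)
    define B where "B t = (indicator {0..s} t * (C / hmean s) + indicator {s..b} t * (2 * C * (sqmean t / (hmean t)\<^sup>2)))
      + indicator {\<tau>..pi} t * (2 * rinv t)" for t
    have c: "continuous_on {s..r} (\<lambda>t. 2 * C * (sqmean t / (hmean t)\<^sup>2))" for r
      by (intro continuous_intros continuous_quotients s)
    have s1: "set_integrable lborel {0..pi} (\<lambda>t. indicator {0..s} t * (C / hmean s))"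
      using s by (subst LBINT_indicator_mult) (auto intro!: set_integrable_Icc_continuous continuous_intros)
    have s2: "set_integrable lborel {0..pi} (\<lambda>t. indicator {s..b} t * (2 * C * (sqmean t / (hmean t)\<^sup>2)))"
      using s bs c by (subst LBINT_indicator_mult) (auto intro!: set_integrable_Icc_continuous)
    have s3: "set_integrable lborel {0..pi} (\<lambda>t. indicator {\<tau>..pi} t * (2 * rinv t))"
      using \<tau> integrable_rinv[of \<tau>] by (subst LBINT_indicator_mult) auto
    have "fpot x * pi \<le> (LBINT t:{0..pi}. B t)"
    proof (rule fpot_le_of_dominated)
      show "set_integrable lborel {0..pi} B"
        unfolding B_def by (intro set_integral_add s1 s2 s3)
      fix t assume t: "0 < t" "t \<le> pi"
      have i0: "0 \<le> indicator {0..s} t * (C / hmean s)" "0 \<le> indicator {s..b} t * (2 * C * (sqmean t / (hmean t)\<^sup>2))"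
          "0 \<le> indicator {\<tau>..pi} t * (2 * rinv t)"
        using C rinv_nonneg sqmean_nonneg hmean_nonneg by (auto intro!: mult_nonneg_nonneg)
      consider "\<tau> \<le> t" | "t \<le> \<tau>" "t \<le> s" | "s \<le> t" "t \<le> \<tau>" by linarith
      then show "(1 - cos (x * t)) * rinv t \<le> B t"
      proof cases
        case 1
        then show ?thesis using rinv_tail_le[of x t] t i0 unfolding B_def by simp
      next
        case 2
        have q: "0 < hmean t" "0 < hmean s" using hmean_pos t s by auto
        have "(1 - cos (x * t)) * rinv t \<le> (x * t)\<^sup>2 / 2 * (C * (2 * hmean t / (hmean t)\<^sup>2))"
        proof (rule mult_mono[OF one_minus_cos_le_sq])
          have "C * (sqmean t / (hmean t)\<^sup>2) \<le> C * (2 * hmean t / (hmean t)\<^sup>2)"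
            using sqmean_le_hmean[of t] C by (intro mult_left_mono divide_right_mono) auto
          with rkC[OF t(1) 2(1)] show "rinv t \<le> C * (2 * hmean t / (hmean t)\<^sup>2)" by linarith
        qed (use rinv_nonneg in auto)
        also have "\<dots> = C * x\<^sup>2 * (t\<^sup>2 / hmean t)"
          using q by (simp add: power_mult_distrib power2_eq_square)
        also have "\<dots> \<le> C * x\<^sup>2 * (s\<^sup>2 / hmean s)"
        proof (rule mult_left_mono)
          show "t\<^sup>2 / hmean t \<le> s\<^sup>2 / hmean s"
            using hmean_mono_ratio(2)[OF t(1) 2(2)] q by (simp add: field_simps)
        qed (use C in simp)
        also have "\<dots> = C * (x * s)\<^sup>2 / hmean s" by (simp add: power_mult_distrib)
        also have "\<dots> = C / hmean s" using s by simp
        finally have "(1 - cos (x * t)) * rinv t \<le> C / hmean s" .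
        moreover have "B t = C / hmean s + indicator {s..b} t * (2 * C * (sqmean t / (hmean t)\<^sup>2)) + indicator {\<tau>..pi} t * (2 * rinv t)"
          using 2 t by (simp add: B_def)
        ultimately show ?thesis using i0 by linarith
      next
        case 3
        then have "(1 - cos (x * t)) * rinv t \<le> 2 * C * (sqmean t / (hmean t)\<^sup>2)"
          using rinv_tail_le[of x t] rkC[OF t(1) 3(2)] by linarith
        moreover have "t \<le> b" using 3 bs by simp
        then have "B t = indicator {0..s} t * (C / hmean s) + 2 * C * (sqmean t / (hmean t)\<^sup>2) + indicator {\<tau>..pi} t * (2 * rinv t)"
          using 3 t by (simp add: B_def)
        ultimately show ?thesis using i0 by linarith
      qed
    qed
    also have "\<dots> = (LBINT t:{0..s}. C / hmean s) + (LBINT t:{s..b}. 2 * C * (sqmean t / (hmean t)\<^sup>2)) + D"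
    proof -
      have sub: "{0..s} \<subseteq> {0..pi}" "{s..b} \<subseteq> {0..pi}" "{\<tau>..pi} \<subseteq> {0..pi}" using s bs \<tau> by auto
      show ?thesis unfolding B_def D_def
        by (simp only: set_integral_add(2)[OF set_integral_add(1)[OF s1 s2] s3] set_integral_add(2)[OF s1 s2]
            LBINT_indicator_mult(1)[OF sub(1)] LBINT_indicator_mult(1)[OF sub(2)] LBINT_indicator_mult(1)[OF sub(3)])
    qed
    also have "(LBINT t:{0..s}. C / hmean s) = C * rate s"
      using s by (simp add: set_integral_const rate_def)
    also have "(LBINT t:{s..b}. 2 * C * (sqmean t / (hmean t)\<^sup>2)) \<le> (LBINT t:{s..4 ^ n * s}. 2 * C * (sqmean t / (hmean t)\<^sup>2))"
      by (rule set_integral_mono_set_nonneg[OF set_integrable_Icc_continuous[OF c]])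
         (use bs C sqmean_nonneg in auto)
    also have "\<dots> = 2 * C * (LBINT t:{s..4 ^ n * s}. sqmean t / (hmean t)\<^sup>2)"
      by (rule set_integral_mult_right)
    also have "\<dots> \<le> 2 * C * (768 * rate s)"
    proof (rule mult_left_mono)
      show "(LBINT t:{s..4 ^ n * s}. sqmean t / (hmean t)\<^sup>2) \<le> 768 * rate s"
        using blocks_upper[OF s(1), of n] rate_pos[of "4 ^ n * s"] s by simp
    qed (use C in simp)
    also have "D \<le> D / c0 * rate s"
      using mult_left_mono[OF c0(2)[OF s(1)], of "D / c0"] D c0 by simp
    finally show ?thesis by (simp add: s_def algebra_simps)
  qed
  show ?thesis
  proof (intro exI allI impI)
    fix x :: real assume "1 \<le> x"
    from main[OF this] show "fpot x \<le> (C + 2 * C * 768 + D / c0) / pi * rate (1 / x)"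
      by (simp add: field_simps)
  qed
qed

section \<open>A bound on the potential forces the liminf condition\<close>

text \<open>The factor \<open>1 - cos (x t)\<close> vanishes at the multiples of \<open>2 \<pi> / x\<close>, so a single \<open>x\<close> says nothing about
  \<open>rinv\<close> there. Its average over \<open>x = 1, .., n\<close> is at least \<open>1/2\<close> for all \<open>t \<ge> 6/n\<close>, while the bounds
  on \<open>fpot\<close> average to a bound of the same order because \<open>rate\<close> is monotone.\<close>

lemma rinv_integral_le_of_fpot_bound:
  assumes C: "\<And>z::nat. z0 \<le> z \<Longrightarrow> fpot (real z) \<le> C * rate (1 / real z)"
  shows "\<exists>C0>0. \<forall>s. 0 < s \<and> s \<le> 1 \<longrightarrow> (LBINT t:{s..pi}. rinv t) \<le> C0 * rate s"
proof -
  obtain c0 where c0: "c0 > 0" "\<And>t. t > 0 \<Longrightarrow> c0 \<le> rate t" using rate_lower_bound by blast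
  \<comment> \<open>The finitely many \<open>z < z0\<close> are absorbed with the lower bound \<open>c0\<close> on \<open>rate\<close>.\<close>
  define C' where "C' = max 0 C + (\<Sum>z<z0. fpot (real z)) / c0 + 1"
  have S0: "0 \<le> (\<Sum>z<z0. fpot (real z))" by (intro sum_nonneg fpot_nonneg)
  have "0 \<le> (\<Sum>z<z0. fpot (real z)) / c0" using c0 S0 by simp
  then have C': "0 < C'" "C \<le> C'" unfolding C'_def by linarith+
  have b: "fpot (real z) \<le> C' * rate (1 / real z)" if z: "1 \<le> z" for z
  proof (cases "z0 \<le> z")
    case True
    have "C * rate (1 / real z) \<le> C' * rate (1 / real z)"
      using C' rate_pos[of "1 / real z"] z by (intro mult_right_mono) auto
    with C[OF True] show ?thesis by linarith
  next
    case False
    have "fpot (real z) \<le> (\<Sum>z<z0. fpot (real z))"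
      using False by (intro member_le_sum fpot_nonneg) auto
    also have "\<dots> = (\<Sum>z<z0. fpot (real z)) / c0 * c0" using c0 by simp
    also have "\<dots> \<le> C' * rate (1 / real z)"
      using c0 z S0 C' by (intro mult_mono) (auto simp: C'_def)
    finally show ?thesis .
  qed
  have avg: "(LBINT t:{6 / real n..pi}. rinv t) \<le> 2 * pi * C' * rate (1 / real n)" if n: "6 \<le> n" for n :: nat
  proof -
    have n0: "0 < 6 / real n" using n by simp
    have int: "set_integrable lborel {0..pi} (\<lambda>t. (1 - cos (real z * t)) * rinv t)" for z :: nat
      by (rule integrable_fpot)
    have sumeq: "pi * (\<Sum>z=1..n. fpot (real z)) = (LBINT t:{0..pi}. \<Sum>z=1..n. (1 - cos (real z * t)) * rinv t)"
    proof -
      have "(LBINT t:{0..pi}. \<Sum>z=1..n. (1 - cos (real z * t)) * rinv t) = (\<Sum>z=1..n. LBINT t:{0..pi}. (1 - cos (real z * t)) * rinv t)"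
        using int unfolding set_lebesgue_integral_def set_integrable_def
        by (subst Bochner_Integration.integral_sum[symmetric]) (simp_all add: sum_distrib_left)
      then show ?thesis by (simp add: fpot_def sum_distrib_left)
    qed
    have si: "set_integrable lborel {0..pi} (\<lambda>t. \<Sum>z=1..n. (1 - cos (real z * t)) * rinv t)"
    proof -
      have "integrable lborel (\<lambda>t. \<Sum>z=1..n. indicator {0..pi} t *\<^sub>R ((1 - cos (real z * t)) * rinv t))"
        using int unfolding set_integrable_def by (intro Bochner_Integration.integrable_sum) auto
      then show ?thesis by (simp add: set_integrable_def sum_distrib_left)
    qed
    have nn: "0 \<le> (\<Sum>z=1..n. (1 - cos (real z * t)) * rinv t)" for t
      by (intro sum_nonneg mult_nonneg_nonneg rinv_nonneg) auto
    have "real n / 2 * (LBINT t:{6 / real n..pi}. rinv t) = (LBINT t:{6 / real n..pi}. real n / 2 * rinv t)"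
      by simp
    also have "\<dots> \<le> (LBINT t:{6 / real n..pi}. \<Sum>z=1..n. (1 - cos (real z * t)) * rinv t)"
    proof (rule set_integral_mono)
      show "set_integrable lborel {6 / real n..pi} (\<lambda>t. real n / 2 * rinv t)"
        using integrable_rinv[OF n0] by simp
      show "set_integrable lborel {6 / real n..pi} (\<lambda>t. \<Sum>z=1..n. (1 - cos (real z * t)) * rinv t)"
        by (rule set_integrable_subset[OF si]) (use n0 in auto)
      fix t assume t: "t \<in> {6 / real n..pi}"
      then have t0: "0 < t" by (intro order.strict_trans2[OF n0]) simp
      have "3 / t \<le> 3 / (6 / real n)" using t n0 t0 by (intro divide_left_mono mult_pos_pos) (auto simp only: atLeastAtMost_iff)
      then have "3 / t \<le> real n / 2" by simp
      with sum_cos_le[OF t0, of n] t have "(\<Sum>z=1..n. cos (real z * t)) \<le> real n / 2" by simp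
      then have "real n / 2 * rinv t \<le> (\<Sum>z=1..n. (1 - cos (real z * t))) * rinv t"
        using rinv_nonneg by (intro mult_right_mono) (auto simp: sum_subtractf)
      then show "real n / 2 * rinv t \<le> (\<Sum>z=1..n. (1 - cos (real z * t)) * rinv t)"
        by (simp add: sum_distrib_right)
    qed
    also have "\<dots> \<le> (LBINT t:{0..pi}. \<Sum>z=1..n. (1 - cos (real z * t)) * rinv t)"
      by (rule set_integral_mono_set_nonneg[OF si]) (use n0 nn in auto)
    also have "\<dots> = pi * (\<Sum>z=1..n. fpot (real z))" by (rule sumeq[symmetric])
    also have "\<dots> \<le> pi * (\<Sum>z=1..n. C' * rate (1 / real n))"
    proof (intro mult_left_mono sum_mono)
      fix z assume z: "z \<in> {1..n}"
      have "rate (1 / real z) \<le> rate (1 / real n)"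
        using z by (intro rate_antimono) (auto simp: field_simps)
      then have "C' * rate (1 / real z) \<le> C' * rate (1 / real n)" using C' by (intro mult_left_mono) auto
      with b[of z] z show "fpot (real z) \<le> C' * rate (1 / real n)" by auto
    qed simp
    also have "\<dots> = real n / 2 * (2 * pi * C' * rate (1 / real n))" by simp
    finally show ?thesis using n by simp
  qed
  have "(LBINT t:{s..pi}. rinv t) \<le> 16 * pi * C' * rate s" if s: "0 < s" "s \<le> 1" for s
  proof -
    \<comment> \<open>The averaging range matched to \<open>s\<close>: \<open>6/n \<le> s\<close> and \<open>s/8 \<le> 1/n\<close>.\<close>
    define n where "n = nat \<lceil>6 / s\<rceil>"
    have n1: "6 / s \<le> real n" by (simp add: n_def real_nat_ceiling_ge)
    have "6 \<le> 6 / s" using s by (simp add: field_simps)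
    then have n6: "6 \<le> n" using n1 by linarith
    have "real n < 6 / s + 1" using s unfolding n_def by (simp add: of_nat_nat ceiling_less_iff) linarith
    also have "\<dots> \<le> 8 / s" using s by (simp add: field_simps)
    finally have n8: "s / 8 \<le> 1 / real n" using s n6 by (simp add: field_simps)
    have "(LBINT t:{s..pi}. rinv t) \<le> (LBINT t:{6 / real n..pi}. rinv t)"
      by (rule set_integral_mono_set_nonneg[OF integrable_rinv])
         (use n1 n6 s rinv_nonneg in \<open>auto simp: field_simps\<close>)
    also have "\<dots> \<le> 2 * pi * C' * rate (1 / real n)" by (rule avg[OF n6])
    also have "\<dots> \<le> 2 * pi * C' * (8 * rate s)"
    proof (rule mult_left_mono)
      have "rate (1 / real n) \<le> rate (s / 8)" using s n8 by (intro rate_antimono) auto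
      also have "\<dots> \<le> 8 * rate s" using rate_scale[of "s / 8" 8] s by simp
      finally show "rate (1 / real n) \<le> 8 * rate s" .
    qed (use C' in simp)
    finally show ?thesis by simp
  qed
  then show ?thesis using C' by (intro exI[of _ "16 * pi * C'"]) auto
qed

lemma rinv_ge_of_le:
  assumes "0 < a" "(cdef t)\<^sup>2 + (smean t)\<^sup>2 \<le> a" shows "cdef t / a \<le> rinv t"
proof (cases "(cdef t)\<^sup>2 + (smean t)\<^sup>2 = 0")
  case False
  then have "0 < (cdef t)\<^sup>2 + (smean t)\<^sup>2" by (smt (verit) zero_le_power2)
  then show ?thesis unfolding rinv_def using assms cdef_nonneg by (intro divide_left_mono mult_pos_pos) auto
qed (simp add: rinv_def sum_power2_eq_zero_iff)

text \<open>If \<open>cdef / hmean\<close> rises from \<open>\<epsilon>\<close> to \<open>\<delta>\<close>, let \<open>w\<close> be the last point at which it is at most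
  \<open>\<epsilon>\<close>. After \<open>w\<close> the cosine defect dominates \<open>smean\<close>, so \<open>rinv \<ge> 1 / (2 cdef)\<close>, and
  \<open>cdef\<close> cannot exceed \<open>(\<epsilon> + 4 (t - w) / w) * hmean w\<close>. The climb therefore takes at least a time of order \<open>\<delta> w\<close>, and
  integrating the reciprocal of the linear bound produces the logarithm.\<close>

lemma cos_defect_crossing:
  assumes s: "0 < s" "s \<le> t1" "t1 \<le> pi"
    and \<delta>: "0 < \<epsilon>" "\<epsilon> \<le> \<delta> / 2" "\<delta> \<le> 1"
    and low: "cdef s \<le> \<epsilon> * hmean s" and high: "\<delta> * hmean t1 < cdef t1"
    and smean: "\<And>t. s \<le> t \<Longrightarrow> t \<le> t1 \<Longrightarrow> \<bar>smean t\<bar> \<le> \<epsilon> * hmean t"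
  shows "\<exists>w. s \<le> w \<and> w \<le> t1 \<and> rate w / 8 * ln (1 + \<delta> / (2 * \<epsilon>)) \<le> (LBINT t:{s..t1}. rinv t)"
proof -
  \<comment> \<open>\<open>S\<close> is compact, so the last time \<open>w\<close> at which \<open>cdef \<le> \<epsilon> * hmean\<close> is attained.\<close>
  define S where "S = {s..t1} \<inter> (\<lambda>t. cdef t - \<epsilon> * hmean t) -` {..0}"
  have "closed S" unfolding S_def
    by (intro continuous_closed_preimage continuous_intros continuous_cdef continuous_hmean)
  then have "compact S"
    using compact_Int_closed[OF compact_Icc[of s t1], of S] by (simp add: S_def)
  moreover have "s \<in> S" using low s by (simp add: S_def)
  ultimately obtain w where w: "w \<in> S" and wmax: "\<And>t. t \<in> S \<Longrightarrow> t \<le> w"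
    using compact_attains_sup[of S] by auto
  have ws: "s \<le> w" "w \<le> t1" "cdef w \<le> \<epsilon> * hmean w" using w by (auto simp: S_def)
  have w0: "0 < w" using ws s by simp
  have q: "0 < hmean w" by (rule hmean_pos[OF w0])
  have after: "\<epsilon> * hmean t < cdef t" if "w < t" "t \<le> t1" for t
    using wmax[of t] that ws by (force simp: S_def)
  \<comment> \<open>By the Lipschitz bound the ratio needs at least the time \<open>(\<delta> - \<epsilon>) w / 4 \<ge> \<delta> w / 8\<close> to reach \<open>\<delta>\<close>.\<close>
  define e where "e = w + \<delta> / 8 * w"
  have e2: "e \<le> 2 * w" "w \<le> e" using \<delta> w0 by (auto simp: e_def)
  have et: "e \<le> t1"
  proof (cases "t1 \<le> 2 * w")
    case True
    have "hmean w \<le> hmean t1" using hmean_mono_ratio(3)[OF w0 ws(2)] .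
    then have "\<delta> * hmean w \<le> \<delta> * hmean t1" using \<delta> by (intro mult_left_mono) auto
    also have "\<delta> * hmean t1 < cdef t1" by (rule high)
    also have "cdef t1 \<le> cdef w + 4 * ((t1 - w) / w) * hmean w"
      using cdef_diff_le[OF w0 ws(2) True] by linarith
    also have "\<dots> \<le> (\<epsilon> + 4 * ((t1 - w) / w)) * hmean w" using ws(3) by (simp add: distrib_right)
    finally have "\<delta> < \<epsilon> + 4 * ((t1 - w) / w)" using q by simp
    then have "\<delta> / 8 \<le> (t1 - w) / w" using \<delta> by linarith
    then show ?thesis using w0 by (simp add: e_def field_simps)
  next
    case False
    then show ?thesis using e2 by linarith
  qed
  define f where "f t = 1 / (2 * hmean w * (\<epsilon> + 4 * ((t - w) / w)))" for t
  have pos: "0 < \<epsilon> + 4 * ((t - w) / w)" if "w \<le> t" for t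
    using that w0 \<delta> by (intro add_pos_nonneg) auto
  have cf: "continuous_on {w..e} f"
    unfolding f_def[abs_def] using q pos w0 by (intro continuous_intros) (auto simp: less_imp_neq[symmetric])
  have "(LBINT t:{w..e}. f t) = w / (8 * hmean w) * ln (\<epsilon> + 4 * ((e - w) / w)) - w / (8 * hmean w) * ln (\<epsilon> + 4 * ((w - w) / w))"
  proof (rule LBINT_FTC_Icc[where F = "\<lambda>t. w / (8 * hmean w) * ln (\<epsilon> + 4 * ((t - w) / w))"])
    fix t assume "w \<le> t"
    from pos[OF this] show "((\<lambda>t. w / (8 * hmean w) * ln (\<epsilon> + 4 * ((t - w) / w))) has_real_derivative f t) (at t)"
      using q w0 by (auto intro!: derivative_eq_intros simp: f_def)
  qed (use cf e2 in auto)
  also have "\<dots> = w / (8 * hmean w) * (ln (\<epsilon> + \<delta> / 2) - ln \<epsilon>)"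
    using w0 by (simp add: e_def right_diff_distrib)
  also have "ln (\<epsilon> + \<delta> / 2) - ln \<epsilon> = ln ((\<epsilon> + \<delta> / 2) / \<epsilon>)" using \<delta> by (subst ln_div) auto
  also have "(\<epsilon> + \<delta> / 2) / \<epsilon> = 1 + \<delta> / (2 * \<epsilon>)" using \<delta> by (simp add: field_simps)
  also have "w / (8 * hmean w) = rate w / 8" by (simp add: rate_def)
  finally have "rate w / 8 * ln (1 + \<delta> / (2 * \<epsilon>)) = (LBINT t:{w..e}. f t)" by simp
  also have "\<dots> \<le> (LBINT t:{w..e}. rinv t)"
    unfolding set_lebesgue_integral_def
  proof (rule integral_mono_AE)
    show "integrable lborel (\<lambda>t. indicator {w..e} t *\<^sub>R f t)"
      using set_integrable_Icc_continuous[OF cf] by (simp add: set_integrable_def)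
    show "integrable lborel (\<lambda>t. indicator {w..e} t *\<^sub>R rinv t)"
      using set_integrable_Icc_continuous[OF continuous_quotients(3)[OF w0, of e]] et s by (simp add: set_integrable_def)
    have "f t \<le> rinv t" if t: "w < t" "t \<le> e" for t
    proof -
      have t1: "t \<le> t1" "t \<le> 2 * w" using t et e2 by auto
      have u: "\<epsilon> * hmean t < cdef t" by (rule after[OF t(1) t1(1)])
      have up: "0 < cdef t" using u \<delta> hmean_pos[of t] t w0 mult_pos_pos[of \<epsilon> "hmean t"] by linarith
      have "\<bar>smean t\<bar> \<le> cdef t" using smean[of t] u t t1 ws by linarith
      then have v2: "(smean t)\<^sup>2 \<le> (cdef t)\<^sup>2" using up by (simp add: abs_le_square_iff[symmetric])
      have "cdef t \<le> cdef w + 4 * ((t - w) / w) * hmean w"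
        using cdef_diff_le[OF w0 _ t1(2)] t by simp
      also have "\<dots> \<le> (\<epsilon> + 4 * ((t - w) / w)) * hmean w" using ws(3) by (simp add: distrib_right)
      finally have ub: "cdef t \<le> (\<epsilon> + 4 * ((t - w) / w)) * hmean w" .
      have "f t \<le> 1 / (2 * cdef t)"
      proof -
        have "1 / (2 * ((\<epsilon> + 4 * ((t - w) / w)) * hmean w)) \<le> 1 / (2 * cdef t)"
          using pos[of t] t q ub up by (intro divide_left_mono mult_pos_pos mult_left_mono) auto
        then show ?thesis by (simp add: f_def mult_ac)
      qed
      also have "\<dots> = cdef t / (2 * (cdef t)\<^sup>2)" using up by (simp add: power2_eq_square)
      also have "\<dots> \<le> rinv t" using v2 up by (intro rinv_ge_of_le) auto
      finally show ?thesis .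
    qed
    then show "AE t in lborel. indicator {w..e} t *\<^sub>R f t \<le> indicator {w..e} t *\<^sub>R rinv t"
      using AE_lborel_singleton[of w] by (auto elim!: eventually_mono simp: indicator_def)
  qed
  also have "\<dots> \<le> (LBINT t:{s..t1}. rinv t)"
    by (rule set_integral_mono_set_nonneg[OF set_integrable_Icc_continuous[OF continuous_quotients(3)]])
       (use s ws et rinv_nonneg in auto)
  finally show ?thesis using ws by auto
qed

text \<open>The dichotomy that proves necessity. It is run on the stretch \<open>[s, b]\<close> over which \<open>rate\<close> is roughly halved, so that
  \<open>rate\<close> stays comparable with \<open>rate s\<close>, and yet its drop is a fixed fraction of \<open>rate s\<close>.\<close>

lemma cos_defect_lower_bound:
  assumes C0: "0 < C0" and I: "\<And>s. 0 < s \<Longrightarrow> s \<le> 1 \<Longrightarrow> (LBINT t:{s..pi}. rinv t) \<le> C0 * rate s"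
    and smean_small: "\<And>\<epsilon>. 0 < \<epsilon> \<Longrightarrow> \<exists>\<tau>>0. \<forall>t. 0 < t \<and> t \<le> \<tau> \<longrightarrow> \<bar>smean t\<bar> \<le> \<epsilon> * hmean t"
  shows "\<exists>\<epsilon>>0. \<exists>\<tau>>0. \<forall>t. 0 < t \<and> t \<le> \<tau> \<longrightarrow> \<epsilon> * hmean t \<le> cdef t"
proof -
  \<comment> \<open>In the first case the kernel integrates to at least \<open>rate s / (4608 \<delta>^2)\<close>; this \<open>\<delta>\<close> makes that exceed \<open>C0 * rate s\<close>.\<close>
  define \<delta> where "\<delta> = min 1 (1 / sqrt (9216 * C0))"
  have \<delta>: "0 < \<delta>" "\<delta> \<le> 1" using C0 by (auto simp: \<delta>_def)
  have \<delta>2: "\<delta>\<^sup>2 * (9216 * C0) \<le> 1"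
  proof -
    have "\<delta>\<^sup>2 \<le> (1 / sqrt (9216 * C0))\<^sup>2" using \<delta> by (intro power_mono) (auto simp: \<delta>_def)
    also have "\<dots> = 1 / (9216 * C0)" using C0 by (simp add: power_divide)
    finally show ?thesis using C0 by (simp add: field_simps)
  qed
  \<comment> \<open>In the second case the logarithm has to exceed \<open>64 C0\<close>, where one \<open>8\<close> comes from the crossing estimate and the other from \<open>rate w > rate s / 8\<close>.\<close>
  define \<epsilon> where "\<epsilon> = \<delta> / (2 * exp (64 * C0))"
  have \<epsilon>: "0 < \<epsilon>" "\<epsilon> \<le> \<delta> / 2" using \<delta> C0 by (auto simp: \<epsilon>_def field_simps)
  have "\<delta> / (2 * \<epsilon>) = exp (64 * C0)" using \<delta> by (simp add: \<epsilon>_def)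
  then have "ln (1 + \<delta> / (2 * \<epsilon>)) > ln (exp (64 * C0))"
    by (subst ln_less_cancel_iff) (auto intro: add_pos_pos)
  then have ln: "64 * C0 < ln (1 + \<delta> / (2 * \<epsilon>))" by simp
  obtain \<tau>1 where \<tau>1: "\<tau>1 > 0" "\<And>t. 0 < t \<Longrightarrow> t \<le> \<tau>1 \<Longrightarrow> \<bar>smean t\<bar> \<le> \<epsilon> * hmean t"
    using smean_small[OF \<epsilon>(1)] by blast
  define \<tau> where "\<tau> = min 1 \<tau>1"
  have \<tau>: "0 < \<tau>" "\<tau> \<le> 1" "\<tau> \<le> pi" using \<tau>1 pi_gt3 by (auto simp: \<tau>_def)
  obtain \<sigma> where \<sigma>: "\<sigma> > 0" "\<And>t. 0 < t \<Longrightarrow> t \<le> \<sigma> \<Longrightarrow> 8 * rate \<tau> \<le> rate t"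
    using rate_unbounded[of "8 * rate \<tau>"] by blast
  have "\<epsilon> * hmean s \<le> cdef s" if s: "0 < s" "s \<le> min \<sigma> \<tau>" for s
  proof (rule ccontr)
    assume "\<not> ?thesis"
    then have low: "cdef s \<le> \<epsilon> * hmean s" by simp
    have gs: "8 * rate \<tau> \<le> rate s" "0 < rate s" using \<sigma>(2)[of s] s rate_pos by auto
    have s1: "s \<le> 1" using s \<tau> by simp
    \<comment> \<open>One quadrupling divides \<open>rate\<close> by at most \<open>4\<close>, so at the first halving it is still above \<open>rate s / 8\<close>.\<close>
    define N where "N = (LEAST n. rate (4 ^ n * s) \<le> rate s / 2)"
    obtain n0 :: nat where "\<tau> / s < 4 ^ n0" using real_arch_pow[of 4 "\<tau> / s"] by auto
    then have "\<tau> \<le> 4 ^ n0 * s" using s by (simp add: field_simps)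
    from rate_antimono[OF \<tau>(1) this] gs have "rate (4 ^ n0 * s) \<le> rate s / 2" by linarith
    then have NN: "rate (4 ^ N * s) \<le> rate s / 2" unfolding N_def by (rule LeastI)
    have "N \<noteq> 0" using NN gs by (intro notI) simp
    then obtain m where m: "N = Suc m" by (cases N) auto
    have "\<not> rate (4 ^ m * s) \<le> rate s / 2"
      using not_less_Least[of m "\<lambda>n. rate (4 ^ n * s) \<le> rate s / 2"] m unfolding N_def by simp
    moreover have "rate (4 ^ m * s) \<le> 4 * rate (4 ^ N * s)"
      using rate_scale[of "4 ^ m * s" 4] s by (simp add: m mult.assoc)
    ultimately have g8: "rate s / 8 < rate (4 ^ N * s)" by linarith
    define b where "b = 4 ^ N * s"
    have b\<tau>: "b \<le> \<tau>"
    proof (rule ccontr)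
      assume "\<not> b \<le> \<tau>"
      then have "rate b \<le> rate \<tau>" using \<tau> by (intro rate_antimono) auto
      with g8 gs show False by (simp add: b_def)
    qed
    have sb: "s \<le> b" using s by (simp add: b_def)
    have smean: "\<bar>smean t\<bar> \<le> \<epsilon> * hmean t" if "s \<le> t" "t \<le> b" for t
      using \<tau>1(2)[of t] that s b\<tau> by (auto simp: \<tau>_def)
    have Is: "(LBINT t:{s..pi}. rinv t) \<le> C0 * rate s" using I s s1 by simp
    show False
    proof (cases "\<forall>t\<in>{s..b}. cdef t \<le> \<delta> * hmean t")
      case True
      have "1 * (rate s / 2) \<le> rate s - rate b" using NN by (simp add: b_def)
      also have "\<dots> \<le> 1152 * (LBINT t:{s..b}. cdef t / (hmean t)\<^sup>2)"
        unfolding b_def by (rule blocks_lower) (use s in simp)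
      also have "(LBINT t:{s..b}. cdef t / (hmean t)\<^sup>2) \<le> (LBINT t:{s..b}. 2 * \<delta>\<^sup>2 * rinv t)"
      proof (rule set_integral_mono)
        show "set_integrable lborel {s..b} (\<lambda>t. cdef t / (hmean t)\<^sup>2)"
          by (intro set_integrable_Icc_continuous continuous_quotients s)
        show "set_integrable lborel {s..b} (\<lambda>t. 2 * \<delta>\<^sup>2 * rinv t)"
          using b\<tau> \<tau> by (intro set_integrable_Icc_continuous continuous_intros continuous_quotients s) auto
        fix t assume t: "t \<in> {s..b}"
        then have q: "0 < hmean t" using s by (intro hmean_pos) auto
        have "\<bar>smean t\<bar> \<le> \<epsilon> * hmean t" using smean t by simp
        also have "\<dots> \<le> \<delta> * hmean t" using \<epsilon> \<delta> q by (intro mult_right_mono) auto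
        finally have "\<bar>smean t\<bar>\<^sup>2 \<le> (\<delta> * hmean t)\<^sup>2" by (intro power_mono) auto
        moreover have "(cdef t)\<^sup>2 \<le> (\<delta> * hmean t)\<^sup>2" using True t cdef_nonneg by (intro power_mono) auto
        ultimately have "(cdef t)\<^sup>2 + (smean t)\<^sup>2 \<le> 2 * (\<delta> * hmean t)\<^sup>2" unfolding power2_abs by (simp only: mult_2 add_mono)
        then have "cdef t / (2 * (\<delta> * hmean t)\<^sup>2) \<le> rinv t" using \<delta> q by (intro rinv_ge_of_le) auto
        then have "2 * \<delta>\<^sup>2 * (cdef t / (2 * (\<delta> * hmean t)\<^sup>2)) \<le> 2 * \<delta>\<^sup>2 * rinv t" by (intro mult_left_mono) auto
        then show "cdef t / (hmean t)\<^sup>2 \<le> 2 * \<delta>\<^sup>2 * rinv t" using \<delta> by (simp add: power_mult_distrib)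
      qed
      also have "1152 * (LBINT t:{s..b}. 2 * \<delta>\<^sup>2 * rinv t) = 2304 * \<delta>\<^sup>2 * (LBINT t:{s..b}. rinv t)" by simp
      also have "2304 * \<delta>\<^sup>2 * (LBINT t:{s..b}. rinv t) \<le> 2304 * \<delta>\<^sup>2 * (C0 * rate s)"
      proof (rule mult_left_mono)
        have "(LBINT t:{s..b}. rinv t) \<le> (LBINT t:{s..pi}. rinv t)"
          by (rule set_integral_mono_set_nonneg[OF integrable_rinv]) (use s b\<tau> \<tau> rinv_nonneg in auto)
        with Is show "(LBINT t:{s..b}. rinv t) \<le> C0 * rate s" by linarith
      qed simp
      also have "\<dots> = (\<delta>\<^sup>2 * (9216 * C0)) * (rate s / 4)" by simp
      also have "\<dots> \<le> 1 * (rate s / 4)" using gs by (intro mult_right_mono \<delta>2) auto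
      finally show False using gs by simp
    next
      case False
      then obtain t1 where t1: "s \<le> t1" "t1 \<le> b" "\<delta> * hmean t1 < cdef t1" by force
      have t1pi: "t1 \<le> pi" using t1 b\<tau> \<tau> by simp
      obtain w where w: "s \<le> w" "w \<le> t1" "rate w / 8 * ln (1 + \<delta> / (2 * \<epsilon>)) \<le> (LBINT t:{s..t1}. rinv t)"
        using cos_defect_crossing[OF s(1) t1(1) t1pi \<epsilon> \<delta>(2) low t1(3)] smean t1(2) by force
      have "rate b \<le> rate w" using w t1 s by (intro rate_antimono) auto
      then have gw: "rate s / 8 < rate w" using g8 by (simp add: b_def)
      have "C0 * rate s = rate s / 8 / 8 * (64 * C0)" by simp
      also have "\<dots> < rate w / 8 * ln (1 + \<delta> / (2 * \<epsilon>))"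
        using gw ln gs C0 by (intro mult_strict_mono) auto
      also have "\<dots> \<le> (LBINT t:{s..t1}. rinv t)" by (rule w(3))
      also have "\<dots> \<le> (LBINT t:{s..pi}. rinv t)"
        by (rule set_integral_mono_set_nonneg[OF integrable_rinv]) (use s t1pi rinv_nonneg in auto)
      finally show False using Is by simp
    qed
  qed
  then show ?thesis using \<epsilon> \<sigma> \<tau> by (intro exI[of _ \<epsilon>] conjI exI[of _ "min \<sigma> \<tau>"]) auto
qed

end

section \<open>Balanced tails make the sine mean negligible\<close>

lemma huber_eq_sq_diff: "0 \<le> L \<Longrightarrow> 0 \<le> x \<Longrightarrow> huber L x = x\<^sup>2 / 2 - (max 0 (x - L))\<^sup>2 / 2"
  by (auto simp: huber_def max_def power2_eq_square algebra_simps)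

lemma huber_mono: assumes "0 \<le> K" "K \<le> L" shows "huber K x \<le> huber L x"
proof -
  have "(max 0 (\<bar>x\<bar> - L))\<^sup>2 \<le> (max 0 (\<bar>x\<bar> - K))\<^sup>2"
    using assms by (intro power_mono) auto
  then show ?thesis
    using huber_eq_sq_diff[of K "\<bar>x\<bar>"] huber_eq_sq_diff[of L "\<bar>x\<bar>"] assms by simp
qed

text \<open>Superposing Huber functions with weight \<open>cos (t L)\<close> reproduces the sine, because the second derivative of
  \<open>huber L\<close> is the indicator of \<open>[-L, L]\<close>.\<close>

lemma LBINT_cos_huber:
  assumes t: "0 < t" and B: "0 < B" "cos (t * B) = 0" "sin (t * B) = 1" and x: "0 \<le> x"
  shows "t ^ 3 * (LBINT L:{0..B}. cos (t * L) * huber L x) =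
    (if x \<le> B then t\<^sup>2 * (x\<^sup>2 / 2) + sin (t * x) - t * x else t\<^sup>2 * (B * x - B\<^sup>2 / 2) + 1 - t * x)"
proof -
  define F where "F L = (L * x - L\<^sup>2 / 2) * sin (t * L) / t + (x - L) * cos (t * L) / t\<^sup>2 + sin (t * L) / t ^ 3" for L
  have F: "(F has_real_derivative cos (t * L) * (L * x - L\<^sup>2 / 2)) (at L)" for L
    unfolding F_def using t
    by (auto intro!: derivative_eq_intros simp: field_simps power2_eq_square power3_eq_cube)
  have lower: "(LBINT L:{0..c}. cos (t * L) * huber L x) = F c - F 0" if "0 \<le> c" "c \<le> x" for c
  proof -
    have "(LBINT L:{0..c}. cos (t * L) * huber L x) = (LBINT L:{0..c}. cos (t * L) * (L * x - L\<^sup>2 / 2))"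
    proof (intro set_lebesgue_integral_cong allI impI)
      fix L assume "L \<in> {0..c}"
      then have "L = x \<or> (L < x \<and> 0 \<le> L)" using that by auto
      with x show "cos (t * L) * huber L x = cos (t * L) * (L * x - L\<^sup>2 / 2)"
        by (auto simp: huber_def power2_eq_square)
    qed simp
    also have "\<dots> = F c - F 0"
      by (rule LBINT_FTC_Icc[OF F]) (use that in \<open>auto intro!: continuous_intros\<close>)
    finally show ?thesis .
  qed
  show ?thesis
  proof (cases "x \<le> B")
    case False
    then have I: "(LBINT L:{0..B}. cos (t * L) * huber L x) = (B * x - B\<^sup>2 / 2) / t + 1 / t ^ 3 - x / t\<^sup>2"
      using lower[of B] B by (simp add: F_def)
    show ?thesis unfolding I using False t
      by (simp add: field_simps power2_eq_square power3_eq_cube)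
  next
    case True
    have upper: "(LBINT L:{x..B}. cos (t * L) * huber L x) = x\<^sup>2 / 2 * (sin (t * B) / t) - x\<^sup>2 / 2 * (sin (t * x) / t)"
    proof -
      have "(LBINT L:{x..B}. cos (t * L) * huber L x) = (LBINT L:{x..B}. x\<^sup>2 / 2 * cos (t * L))"
        using x by (intro set_lebesgue_integral_cong) (auto simp: huber_def)
      also have "\<dots> = x\<^sup>2 / 2 * (sin (t * B) / t) - x\<^sup>2 / 2 * (sin (t * x) / t)"
        by (rule LBINT_FTC_Icc[where F = "\<lambda>L. x\<^sup>2 / 2 * (sin (t * L) / t)"])
           (use t True in \<open>auto intro!: derivative_eq_intros continuous_intros\<close>)
      finally show ?thesis .
    qed
    have "set_integrable lborel {0..B} (\<lambda>L. cos (t * L) * (x\<^sup>2 / 2 - (max 0 (x - L))\<^sup>2 / 2))"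
      by (intro set_integrable_Icc_continuous continuous_intros) auto
    then have "set_integrable lborel {0..B} (\<lambda>L. cos (t * L) * huber L x)"
      by (subst set_integrable_cong[OF refl refl, of _ _ "\<lambda>L. cos (t * L) * (x\<^sup>2 / 2 - (max 0 (x - L))\<^sup>2 / 2)"])
         (use x in \<open>auto simp: huber_eq_sq_diff\<close>)
    from LBINT_Icc_split[OF this x True]
    have "(LBINT L:{0..B}. cos (t * L) * huber L x) = (F x - F 0) + (x\<^sup>2 / 2 * (sin (t * B) / t) - x\<^sup>2 / 2 * (sin (t * x) / t))"
      using lower[OF x] upper by simp
    also have "\<dots> = x\<^sup>2 / 2 / t + sin (t * x) / t ^ 3 - x / t\<^sup>2"
      using B by (simp add: F_def power2_eq_square)
    finally have I: "(LBINT L:{0..B}. cos (t * L) * huber L x) = \<dots>" .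
    show ?thesis unfolding I using True t
      by (simp add: field_simps power2_eq_square power3_eq_cube)
  qed
qed

text \<open>\<open>t x - sin (t x)\<close> equals the superposition exactly on \<open>[0, B]\<close>. The choice \<open>cos (t B) = 0\<close> makes the slopes agree
  at \<open>B\<close>, so beyond \<open>B\<close> the error is only \<open>1 - sin (t x)\<close>, which is bounded. Without that choice the error would grow
  linearly.\<close>

lemma sin_excess_huber_approx:
  assumes t: "0 < t" and B: "0 < B" "cos (t * B) = 0" "sin (t * B) = 1" and x: "0 \<le> x"
  shows "\<bar>(t * x - sin (t * x)) - (t\<^sup>2 * huber B x - t ^ 3 * (LBINT L:{0..B}. cos (t * L) * huber L x))\<bar>
    \<le> 4 / B\<^sup>2 * huber B x"
proof (cases "x \<le> B")
  case True
  then show ?thesis using x B huber_nonneg[of B x] unfolding LBINT_cos_huber[OF assms] by (simp add: huber_def)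
next
  case False
  have "B * B \<le> B * x" using False B by (intro mult_left_mono) auto
  then have "B\<^sup>2 / 2 \<le> huber B x" using False x by (simp add: huber_def power2_eq_square)
  then have "4 / B\<^sup>2 * (B\<^sup>2 / 2) \<le> 4 / B\<^sup>2 * huber B x" by (intro mult_left_mono) auto
  then have "2 \<le> 4 / B\<^sup>2 * huber B x" using B by simp
  moreover have "(t * x - sin (t * x)) - (t\<^sup>2 * huber B x - t ^ 3 * (LBINT L:{0..B}. cos (t * L) * huber L x)) = 1 - sin (t * x)"
    unfolding LBINT_cos_huber[OF assms] using False B x by (simp add: huber_def)
  moreover have "\<bar>1 - sin (t * x)\<bar> \<le> 2"
    using sin_ge_minus_one[of "t * x"] sin_le_one[of "t * x"] by linarith
  ultimately show ?thesis by linarith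
qed

lemma (in prob_space) expectation_sin_excess_approx:
  assumes Y: "integrable M Y" "\<And>\<omega>. 0 \<le> Y \<omega>"
    and t: "0 < t" and B: "0 < B" "cos (t * B) = 0" "sin (t * B) = 1"
  shows "\<bar>expectation (\<lambda>\<omega>. t * Y \<omega> - sin (t * Y \<omega>)) - (t\<^sup>2 * expectation (\<lambda>\<omega>. huber B (Y \<omega>))
      - t ^ 3 * (LBINT L:{0..B}. cos (t * L) * expectation (\<lambda>\<omega>. huber L (Y \<omega>))))\<bar>
    \<le> 4 / B\<^sup>2 * expectation (\<lambda>\<omega>. huber B (Y \<omega>))" (is "\<bar>?E - (_ - _ * ?I)\<bar> \<le> _")
    and "set_integrable lborel {0..B} (\<lambda>L. cos (t * L) * expectation (\<lambda>\<omega>. huber L (Y \<omega>)))"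
proof -
  have [measurable]: "Y \<in> borel_measurable M" using Y by auto
  have hi: "integrable M (\<lambda>\<omega>. huber L (Y \<omega>))" if "0 \<le> L" for L
  proof (rule Bochner_Integration.integrable_bound)
    show "integrable M (\<lambda>\<omega>. L * Y \<omega>)" using Y by auto
    show "AE \<omega> in M. norm (huber L (Y \<omega>)) \<le> norm (L * Y \<omega>)"
    proof (rule AE_I2)
      fix \<omega>
      show "norm (huber L (Y \<omega>)) \<le> norm (L * Y \<omega>)"
        using huber_le_linear[OF that, of "Y \<omega>"] huber_nonneg[OF that, of "Y \<omega>"] that Y(2)[of \<omega>] by (simp add: abs_mult)
    qed
  qed simp
  have bound: "norm (cos (t * L) * huber L (Y \<omega>)) \<le> B * Y \<omega>" if "L \<in> {0..B}" for \<omega> L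
  proof -
    have "norm (cos (t * L) * huber L (Y \<omega>)) \<le> 1 * huber L (Y \<omega>)"
      using that huber_nonneg[of L "Y \<omega>"] by (simp add: abs_mult mult_left_le_one_le)
    also have "\<dots> \<le> L * Y \<omega>" using huber_le_linear[of L "Y \<omega>"] that Y(2)[of \<omega>] by simp
    also have "\<dots> \<le> B * Y \<omega>" using that Y(2) by (intro mult_right_mono) auto
    finally show ?thesis .
  qed
  note sw = set_integral_expectation_swap[where f = "\<lambda>x L. cos (t * L) * huber L x" and Y = Y and g = "\<lambda>\<omega>. B * Y \<omega>"
      and a = 0 and b = B]
  have I: "?I = expectation (\<lambda>\<omega>. LBINT L:{0..B}. cos (t * L) * huber L (Y \<omega>))"
    using sw(1)[OF _ _ _ bound] Y by simp
  show "set_integrable lborel {0..B} (\<lambda>L. cos (t * L) * expectation (\<lambda>\<omega>. huber L (Y \<omega>)))"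
    using sw(2)[OF _ _ _ bound] Y by simp
  have Ii: "integrable M (\<lambda>\<omega>. LBINT L:{0..B}. cos (t * L) * huber L (Y \<omega>))"
    using sw(3)[OF _ _ _ bound] Y by simp
  have Ei: "integrable M (\<lambda>\<omega>. t * Y \<omega> - sin (t * Y \<omega>))"
    using Y by (intro Bochner_Integration.integrable_diff integrable_const_bound[where B = 1 and f = "\<lambda>\<omega>. sin (t * Y \<omega>)"]) auto
  define G where "G \<omega> = t\<^sup>2 * huber B (Y \<omega>) - t ^ 3 * (LBINT L:{0..B}. cos (t * L) * huber L (Y \<omega>))" for \<omega>
  have Gi: "integrable M G" unfolding G_def using hi[of B] Ii B by auto
  have "?E - (t\<^sup>2 * expectation (\<lambda>\<omega>. huber B (Y \<omega>)) - t ^ 3 * ?I) = ?E - expectation G"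
    unfolding I G_def using hi[of B] Ii B by simp
  also have "\<dots> = expectation (\<lambda>\<omega>. (t * Y \<omega> - sin (t * Y \<omega>)) - G \<omega>)"
    by (rule Bochner_Integration.integral_diff[symmetric, OF Ei Gi])
  also have "\<bar>\<dots>\<bar> \<le> expectation (\<lambda>\<omega>. \<bar>(t * Y \<omega> - sin (t * Y \<omega>)) - G \<omega>\<bar>)"
    by (rule integral_abs_bound)
  also have "\<dots> \<le> expectation (\<lambda>\<omega>. 4 / B\<^sup>2 * huber B (Y \<omega>))"
  proof (rule integral_mono)
    show "integrable M (\<lambda>\<omega>. \<bar>(t * Y \<omega> - sin (t * Y \<omega>)) - G \<omega>\<bar>)"
      by (intro integrable_abs Bochner_Integration.integrable_diff[OF Ei Gi])
    show "integrable M (\<lambda>\<omega>. 4 / B\<^sup>2 * huber B (Y \<omega>))" using hi[of B] B by simp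
    show "\<bar>(t * Y \<omega> - sin (t * Y \<omega>)) - G \<omega>\<bar> \<le> 4 / B\<^sup>2 * huber B (Y \<omega>)" for \<omega>
      unfolding G_def by (rule sin_excess_huber_approx[OF t B Y(2)])
  qed
  finally show "\<bar>?E - (t\<^sup>2 * expectation (\<lambda>\<omega>. huber B (Y \<omega>)) - t ^ 3 * ?I)\<bar> \<le> 4 / B\<^sup>2 * expectation (\<lambda>\<omega>. huber B (Y \<omega>))"
    by simp
qed

context heavy_step
begin

lemma m_total_mono:
  assumes "0 \<le> K" "K \<le> L" shows "m_total M X K \<le> m_total M X L"
  using assms by (simp add: m_total_eq integral_mono huber_mono integrable_huber integrable_X)

lemma m_pm_nonneg: "0 \<le> L \<Longrightarrow> 0 \<le> m_plus M X L" "0 \<le> L \<Longrightarrow> 0 \<le> m_minus M X L"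
  by (simp_all add: m_plus_eq m_minus_eq integral_nonneg_AE huber_nonneg)

lemma m_total_unbounded: "\<exists>B0>0. \<forall>B\<ge>B0. K \<le> m_total M X B"
proof -
  obtain \<tau> where \<tau>: "\<tau> > 0" "\<And>t. 0 < t \<Longrightarrow> t \<le> \<tau> \<Longrightarrow> (4 * K) * t\<^sup>2 \<le> cdef t"
    using cdef_superquadratic[of "4 * K"] by blast
  have "K \<le> m_total M X B" if B: "1 / \<tau> \<le> B" for B
  proof -
    have B0: "0 < B" using \<tau> B by (intro order.strict_trans2[OF _ B]) simp
    have "1 / B \<le> \<tau>" using B B0 \<tau> by (simp add: field_simps)
    then have "(4 * K) * (1 / B)\<^sup>2 \<le> cdef (1 / B)" using B0 by (intro \<tau>) auto
    also have "\<dots> \<le> 4 * hmean (1 / B)" by (rule cdef_le_hmean)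
    finally have "K * (1 / B)\<^sup>2 \<le> hmean (1 / B)" by simp
    then have "B\<^sup>2 * (K * (1 / B)\<^sup>2) \<le> B\<^sup>2 * hmean (1 / B)" by (intro mult_left_mono) auto
    then show ?thesis using B0 by (simp add: m_total_eq_hmean power_divide)
  qed
  then show ?thesis using \<tau> by (intro exI[of _ "1 / \<tau>"]) auto
qed

text \<open>The zero mean turns \<open>- smean t\<close> into \<open>E (t X - sin (t X))\<close>. Superposition expresses the contributions of the positive and the
  negative part through \<open>m_+\<close> and \<open>m_-\<close>, so only their difference survives, besides the error from \<open>|X| > B\<close>.\<close>

lemma smean_le_balance:
  assumes t: "0 < t" and B: "0 < B" "cos (t * B) = 0" "sin (t * B) = 1"
    and D: "\<And>L. 0 \<le> L \<Longrightarrow> L \<le> B \<Longrightarrow> \<bar>m_plus M X L - m_minus M X L\<bar> \<le> d"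
  shows "\<bar>smean t\<bar> \<le> (t\<^sup>2 + t ^ 3 * B) * d + 4 / B\<^sup>2 * m_total M X B"
proof -
  define P where "P = (\<lambda>\<omega>. max 0 (real_of_int (X \<omega>)))"
  define N where "N = (\<lambda>\<omega>. max 0 (- real_of_int (X \<omega>)))"
  have PN: "integrable M P" "integrable M N" "\<And>\<omega>. 0 \<le> P \<omega>" "\<And>\<omega>. 0 \<le> N \<omega>"
    using integrable_X by (auto simp: P_def N_def)
  have si: "integrable M (\<lambda>\<omega>. t * Y \<omega> - sin (t * Y \<omega>))" if "integrable M Y" for Y
    using that by (intro Bochner_Integration.integrable_diff integrable_const_bound[where B = 1 and f = "\<lambda>\<omega>. sin (t * Y \<omega>)"]) auto
  have "- smean t = expectation (\<lambda>\<omega>. t * real_of_int (X \<omega>) - sin (t * real_of_int (X \<omega>)))"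
    using integrable_X mean_zero by (subst Bochner_Integration.integral_diff) (auto simp: smean_def)
  also have "\<dots> = expectation (\<lambda>\<omega>. (t * P \<omega> - sin (t * P \<omega>)) - (t * N \<omega> - sin (t * N \<omega>)))"
    by (intro Bochner_Integration.integral_cong) (auto simp: P_def N_def max_def)
  also have "\<dots> = expectation (\<lambda>\<omega>. t * P \<omega> - sin (t * P \<omega>)) - expectation (\<lambda>\<omega>. t * N \<omega> - sin (t * N \<omega>))"
    by (intro Bochner_Integration.integral_diff si PN)
  finally have smean: "- smean t = \<dots>" .
  define IP where "IP = (LBINT L:{0..B}. cos (t * L) * m_plus M X L)"
  define IN where "IN = (LBINT L:{0..B}. cos (t * L) * m_minus M X L)"
  have mP: "m_plus M X L = expectation (\<lambda>\<omega>. huber L (P \<omega>))" and mN: "m_minus M X L = expectation (\<lambda>\<omega>. huber L (N \<omega>))"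
    if "0 \<le> L" for L using that by (simp_all add: m_plus_eq m_minus_eq P_def N_def)
  have IP: "IP = (LBINT L:{0..B}. cos (t * L) * expectation (\<lambda>\<omega>. huber L (P \<omega>)))"
    and IN: "IN = (LBINT L:{0..B}. cos (t * L) * expectation (\<lambda>\<omega>. huber L (N \<omega>)))"
    unfolding IP_def IN_def by (intro set_lebesgue_integral_cong; simp add: mP mN)+
  have iP: "set_integrable lborel {0..B} (\<lambda>L. cos (t * L) * m_plus M X L)"
    using expectation_sin_excess_approx(2)[OF PN(1,3) t B]
    by (subst set_integrable_cong[OF refl refl, of _ _ "\<lambda>L. cos (t * L) * expectation (\<lambda>\<omega>. huber L (P \<omega>))"]) (auto simp: mP)
  have iN: "set_integrable lborel {0..B} (\<lambda>L. cos (t * L) * m_minus M X L)"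
    using expectation_sin_excess_approx(2)[OF PN(2,4) t B]
    by (subst set_integrable_cong[OF refl refl, of _ _ "\<lambda>L. cos (t * L) * expectation (\<lambda>\<omega>. huber L (N \<omega>))"]) (auto simp: mN)
  have aP: "\<bar>expectation (\<lambda>\<omega>. t * P \<omega> - sin (t * P \<omega>)) - (t\<^sup>2 * m_plus M X B - t ^ 3 * IP)\<bar> \<le> 4 / B\<^sup>2 * m_plus M X B"
    using expectation_sin_excess_approx(1)[OF PN(1,3) t B] B(1) by (simp only: IP mP less_imp_le)
  have aN: "\<bar>expectation (\<lambda>\<omega>. t * N \<omega> - sin (t * N \<omega>)) - (t\<^sup>2 * m_minus M X B - t ^ 3 * IN)\<bar> \<le> 4 / B\<^sup>2 * m_minus M X B"
    using expectation_sin_excess_approx(1)[OF PN(2,4) t B] B(1) by (simp only: IN mN less_imp_le)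
  have "\<bar>IP - IN\<bar> = \<bar>LBINT L:{0..B}. cos (t * L) * (m_plus M X L - m_minus M X L)\<bar>"
    unfolding IP_def IN_def by (subst set_integral_diff(2)[symmetric, OF iP iN]) (simp add: right_diff_distrib)
  also have "\<dots> \<le> (LBINT L:{0..B}. \<bar>cos (t * L) * (m_plus M X L - m_minus M X L)\<bar>)"
    using set_integral_norm_bound[OF set_integral_diff(1)[OF iP iN]] by (simp add: right_diff_distrib)
  also have "\<dots> \<le> (LBINT L:{0..B}. d)"
  proof (rule set_integral_mono)
    show "set_integrable lborel {0..B} (\<lambda>L. \<bar>cos (t * L) * (m_plus M X L - m_minus M X L)\<bar>)"
      using set_integrable_abs[OF set_integral_diff(1)[OF iP iN]] by (simp add: right_diff_distrib)
    show "set_integrable lborel {0..B} (\<lambda>L. d)"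
      by (intro set_integrable_Icc_continuous continuous_intros)
    fix L assume L: "L \<in> {0..B}"
    have "\<bar>cos (t * L)\<bar> * \<bar>m_plus M X L - m_minus M X L\<bar> \<le> 1 * d"
      using D[of L] L by (intro mult_mono) auto
    then show "\<bar>cos (t * L) * (m_plus M X L - m_minus M X L)\<bar> \<le> d" by (simp add: abs_mult)
  qed
  also have "\<dots> = B * d" using B by (simp add: set_integral_const)
  finally have I: "t ^ 3 * \<bar>IP - IN\<bar> \<le> t ^ 3 * (B * d)" using t by (intro mult_left_mono) auto
  have "t\<^sup>2 * \<bar>m_plus M X B - m_minus M X B\<bar> \<le> t\<^sup>2 * d" using D[of B] B by (intro mult_left_mono) auto
  moreover have "\<bar>smean t\<bar> \<le> t\<^sup>2 * \<bar>m_plus M X B - m_minus M X B\<bar> + t ^ 3 * \<bar>IP - IN\<bar>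
      + (4 / B\<^sup>2 * m_plus M X B + 4 / B\<^sup>2 * m_minus M X B)"
  proof -
    have "\<bar>(t\<^sup>2 * m_plus M X B - t ^ 3 * IP) - (t\<^sup>2 * m_minus M X B - t ^ 3 * IN)\<bar>
        = \<bar>t\<^sup>2 * (m_plus M X B - m_minus M X B) - t ^ 3 * (IP - IN)\<bar>" by (simp add: algebra_simps)
    also have "\<dots> \<le> \<bar>t\<^sup>2 * (m_plus M X B - m_minus M X B)\<bar> + \<bar>t ^ 3 * (IP - IN)\<bar>" by (rule abs_triangle_ineq4)
    also have "\<dots> = t\<^sup>2 * \<bar>m_plus M X B - m_minus M X B\<bar> + t ^ 3 * \<bar>IP - IN\<bar>" using t by (simp add: abs_mult)
    finally show ?thesis using aP aN smean by linarith
  qed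
  ultimately have "\<bar>smean t\<bar> \<le> t\<^sup>2 * d + t ^ 3 * (B * d) + (4 / B\<^sup>2 * m_plus M X B + 4 / B\<^sup>2 * m_minus M X B)"
    using I by linarith
  also have "\<dots> = (t\<^sup>2 + t ^ 3 * B) * d + 4 / B\<^sup>2 * m_total M X B"
    by (simp add: m_total_def algebra_simps add_divide_distrib)
  finally show ?thesis .
qed

text \<open>With \<open>B = b / t\<close> the two error terms are at most \<open>\<eta> b (1 + b) * hmean t\<close> and \<open>(4 / b) * hmean t\<close>. So
  \<open>b\<close> is fixed first, large, and the relative imbalance \<open>\<eta>\<close> of \<open>m_+\<close> and \<open>m_-\<close> then chosen small. Unboundedness
  of \<open>m\<close> takes care of the initial range, where the balance may fail.\<close>

lemma smean_small_of_balance: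
  assumes lim: "((\<lambda>x. m_minus M X x / m_plus M X x) \<longlongrightarrow> 1) at_top" and \<epsilon>: "0 < \<epsilon>"
  shows "\<exists>\<tau>>0. \<forall>t. 0 < t \<and> t \<le> \<tau> \<longrightarrow> \<bar>smean t\<bar> \<le> \<epsilon> * hmean t"
proof -
  obtain N :: nat where N: "8 / \<epsilon> \<le> real N" using real_arch_simple by blast
  \<comment> \<open>This form of \<open>b\<close> gives \<open>cos b = 0\<close> and \<open>sin b = 1\<close>.\<close>
  define b where "b = pi / 2 + 2 * pi * real N"
  have b1: "1 \<le> b" "8 / \<epsilon> \<le> b"
  proof -
    have "3 * real N \<le> pi * real N" using pi_gt3 by (intro mult_right_mono) auto
    then have "real N \<le> 2 * pi * real N" by simp
    moreover have "1 \<le> pi / 2" using pi_gt3 by simp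
    ultimately show "1 \<le> b" "8 / \<epsilon> \<le> b" using N unfolding b_def by linarith+
  qed
  have trig: "cos b = 0" "sin b = 1"
    using sin_cos_eq_iff[of b "pi / 2"] by (auto simp: b_def intro!: exI[of _ "int N"])
  define \<eta> where "\<eta> = min (1/2) (\<epsilon> / (2 * (1 + b) * b))"
  have \<eta>: "0 < \<eta>" "\<eta> \<le> 1 / 2" "\<eta> * (2 * (1 + b) * b) \<le> \<epsilon>"
  proof -
    show "0 < \<eta>" using \<epsilon> b1 by (auto simp: \<eta>_def)
    show "\<eta> \<le> 1/2" unfolding \<eta>_def by (rule min.cobounded1)
    have "\<eta> \<le> \<epsilon> / (2 * (1 + b) * b)" by (simp add: \<eta>_def)
    then show "\<eta> * (2 * (1 + b) * b) \<le> \<epsilon>" using b1 by (simp add: pos_le_divide_eq)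
  qed
  have "\<forall>\<^sub>F x in at_top. dist (m_minus M X x / m_plus M X x) 1 < \<eta>"
    using lim \<eta>(1) by (rule tendstoD)
  then obtain L1 where L1: "\<And>x. L1 \<le> x \<Longrightarrow> \<bar>m_minus M X x / m_plus M X x - 1\<bar> < \<eta>"
    by (auto simp: eventually_at_top_linorder dist_real_def)
  define L0 where "L0 = max 0 L1"
  have D1: "\<bar>m_plus M X L - m_minus M X L\<bar> \<le> \<eta> * m_total M X L" if L: "L0 \<le> L" for L
  proof -
    have L': "0 \<le> L" "L1 \<le> L" using L by (auto simp: L0_def)
    have r: "\<bar>m_minus M X L / m_plus M X L - 1\<bar> < \<eta>" using L1 L' by simp
    then have p: "m_plus M X L \<noteq> 0" using \<eta> by auto
    then have p: "0 < m_plus M X L" using m_pm_nonneg(1)[OF L'(1)] by simp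
    have "m_minus M X L - m_plus M X L = (m_minus M X L / m_plus M X L - 1) * m_plus M X L"
      using p by (simp add: left_diff_distrib)
    then have "\<bar>m_minus M X L - m_plus M X L\<bar> = \<bar>m_minus M X L / m_plus M X L - 1\<bar> * m_plus M X L"
      using p by (simp only: abs_mult abs_of_pos)
    then have "\<bar>m_plus M X L - m_minus M X L\<bar> = \<bar>m_minus M X L / m_plus M X L - 1\<bar> * m_plus M X L"
      by (simp only: abs_minus_commute)
    also have "\<dots> \<le> \<eta> * m_plus M X L" using r p by (intro mult_right_mono) auto
    also have "\<dots> \<le> \<eta> * m_total M X L"
      using \<eta> m_pm_nonneg(2)[OF L'(1)] by (intro mult_left_mono) (auto simp: m_total_def)
    finally show ?thesis .
  qed
  obtain B0 where B0: "B0 > 0" "\<And>B. B0 \<le> B \<Longrightarrow> m_total M X L0 / \<eta> \<le> m_total M X B"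
    using m_total_unbounded by blast
  have "\<bar>smean t\<bar> \<le> \<epsilon> * hmean t" if t: "0 < t" "t \<le> b / (B0 + L0)" for t
  proof -
    define B where "B = b / t"
    have L00: "0 \<le> L0" by (simp add: L0_def)
    have Bb: "t * B = b" "0 < B" using t b1 by (auto simp: B_def)
    have "B0 + L0 \<le> B" using t B0 L00 by (simp add: B_def field_simps)
    then have BB: "B0 \<le> B" "L0 \<le> B" using B0 L00 by auto
    have d: "\<bar>m_plus M X L - m_minus M X L\<bar> \<le> \<eta> * m_total M X B" if L: "0 \<le> L" "L \<le> B" for L
    proof (cases "L0 \<le> L")
      case True
      have "\<eta> * m_total M X L \<le> \<eta> * m_total M X B" using \<eta> L by (intro mult_left_mono m_total_mono) auto
      with D1[OF True] show ?thesis by linarith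
    next
      case False
      have "\<bar>m_plus M X L - m_minus M X L\<bar> \<le> m_total M X L"
        using m_pm_nonneg[OF L(1)] by (auto simp: m_total_def)
      also have "\<dots> \<le> m_total M X L0" using False L by (intro m_total_mono) auto
      also have "\<dots> = \<eta> * (m_total M X L0 / \<eta>)" using \<eta> by simp
      also have "\<dots> \<le> \<eta> * m_total M X B" using \<eta> B0(2)[OF BB(1)] by (intro mult_left_mono) auto
      finally show ?thesis .
    qed
    have mB: "t\<^sup>2 * m_total M X B \<le> b * hmean t"
    proof -
      have "t\<^sup>2 * m_total M X B = b * (b * hmean (1 / B))"
        using Bb t by (simp add: m_total_eq_hmean B_def power2_eq_square)
      also have "\<dots> \<le> b * hmean (b * (1 / B))" using b1 hmean_scale(1)[OF b1(1), of "1 / B"] by (intro mult_left_mono) auto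
      also have "b * (1 / B) = t" using t b1 by (simp add: B_def)
      finally show ?thesis .
    qed
    have "\<bar>smean t\<bar> \<le> (t\<^sup>2 + t ^ 3 * B) * (\<eta> * m_total M X B) + 4 / B\<^sup>2 * m_total M X B"
      by (rule smean_le_balance[OF t(1) Bb(2)]) (use Bb trig d in auto)
    also have "t\<^sup>2 + t ^ 3 * B = t\<^sup>2 * (1 + b)" using Bb(1) by (simp add: power3_eq_cube power2_eq_square distrib_left mult.assoc)
    also have "4 / B\<^sup>2 = t\<^sup>2 * (4 / b\<^sup>2)" using t b1 by (simp add: B_def power_divide)
    also have "t\<^sup>2 * (1 + b) * (\<eta> * m_total M X B) + t\<^sup>2 * (4 / b\<^sup>2) * m_total M X B
        = (\<eta> * (1 + b) + 4 / b\<^sup>2) * (t\<^sup>2 * m_total M X B)" by (simp add: algebra_simps)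
    also have "\<dots> \<le> (\<eta> * (1 + b) + 4 / b\<^sup>2) * (b * hmean t)"
      using \<eta> b1 by (intro mult_left_mono mB) auto
    also have "\<dots> = (\<eta> * (2 * (1 + b) * b) / 2 + 4 / b) * hmean t"
      using b1 by (simp add: field_simps power2_eq_square)
    also have "\<dots> \<le> (\<epsilon> / 2 + \<epsilon> / 2) * hmean t"
    proof (intro mult_right_mono add_mono)
      show "\<eta> * (2 * (1 + b) * b) / 2 \<le> \<epsilon> / 2" using \<eta>(3) by simp
      show "4 / b \<le> \<epsilon> / 2" using b1 \<epsilon> by (simp add: field_simps)
    qed (rule hmean_nonneg)
    finally show ?thesis by simp
  qed
  then show ?thesis using b1 B0 L0_def by (intro exI[of _ "b / (B0 + L0)"]) (auto intro!: divide_pos_pos add_pos_nonneg)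
qed

end

section \<open>Fourier inversion for the walk\<close>

lemma LBINT_cis:
  fixes k :: int
  shows "(LBINT t:{-pi..pi}. cis (t * real_of_int k)) = (if k = 0 then of_real (2 * pi) else 0)"
proof (cases "k = 0")
  case True
  have "(LBINT t:{-pi..pi}. (1::complex)) = of_real (2 * pi)"
    by (simp add: set_integral_const scaleR_conv_of_real)
  then show ?thesis using True by simp
next
  case False
  define F where "F z = exp (\<i> * of_int k * z) / (\<i> * of_int k)" for z :: complex
  have "(LBINT t:{-pi..pi}. cis (t * real_of_int k)) = F (of_real pi) - F (of_real (- pi))"
    unfolding set_lebesgue_integral_def
  proof (rule integral_FTC_atLeastAtMost[where F = "\<lambda>t. F (of_real t)"])
    fix t :: real
    have "(F has_field_derivative cis (t * real_of_int k)) (at (of_real t))"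
      unfolding F_def using False by (auto intro!: derivative_eq_intros simp: cis_conv_exp mult_ac)
    then show "((\<lambda>t. F (of_real t)) has_vector_derivative cis (t * real_of_int k)) (at t within {-pi..pi})"
      by (rule has_vector_derivative_real_field)
  qed (auto intro!: continuous_intros)
  also have "F (of_real pi) = cis (pi * real_of_int k) / (\<i> * of_int k)"
    by (simp add: F_def cis_conv_exp mult_ac)
  also have "F (of_real (- pi)) = cis (- (pi * real_of_int k)) / (\<i> * of_int k)"
    by (simp add: F_def cis_conv_exp mult_ac)
  also have "cis (- (pi * real_of_int k)) = cis (pi * real_of_int k)"
    by (simp add: complex_eq_iff sin_int_times_real sin_times_pi_eq_0 mult.commute)
  finally show ?thesis using False by simp
qed

lemma LBINT_even:
  fixes f :: "real \<Rightarrow> real"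
  assumes "set_integrable lborel {0..a} f" "\<And>t. f (- t) = f t" "0 \<le> a"
  shows "(LBINT t:{-a..a}. f t) = 2 * (LBINT t:{0..a}. f t)"
proof -
  have m: "integrable lborel (\<lambda>t. indicator {0..a} (- t) *\<^sub>R f (- t))"
    using assms(1) lborel_integrable_real_affine[of "\<lambda>t. indicator {0..a} t *\<^sub>R f t" "-1" 0] unfolding set_integrable_def by simp
  have "(\<lambda>t. indicator {0..a} (- t) *\<^sub>R f (- t)) = (\<lambda>t. indicator {-a..0} t *\<^sub>R f t)"
    using assms(2) by (auto simp: fun_eq_iff indicator_def)
  with m have left: "set_integrable lborel {-a..0} f" "(LBINT t:{-a..0}. f t) = (\<integral>t. indicator {0..a} (- t) *\<^sub>R f (- t) \<partial>lborel)"
    by (simp_all add: set_integrable_def set_lebesgue_integral_def)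
  have "(\<integral>t. indicator {0..a} (- t) *\<^sub>R f (- t) \<partial>lborel) = (LBINT t:{0..a}. f t)"
    using lborel_integral_real_affine[of "-1" "\<lambda>t. indicator {0..a} t *\<^sub>R f t" 0] by (simp add: set_lebesgue_integral_def)
  with left have l: "(LBINT t:{-a..0}. f t) = (LBINT t:{0..a}. f t)" by simp
  have "set_integrable lborel ({-a..0} \<union> {0..a}) f" by (rule set_integrable_Un[OF left(1) assms(1)]) auto
  then have "set_integrable lborel {-a..a} f" using assms(3) by (simp add: ivl_disj_un_two_touch)
  from LBINT_Icc_split[OF this, of 0] l assms(3) show ?thesis by simp
qed

lemma cis_measurable [measurable]: "cis \<in> borel_measurable borel"
  by (intro borel_measurable_continuous_onI continuous_intros)

lemma Re_of_real_times: "Re (of_real a * z) = a * Re z"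
  by simp

lemma (in prob_space) expectation_indicator_eq:
  assumes [measurable]: "Measurable.pred M P"
  shows "(\<integral>\<omega>. (if P \<omega> then c else 0) \<partial>M) = (c :: 'b::{banach, second_countable_topology, real_normed_field}) * of_real (prob {\<omega> \<in> space M. P \<omega>})"
proof -
  have "(\<integral>\<omega>. (if P \<omega> then c else 0) \<partial>M) = (\<integral>\<omega>. indicator {\<omega> \<in> space M. P \<omega>} \<omega> *\<^sub>R c \<partial>M)"
    by (rule Bochner_Integration.integral_cong) auto
  also have "\<dots> = prob {\<omega> \<in> space M. P \<omega>} *\<^sub>R c"
    by (subst Bochner_Integration.integral_scaleR_left)
       (auto simp: Int_absorb2 less_top[symmetric])
  finally show ?thesis by (simp add: scaleR_conv_of_real mult.commute)
qed

lemma (in prob_space) fourier_inversion_int: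
  fixes Z :: "'a \<Rightarrow> int" and x :: int
  assumes [measurable]: "(\<lambda>\<omega>. real_of_int (Z \<omega>)) \<in> borel_measurable M"
  shows "(LBINT t:{-pi..pi}. cis (- (t * real_of_int x)) * (\<integral>\<omega>. cis (t * real_of_int (Z \<omega>)) \<partial>M))
    = of_real (2 * pi * prob {\<omega> \<in> space M. Z \<omega> = x})"
proof -
  have "Measurable.pred M (\<lambda>\<omega>. real_of_int (Z \<omega>) = real_of_int x)" by measurable
  then have [measurable]: "Measurable.pred M (\<lambda>\<omega>. Z \<omega> = x)" by simp
  have cm: "cis \<in> borel_measurable borel"
    by (intro borel_measurable_continuous_onI continuous_intros)
  have "(LBINT t:{-pi..pi}. cis (- (t * real_of_int x)) * (\<integral>\<omega>. cis (t * real_of_int (Z \<omega>)) \<partial>M))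
      = (LBINT t:{-pi..pi}. (\<integral>\<omega>. cis (- (t * real_of_int x)) * cis (t * real_of_int (Z \<omega>)) \<partial>M))"
    by simp
  also have "\<dots> = (\<integral>\<omega>. (LBINT t:{-pi..pi}. cis (- (t * real_of_int x)) * cis (t * real_of_int (Z \<omega>))) \<partial>M)"
    by (rule set_integral_expectation_swap(1)[where f = "\<lambda>z t. cis (- (t * real_of_int x)) * cis (t * z)" and g = "\<lambda>_. 1"])
       (auto intro!: measurable_compose[OF _ cm] borel_measurable_times simp: norm_mult)
  also have "\<dots> = (\<integral>\<omega>. (if Z \<omega> = x then of_real (2 * pi) else 0) \<partial>M)"
  proof (rule Bochner_Integration.integral_cong[OF refl])
    fix \<omega>
    have "(LBINT t:{-pi..pi}. cis (- (t * real_of_int x)) * cis (t * real_of_int (Z \<omega>))) = (LBINT t:{-pi..pi}. cis (t * real_of_int (Z \<omega> - x)))"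
      by (simp add: cis_mult algebra_simps)
    also have "\<dots> = (if Z \<omega> = x then of_real (2 * pi) else 0)" by (simp only: LBINT_cis right_minus_eq)
    finally show "(LBINT t:{-pi..pi}. cis (- (t * real_of_int x)) * cis (t * real_of_int (Z \<omega>))) = (if Z \<omega> = x then of_real (2 * pi) else 0)" .
  qed
  also have "\<dots> = of_real (2 * pi) * of_real (prob {\<omega> \<in> space M. Z \<omega> = x})"
    by (rule expectation_indicator_eq) measurable
  finally show ?thesis by (simp only: of_real_mult)
qed

locale iid_walk = prob_space M for M :: "'w measure" +
  fixes X :: "nat \<Rightarrow> 'w \<Rightarrow> int"
  assumes iid: "iid_int M X"
begin

definition phi :: "real \<Rightarrow> complex" where
  "phi t = (\<integral>\<omega>. cis (t * real_of_int (X 0 \<omega>)) \<partial>M)"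

definition pwalk :: "nat \<Rightarrow> int \<Rightarrow> real" where
  "pwalk n x = prob {\<omega> \<in> space M. walk X n \<omega> = x}"

lemma measurable_step: "X k \<in> measurable M (count_space UNIV)"
  using iid unfolding iid_int_def indep_vars_def2 by auto

lemma measurable_real_step [measurable]: "(\<lambda>\<omega>. real_of_int (X k \<omega>)) \<in> borel_measurable M"
  by (rule measurable_compose[OF measurable_step]) simp

lemma real_walk: "real_of_int (walk X n \<omega>) = (\<Sum>k\<in>{1..n}. real_of_int (X k \<omega>))"
  by (simp add: walk_def)

lemma measurable_real_walk [measurable]: "(\<lambda>\<omega>. real_of_int (walk X n \<omega>)) \<in> borel_measurable M"
  unfolding real_walk by measurable

lemma char_distr_eq:
  assumes [measurable]: "f \<in> borel_measurable M"
  shows "char (distr M borel f) t = (\<integral>\<omega>. cis (t * f \<omega>) \<partial>M)"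
  unfolding char_def by (subst integral_distr) (auto simp: cis_conv_exp)

lemma distr_real_step: "distr M borel (\<lambda>\<omega>. real_of_int (X k \<omega>)) = distr M borel (\<lambda>\<omega>. real_of_int (X 0 \<omega>))"
proof -
  have "distr M borel (\<lambda>\<omega>. real_of_int (X k \<omega>)) = distr (distr M (count_space UNIV) (X k)) borel real_of_int" for k
    by (subst distr_distr) (auto simp: measurable_step comp_def)
  then show ?thesis using iid unfolding iid_int_def by metis
qed

lemma char_walk: "(\<integral>\<omega>. cis (t * real_of_int (walk X n \<omega>)) \<partial>M) = phi t ^ n"
proof -
  have "indep_vars (\<lambda>_. count_space UNIV) X UNIV" using iid by (simp add: iid_int_def)
  then have "indep_vars (\<lambda>_. borel) (\<lambda>k \<omega>. real_of_int (X k \<omega>)) UNIV"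
    by (rule indep_vars_compose2[where Y = "\<lambda>_. real_of_int"]) simp
  then have iv: "indep_vars (\<lambda>_. borel) (\<lambda>k \<omega>. real_of_int (X k \<omega>)) {1..n}"
    by (rule indep_vars_subset) simp
  have "(\<integral>\<omega>. cis (t * real_of_int (walk X n \<omega>)) \<partial>M) = char (distr M borel (\<lambda>\<omega>. \<Sum>k\<in>{1..n}. real_of_int (X k \<omega>))) t"
    by (simp add: char_distr_eq real_walk)
  also have "\<dots> = (\<Prod>k\<in>{1..n}. char (distr M borel (\<lambda>\<omega>. real_of_int (X k \<omega>))) t)"
    by (rule char_distr_sum[OF iv])
  also have "char (distr M borel (\<lambda>\<omega>. real_of_int (X k \<omega>))) t = phi t" for k
    by (subst distr_real_step) (simp add: char_distr_eq phi_def)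
  then have "(\<Prod>k\<in>{1..n}. char (distr M borel (\<lambda>\<omega>. real_of_int (X k \<omega>))) t) = phi t ^ n" by simp
  finally show ?thesis .
qed

lemma measurable_phi [measurable]: "phi \<in> borel_measurable borel"
proof -
  interpret D: real_distribution "distr M borel (\<lambda>\<omega>. real_of_int (X 0 \<omega>))"
    by (rule real_distribution_distr) simp
  have "phi = char (distr M borel (\<lambda>\<omega>. real_of_int (X 0 \<omega>)))"
    by (rule ext) (simp add: phi_def char_distr_eq)
  then show ?thesis using D.char_measurable by simp
qed

lemma norm_phi_le_1: "norm (phi t) \<le> 1"
proof -
  have "norm (phi t) \<le> (\<integral>\<omega>. norm (cis (t * real_of_int (X 0 \<omega>))) \<partial>M)"
    unfolding phi_def by (rule integral_norm_bound)
  then show ?thesis by (simp add: prob_space)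
qed

lemma pwalk_fourier: "(LBINT t:{-pi..pi}. cis (- (t * real_of_int x)) * phi t ^ n) = of_real (2 * pi * pwalk n x)"
  using fourier_inversion_int[of "walk X n" x] by (simp add: char_walk pwalk_def)

lemma pwalk_0: "pwalk 0 x = (if x = 0 then 1 else 0)"
  by (simp add: pwalk_def walk_def prob_space)

text \<open>The one-step recursion, obtained on the Fourier side: the new factor \<open>\<phi>\<close> is the expectation of a character in \<open>X 0\<close>, and
  Fubini moves that expectation outside the inversion integral.\<close>

lemma pwalk_Suc: "pwalk (Suc n) x = (\<integral>\<omega>. pwalk n (x - X 0 \<omega>) \<partial>M)"
    and integrable_pwalk: "integrable M (\<lambda>\<omega>. pwalk n (x - X 0 \<omega>))"
proof -
  let ?f = "\<lambda>z t. cis (- (t * real_of_int x)) * phi t ^ n * cis (t * z)"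
  have fm: "(\<lambda>p. ?f (fst p) (snd p)) \<in> borel_measurable (borel \<Otimes>\<^sub>M borel)" by measurable
  have fb: "norm (?f z t) \<le> 1" for z t
    using norm_phi_le_1[of t] by (simp add: norm_mult norm_power power_le_one)
  note sw = set_integral_expectation_swap[where f = ?f and g = "\<lambda>_. 1", OF fm measurable_real_step _ fb, of "-pi" pi 0]
  have inner: "(LBINT t:{-pi..pi}. ?f (real_of_int (X 0 \<omega>)) t) = of_real (2 * pi * pwalk n (x - X 0 \<omega>))" for \<omega>
  proof -
    have "?f (real_of_int (X 0 \<omega>)) t = cis (- (t * real_of_int (x - X 0 \<omega>))) * phi t ^ n" for t
    proof -
      have "cis (- (t * real_of_int (x - X 0 \<omega>))) = cis (- (t * real_of_int x)) * cis (t * real_of_int (X 0 \<omega>))"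
        by (simp add: cis_mult algebra_simps)
      then show ?thesis by (simp add: mult_ac)
    qed
    then show ?thesis by (simp only: pwalk_fourier)
  qed
  have "integrable M (\<lambda>\<omega>. of_real (2 * pi * pwalk n (x - X 0 \<omega>)) :: complex)"
    using sw(3) by (simp only: inner) simp
  then have "integrable M (\<lambda>\<omega>. 2 * pi * pwalk n (x - X 0 \<omega>))"
    by (simp only: complex_of_real_integrable_eq)
  then show i: "integrable M (\<lambda>\<omega>. pwalk n (x - X 0 \<omega>))" by simp
  have "of_real (2 * pi * pwalk (Suc n) x) = (LBINT t:{-pi..pi}. (\<integral>\<omega>. ?f (real_of_int (X 0 \<omega>)) t \<partial>M))"
    unfolding pwalk_fourier[symmetric] by (simp add: phi_def mult_ac)
  also have "\<dots> = (\<integral>\<omega>. of_real (2 * pi * pwalk n (x - X 0 \<omega>)) \<partial>M)"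
    using sw(1) by (simp only: inner) simp
  also have "\<dots> = of_real (\<integral>\<omega>. 2 * pi * pwalk n (x - X 0 \<omega>) \<partial>M)" by (rule integral_complex_of_real)
  finally have "2 * pi * pwalk (Suc n) x = (\<integral>\<omega>. 2 * pi * pwalk n (x - X 0 \<omega>) \<partial>M)"
    by (simp only: of_real_eq_iff)
  then show "pwalk (Suc n) x = (\<integral>\<omega>. pwalk n (x - X 0 \<omega>) \<partial>M)" by simp
qed

text \<open>The truncated Green function, the expected number of visits to \<open>x\<close> before time \<open>N\<close>.\<close>

definition green :: "nat \<Rightarrow> int \<Rightarrow> real" where
  "green N x = (\<Sum>n<N. pwalk n x)"

text \<open>A maximum principle by induction on \<open>N\<close>: off the origin, \<open>green (Suc N)\<close> is an average of values of \<open>green N\<close>,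
  and these are at most \<open>green N 0 \<le> green (Suc N) 0\<close>.\<close>

lemma green_le_green_0: "green N x \<le> green N 0"
proof (induction N arbitrary: x)
  case (Suc N)
  show ?case
  proof (cases "x = 0")
    case False
    have "green (Suc N) x = (\<Sum>n<N. pwalk (Suc n) x)"
      using False unfolding green_def sum.lessThan_Suc_shift by (simp add: pwalk_0)
    also have "\<dots> = (\<integral>\<omega>. green N (x - X 0 \<omega>) \<partial>M)"
      unfolding green_def pwalk_Suc by (rule Bochner_Integration.integral_sum[symmetric]) (rule integrable_pwalk)
    also have "\<dots> \<le> (\<integral>\<omega>. green N 0 \<partial>M)"
      using Suc integrable_pwalk by (intro integral_mono) (auto simp: green_def)
    also have "\<dots> = green N 0" by (simp add: prob_space)
    also have "\<dots> \<le> green (Suc N) 0" by (simp add: green_def pwalk_def)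
    finally show ?thesis .
  qed simp
qed (simp add: green_def)

definition ppot :: "nat \<Rightarrow> int \<Rightarrow> real" where
  "ppot N x = (\<Sum>n<N. pwalk n 0 - pwalk n (- x))"

lemma ppot_nonneg: "0 \<le> ppot N x"
  using green_le_green_0[of N "- x"] by (simp add: ppot_def green_def sum_subtractf)

lemma potential_eq_suminf: "potential M X x = (\<Sum>n. pwalk n 0 - pwalk n (- x))"
  by (simp add: potential_def pwalk_def)

text \<open>The Fourier kernel of the partial sum at \<open>x\<close>, corrected by \<open>x\<close> times the one at \<open>1\<close> so that it vanishes to second
  order at \<open>0\<close>.\<close>

definition dker :: "int \<Rightarrow> real \<Rightarrow> complex" where
  "dker x t = (1 - cis (t * real_of_int x)) - of_int x * (1 - cis t)"

lemma set_integrable_phi_power: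
  "set_integrable lborel {-pi..pi} (\<lambda>t. cis (t * c) * phi t ^ n)"
  unfolding set_integrable_def
proof (rule Bochner_Integration.integrable_bound)
  show "integrable lborel (\<lambda>t. indicator {-pi..pi} t :: real)" by simp
  show "AE t in lborel. norm (indicator {-pi..pi} t *\<^sub>R (cis (t * c) * phi t ^ n)) \<le> norm (indicator {-pi..pi} t :: real)"
    using norm_phi_le_1 by (auto simp: norm_mult norm_power power_le_one indicator_def)
qed measurable

lemma ppot_fourier:
  "of_real (2 * pi * (ppot N x - real_of_int x * ppot N 1)) = (LBINT t:{-pi..pi}. (\<Sum>n<N. phi t ^ n) * dker x t)"
proof -
  have si: "set_integrable lborel {-pi..pi} (\<lambda>t. cis (t * c) * phi t ^ n)" for c n
    by (rule set_integrable_phi_power)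
  have trm: "of_real (2 * pi * ((pwalk n 0 - pwalk n (- x)) - real_of_int x * (pwalk n 0 - pwalk n (- 1))))
      = (LBINT t:{-pi..pi}. phi t ^ n * dker x t)"
    and trm_int: "set_integrable lborel {-pi..pi} (\<lambda>t. phi t ^ n * dker x t)" for n
  proof -
    have F: "of_real (2 * pi * pwalk n y) = (LBINT t:{-pi..pi}. cis (t * real_of_int (- y)) * phi t ^ n)" for y
      using pwalk_fourier[of y n] by simp
    have e: "phi t ^ n * dker x t = (cis (t * real_of_int (- 0)) * phi t ^ n - cis (t * real_of_int (- (- x))) * phi t ^ n)
        - of_int x * (cis (t * real_of_int (- 0)) * phi t ^ n - cis (t * real_of_int (- (- 1))) * phi t ^ n)" for t
      by (simp add: dker_def algebra_simps)
    note ints = set_integral_diff[OF si si] set_integral_diff[OF set_integral_diff(1)[OF si si] set_integrable_mult_right[OF set_integral_diff(1)[OF si si]]]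
    show "of_real (2 * pi * ((pwalk n 0 - pwalk n (- x)) - real_of_int x * (pwalk n 0 - pwalk n (- 1))))
      = (LBINT t:{-pi..pi}. phi t ^ n * dker x t)"
    proof -
      have "of_real (2 * pi * ((pwalk n 0 - pwalk n (- x)) - real_of_int x * (pwalk n 0 - pwalk n (- 1))))
          = (of_real (2 * pi * pwalk n 0) - of_real (2 * pi * pwalk n (- x)))
            - of_int x * ((of_real (2 * pi * pwalk n 0) - of_real (2 * pi * pwalk n (- 1))) :: complex)"
        by (simp add: algebra_simps)
      also have "\<dots> = (LBINT t:{-pi..pi}. phi t ^ n * dker x t)"
        unfolding F e by (simp only: ints set_integral_mult_right)
      finally show ?thesis .
    qed
    show "set_integrable lborel {-pi..pi} (\<lambda>t. phi t ^ n * dker x t)"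
      unfolding e by (rule ints)
  qed
  have "of_real (2 * pi * (ppot N x - real_of_int x * ppot N 1))
      = (\<Sum>n<N. of_real (2 * pi * ((pwalk n 0 - pwalk n (- x)) - real_of_int x * (pwalk n 0 - pwalk n (- 1)))) :: complex)"
    unfolding ppot_def of_real_sum[symmetric] by (simp add: sum_distrib_left sum_subtractf right_diff_distrib)
  also have "\<dots> = (\<Sum>n<N. LBINT t:{-pi..pi}. phi t ^ n * dker x t)" by (simp only: trm)
  also have "\<dots> = (LBINT t:{-pi..pi}. \<Sum>n<N. phi t ^ n * dker x t)"
    using trm_int unfolding set_lebesgue_integral_def set_integrable_def
    by (subst Bochner_Integration.integral_sum[symmetric]) (auto simp: scaleR_sum_right)
  finally show ?thesis by (simp add: sum_distrib_right)
qed

lemma norm_dker_le: "norm (dker x t) \<le> (\<bar>real_of_int x\<bar> + (real_of_int x)\<^sup>2) * t\<^sup>2"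
proof -
  have a: "norm (cis y - (1 + \<i> * of_real y)) \<le> y\<^sup>2" for y
  proof -
    have "norm (cis y - (1 + \<i> * of_real y)) \<le> \<bar>y\<bar>^2 / 2"
      using iexp_approx1[of y 1] by (simp add: cis_conv_exp numeral_2_eq_2)
    then show ?thesis using zero_le_power2[of y] unfolding power2_abs by linarith
  qed
  have "dker x t = of_int x * (cis t - (1 + \<i> * of_real t)) - (cis (t * real_of_int x) - (1 + \<i> * of_real (t * real_of_int x)))"
    by (simp add: dker_def algebra_simps)
  also have "norm \<dots> \<le> norm (of_int x * (cis t - (1 + \<i> * of_real t))) + norm (cis (t * real_of_int x) - (1 + \<i> * of_real (t * real_of_int x)))"
    by (rule norm_triangle_ineq4)
  also have "\<dots> \<le> \<bar>real_of_int x\<bar> * t\<^sup>2 + (t * real_of_int x)\<^sup>2"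
    unfolding norm_mult using a[of t] a[of "t * real_of_int x"] by (intro add_mono mult_mono) auto
  finally show ?thesis by (simp add: power_mult_distrib algebra_simps)
qed

lemma dker_symm: "dker x t + dker (- x) t = of_real (2 * (1 - cos (real_of_int x * t)))"
  by (simp add: dker_def complex_eq_iff mult.commute)

end

section \<open>Convergence of the potential series\<close>

locale heavy_walk = iid_walk M X + integrable_step M "X 0"
  for M :: "'w measure" and X :: "nat \<Rightarrow> 'w \<Rightarrow> int" +
  assumes irreducible: "irreducible_walk M X"
    and step_mean_zero: "expectation (\<lambda>\<omega>. real_of_int (X 0 \<omega>)) = 0"
    and step_second_moment: "(\<integral>\<^sup>+\<omega>. ennreal ((real_of_int (X 0 \<omega>))\<^sup>2) \<partial>M) = \<infinity>"
begin

lemma integrable_cis [simp]: 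
  assumes [measurable]: "f \<in> borel_measurable M" shows "integrable M (\<lambda>\<omega>. cis (f \<omega>))"
  by (rule integrable_const_bound[where B = 1]) auto

lemma phi_eq: "phi t = Complex (1 - cdef t) (smean t)"
proof (rule complex_eqI)
  have "Re (phi t) = expectation (\<lambda>\<omega>. cos (t * real_of_int (X 0 \<omega>)))"
    unfolding phi_def by (subst integral_Re[symmetric]) auto
  also have "\<dots> = expectation (\<lambda>\<omega>. 1 - (1 - cos (t * real_of_int (X 0 \<omega>))))" by simp
  also have "\<dots> = 1 - cdef t"
    unfolding cdef_def by (subst Bochner_Integration.integral_diff) (auto simp: prob_space simp del: integral_diff)
  finally show "Re (phi t) = Re (Complex (1 - cdef t) (smean t))" by simp
  show "Im (phi t) = Im (Complex (1 - cdef t) (smean t))"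
    unfolding phi_def smean_def by (subst integral_Im[symmetric]) auto
qed

text \<open>If \<open>|E (cis (t Z))|\<close> is \<open>1\<close>, attained at phase \<open>\<theta>\<close>, the right-hand side vanishes and every atom of \<open>Z\<close> satisfies
  \<open>cos (t a - \<theta>) = 1\<close>. Both the positivity of \<open>cdef\<close> and the countability of \<open>{t. |\<phi> t| = 1}\<close> rest on this.\<close>

lemma prob_mult_le_cos_defect:
  assumes [measurable]: "(\<lambda>\<omega>. real_of_int (Z \<omega>)) \<in> borel_measurable M"
  shows "prob {\<omega> \<in> space M. Z \<omega> = a} * (1 - cos (t * real_of_int a - \<theta>)) \<le> 1 - Re (cis (- \<theta>) * (\<integral>\<omega>. cis (t * real_of_int (Z \<omega>)) \<partial>M))"
proof -
  have "Measurable.pred M (\<lambda>\<omega>. real_of_int (Z \<omega>) = real_of_int a)" by measurable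
  then have [measurable]: "Measurable.pred M (\<lambda>\<omega>. Z \<omega> = a)" by simp
  have i: "integrable M (\<lambda>\<omega>. cos (t * real_of_int (Z \<omega>) - \<theta>))"
    by (rule integrable_const_bound[where B = 1]) auto
  have "prob {\<omega> \<in> space M. Z \<omega> = a} * (1 - cos (t * real_of_int a - \<theta>))
      = (\<integral>\<omega>. (if Z \<omega> = a then 1 - cos (t * real_of_int a - \<theta>) else 0) \<partial>M)"
    by (subst expectation_indicator_eq) auto
  also have "\<dots> \<le> (\<integral>\<omega>. 1 - cos (t * real_of_int (Z \<omega>) - \<theta>) \<partial>M)"
    by (rule integral_mono) (use i in \<open>auto intro!: integrable_const_bound[where B = 2] simp: abs_le_iff one_minus_cos_le_2\<close>)
  also have "\<dots> = 1 - (\<integral>\<omega>. cos (t * real_of_int (Z \<omega>) - \<theta>) \<partial>M)"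
    using i by (subst Bochner_Integration.integral_diff) (auto simp: prob_space)
  also have "(\<integral>\<omega>. cos (t * real_of_int (Z \<omega>) - \<theta>) \<partial>M) = (\<integral>\<omega>. Re (cis (- \<theta>) * cis (t * real_of_int (Z \<omega>))) \<partial>M)"
    by (simp add: cis_mult)
  also have "\<dots> = Re (\<integral>\<omega>. cis (- \<theta>) * cis (t * real_of_int (Z \<omega>)) \<partial>M)"
    by (rule integral_Re) auto
  finally show ?thesis by simp
qed

text \<open>If \<open>cdef t = 0\<close> then \<open>\<phi> t = 1\<close>, so \<open>cis (t S_n)\<close> has mean \<open>1\<close> for every \<open>n\<close>; but by irreducibility some \<open>S_n\<close> hits
  \<open>1\<close>, which forces \<open>cos t = 1\<close>.\<close>

lemma cos_defect_pos:
  assumes t: "0 < t" "t \<le> pi" shows "0 < cdef t"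
proof (rule ccontr)
  assume "\<not> 0 < cdef t"
  then have u: "cdef t = 0" using cdef_nonneg[of t] by simp
  have "(Re (phi t))\<^sup>2 + (Im (phi t))\<^sup>2 \<le> 1"
    using norm_phi_le_1[of t] by (simp add: cmod_def)
  then have "smean t = 0" using u by (simp add: phi_eq)
  then have "phi t = 1" using u by (simp add: phi_eq complex_eq_iff)
  moreover obtain n where n: "prob {\<omega> \<in> space M. 0 + walk X n \<omega> = 1} > 0"
    using irreducible unfolding irreducible_walk_def by blast
  ultimately have "prob {\<omega> \<in> space M. walk X n \<omega> = 1} * (1 - cos t) \<le> 0"
    using prob_mult_le_cos_defect[of "walk X n" 1 t 0] by (simp add: char_walk)
  then have "1 \<le> cos t" using n by (simp add: mult_le_0_iff)
  moreover have "cos t < cos 0" using t by (intro cos_monotone_0_pi) auto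
  ultimately show False by simp
qed

sublocale heavy_step M "X 0"
  by unfold_locales (use step_mean_zero step_second_moment cos_defect_pos in auto)

lemma measurable_eq_step [measurable]: "Measurable.pred M (\<lambda>\<omega>. X k \<omega> = a)"
proof -
  have "Measurable.pred M (\<lambda>\<omega>. real_of_int (X k \<omega>) = real_of_int a)" by measurable
  then show ?thesis by simp
qed

lemma step_not_bounded_AE: "\<not> (AE \<omega> in M. \<bar>real_of_int (X 0 \<omega>)\<bar> \<le> L)"
proof
  assume "AE \<omega> in M. \<bar>real_of_int (X 0 \<omega>)\<bar> \<le> L"
  then have "(\<integral>\<^sup>+\<omega>. ennreal ((real_of_int (X 0 \<omega>))\<^sup>2) \<partial>M) \<le> (\<integral>\<^sup>+\<omega>. ennreal (L\<^sup>2) \<partial>M)"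
  proof (intro nn_integral_mono_AE, eventually_elim)
    fix \<omega> assume "\<bar>real_of_int (X 0 \<omega>)\<bar> \<le> L"
    then have "\<bar>real_of_int (X 0 \<omega>)\<bar>\<^sup>2 \<le> L\<^sup>2" by (intro power_mono) auto
    then show "ennreal ((real_of_int (X 0 \<omega>))\<^sup>2) \<le> ennreal (L\<^sup>2)" by (intro ennreal_leI) simp
  qed
  also have "\<dots> < \<infinity>" by (simp add: emeasure_space_1)
  finally show False using step_second_moment by simp
qed

lemma two_atoms: "\<exists>a b. a \<noteq> b \<and> 0 < prob {\<omega> \<in> space M. X 0 \<omega> = a} \<and> 0 < prob {\<omega> \<in> space M. X 0 \<omega> = b}"
proof -
  have null: "AE \<omega> in M. X 0 \<omega> \<noteq> a" if "\<not> 0 < prob {\<omega> \<in> space M. X 0 \<omega> = a}" for a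
  proof -
    have "prob {\<omega> \<in> space M. X 0 \<omega> = a} = 0" using that by (simp add: zero_less_measure_iff)
    then show ?thesis by (subst (asm) prob_eq_0) auto
  qed
  have "\<exists>a. 0 < prob {\<omega> \<in> space M. X 0 \<omega> = a}"
  proof (rule ccontr)
    assume "\<not> ?thesis"
    then have "AE \<omega> in M. \<forall>a. X 0 \<omega> \<noteq> a" using null by (simp only: AE_all_countable) blast
    then have "AE \<omega> in M. False" by simp
    then show False by simp
  qed
  then obtain a where a: "0 < prob {\<omega> \<in> space M. X 0 \<omega> = a}" by blast
  have "\<exists>b. b \<noteq> a \<and> 0 < prob {\<omega> \<in> space M. X 0 \<omega> = b}"
  proof (rule ccontr)
    assume n: "\<not> ?thesis"
    have "AE \<omega> in M. b \<noteq> a \<longrightarrow> X 0 \<omega> \<noteq> b" for b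
      using n null[of b] by (cases "b = a") auto
    then have "AE \<omega> in M. \<forall>b. b \<noteq> a \<longrightarrow> X 0 \<omega> \<noteq> b" by (simp only: AE_all_countable) blast
    then have "AE \<omega> in M. \<bar>real_of_int (X 0 \<omega>)\<bar> \<le> \<bar>real_of_int a\<bar>" by eventually_elim auto
    then show False using step_not_bounded_AE by blast
  qed
  with a show ?thesis by blast
qed

text \<open>A periodic walk has \<open>|\<phi> t| = 1\<close> at some \<open>t \<noteq> 0\<close>. Two atoms \<open>a \<noteq> b\<close> of the step confine such \<open>t\<close> to multiples
  of \<open>2 \<pi> / (a - b)\<close>, a null set, so \<open>\<phi>^N \<rightarrow> 0\<close> almost everywhere.\<close>

lemma countable_norm_phi_eq_1: "countable {t. norm (phi t) = 1}"
proof -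
  obtain a b where ab: "a \<noteq> b" "0 < prob {\<omega> \<in> space M. X 0 \<omega> = a}" "0 < prob {\<omega> \<in> space M. X 0 \<omega> = b}"
    using two_atoms by blast
  have "{t. norm (phi t) = 1} \<subseteq> (\<lambda>k::int. real_of_int k * 2 * pi / real_of_int (a - b)) ` UNIV"
  proof
    fix t assume "t \<in> {t. norm (phi t) = 1}"
    then have n: "norm (phi t) = 1" by simp
    define \<theta> where "\<theta> = Arg (phi t)"
    have "phi t = cis \<theta>" using rcis_cmod_Arg[of "phi t"] n by (simp add: \<theta>_def rcis_def)
    then have z: "1 - Re (cis (- \<theta>) * (\<integral>\<omega>. cis (t * real_of_int (X 0 \<omega>)) \<partial>M)) = 0"
      by (simp add: phi_def[symmetric] cis_mult)
    have one: "cos (t * real_of_int c - \<theta>) = 1" if "0 < prob {\<omega> \<in> space M. X 0 \<omega> = c}" for c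
      proof (rule antisym[OF cos_le_one])
      have "prob {\<omega> \<in> space M. X 0 \<omega> = c} * (1 - cos (t * real_of_int c - \<theta>)) \<le> 0"
        using prob_mult_le_cos_defect[of "X 0" c t \<theta>] z by simp
      then show "1 \<le> cos (t * real_of_int c - \<theta>)" using that by (simp add: mult_le_0_iff)
    qed
    obtain k l :: int where "t * real_of_int a - \<theta> = of_int k * 2 * pi" "t * real_of_int b - \<theta> = of_int l * 2 * pi"
      using one[OF ab(2)] one[OF ab(3)] by (auto simp: cos_one_2pi_int)
    then have "t * real_of_int (a - b) = real_of_int (k - l) * 2 * pi" by (simp add: algebra_simps)
    then have "t = real_of_int (k - l) * 2 * pi / real_of_int (a - b)" using ab(1) by (simp add: field_simps)
    then show "t \<in> (\<lambda>k::int. real_of_int k * 2 * pi / real_of_int (a - b)) ` UNIV" by blast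
  qed
  then show ?thesis by (rule countable_subset) simp
qed

lemma norm_one_minus_phi_ge: "cdef t \<le> norm (1 - phi t)"
  using abs_Re_le_cmod[of "1 - phi t"] by (simp add: phi_eq)

lemma cdef_ge_sq_symmetric: "\<exists>c>0. \<forall>t\<in>{-pi..pi}. c * t\<^sup>2 \<le> cdef t"
proof -
  obtain c where c: "c > 0" "\<And>t. 0 \<le> t \<Longrightarrow> t \<le> pi \<Longrightarrow> c * t\<^sup>2 \<le> cdef t"
    using cdef_ge_sq by blast
  have "c * t\<^sup>2 \<le> cdef t" if "t \<in> {-pi..pi}" for t
  proof (cases "0 \<le> t")
    case False
    then show ?thesis using c(2)[of "- t"] that by simp
  qed (use c that in auto)
  with c show ?thesis by blast
qed

lemma dker_bound: "\<exists>C. \<forall>t\<in>{-pi..pi}. norm (dker x t / (1 - phi t)) \<le> C"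
proof -
  obtain c where c: "c > 0" "\<And>t. t \<in> {-pi..pi} \<Longrightarrow> c * t\<^sup>2 \<le> cdef t"
    using cdef_ge_sq_symmetric by blast
  define K where "K = \<bar>real_of_int x\<bar> + (real_of_int x)\<^sup>2"
  have "norm (dker x t / (1 - phi t)) \<le> K / c" if t: "t \<in> {-pi..pi}" for t
  proof (cases "t = 0")
    case False
    have "norm (dker x t / (1 - phi t)) \<le> K * t\<^sup>2 / (c * t\<^sup>2)"
      unfolding norm_divide using c(1) c(2)[OF t] norm_one_minus_phi_ge[of t] norm_dker_le[of x t] False
      by (intro frac_le) (auto simp: K_def)
    then show ?thesis using False by simp
  qed (use c in \<open>simp add: dker_def K_def\<close>)
  then show ?thesis by blast
qed

definition dlim :: "int \<Rightarrow> real" where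
  "dlim x = Re (LBINT t:{-pi..pi}. dker x t / (1 - phi t)) / (2 * pi)"

lemma dker_measurable [measurable]: "dker x \<in> borel_measurable borel"
  unfolding dker_def[abs_def] by measurable

lemma set_integrable_dker: "set_integrable lborel {-pi..pi} (\<lambda>t. dker x t / (1 - phi t))"
proof -
  obtain C where C: "\<And>t. t \<in> {-pi..pi} \<Longrightarrow> norm (dker x t / (1 - phi t)) \<le> C"
    using dker_bound by blast
  show ?thesis unfolding set_integrable_def
  proof (rule Bochner_Integration.integrable_bound)
    show "integrable lborel (\<lambda>t. indicator {-pi..pi} t * C)" by simp
    show "AE t in lborel. norm (indicator {-pi..pi} t *\<^sub>R (dker x t / (1 - phi t))) \<le> norm (indicator {-pi..pi} t * C)"
      using order_trans[OF C abs_ge_self] by (intro AE_I2) (simp add: indicator_def)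
  qed measurable
qed

text \<open>Dominated convergence in the geometric series \<open>(1 - \<phi>^N) / (1 - \<phi>)\<close>, with the bounded function
  \<open>dker x / (1 - \<phi>)\<close> as dominating factor.\<close>

lemma ppot_linear_defect_tendsto: "(\<lambda>N. ppot N x - real_of_int x * ppot N 1) \<longlonglongrightarrow> dlim x"
proof -
  obtain C where C: "\<And>t. t \<in> {-pi..pi} \<Longrightarrow> norm (dker x t / (1 - phi t)) \<le> C"
    using dker_bound by blast
  obtain c where c: "c > 0" "\<And>t. t \<in> {-pi..pi} \<Longrightarrow> c * t\<^sup>2 \<le> cdef t"
    using cdef_ge_sq_symmetric by blast
  have geo: "(\<Sum>n<N. phi t ^ n) * dker x t = (1 - phi t ^ N) * (dker x t / (1 - phi t))" if t: "t \<in> {-pi..pi}" for N t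
  proof (cases "t = 0")
    case False
    have "0 < c * t\<^sup>2" using c False by simp
    also have "\<dots> \<le> cdef t" by (rule c(2)[OF t])
    also have "\<dots> \<le> norm (1 - phi t)" by (rule norm_one_minus_phi_ge)
    finally have "phi t \<noteq> 1" by auto
    then show ?thesis by (simp add: sum_gp_strict)
  qed (simp add: dker_def)
  have "(\<lambda>N. LBINT t:{-pi..pi}. (\<Sum>n<N. phi t ^ n) * dker x t) \<longlonglongrightarrow> (LBINT t:{-pi..pi}. dker x t / (1 - phi t))"
    unfolding set_lebesgue_integral_def
  proof (rule integral_dominated_convergence[where w = "\<lambda>t. indicator {-pi..pi} t * (2 * C)"])
    have "AE t in lborel. t \<notin> {t. norm (phi t) = 1}"
      using countable_norm_phi_eq_1 by (intro AE_not_in countable_imp_null_set_lborel)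
    then show "AE t in lborel. (\<lambda>N. indicator {-pi..pi} t *\<^sub>R ((\<Sum>n<N. phi t ^ n) * dker x t)) \<longlonglongrightarrow> indicator {-pi..pi} t *\<^sub>R (dker x t / (1 - phi t))"
    proof eventually_elim
      fix t assume "t \<notin> {t. norm (phi t) = 1}"
      then have "norm (phi t) < 1" using norm_phi_le_1[of t] by (simp add: less_le)
      then have "(\<lambda>N. (1 - phi t ^ N) * (dker x t / (1 - phi t))) \<longlonglongrightarrow> (1 - 0) * (dker x t / (1 - phi t))"
        by (intro tendsto_intros LIMSEQ_power_zero)
      then show "(\<lambda>N. indicator {-pi..pi} t *\<^sub>R ((\<Sum>n<N. phi t ^ n) * dker x t)) \<longlonglongrightarrow> indicator {-pi..pi} t *\<^sub>R (dker x t / (1 - phi t))"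
        by (cases "t \<in> {-pi..pi}") (simp_all add: geo)
    qed
    show "AE t in lborel. norm (indicator {-pi..pi} t *\<^sub>R ((\<Sum>n<N. phi t ^ n) * dker x t)) \<le> indicator {-pi..pi} t * (2 * C)" for N
    proof (rule AE_I2)
      fix t
      have "norm ((\<Sum>n<N. phi t ^ n) * dker x t) \<le> 2 * C" if t: "t \<in> {-pi..pi}"
      proof -
        have "norm (1 - phi t ^ N) \<le> norm (1::complex) + norm (phi t ^ N)" by (rule norm_triangle_ineq4)
        also have "\<dots> \<le> 2" using norm_phi_le_1[of t] by (simp add: norm_power power_le_one)
        finally show ?thesis unfolding geo[OF t] norm_mult using C[OF t] by (intro mult_mono) auto
      qed
      then show "norm (indicator {-pi..pi} t *\<^sub>R ((\<Sum>n<N. phi t ^ n) * dker x t)) \<le> indicator {-pi..pi} t * (2 * C)"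
        by (simp add: indicator_def)
    qed
  qed (simp, measurable)
  then have "(\<lambda>N. Re (of_real (2 * pi * (ppot N x - real_of_int x * ppot N 1)))) \<longlonglongrightarrow> Re (LBINT t:{-pi..pi}. dker x t / (1 - phi t))"
    unfolding ppot_fourier by (rule tendsto_Re)
  then have "(\<lambda>N. 2 * pi * (ppot N x - real_of_int x * ppot N 1) / (2 * pi)) \<longlonglongrightarrow> Re (LBINT t:{-pi..pi}. dker x t / (1 - phi t)) / (2 * pi)"
    by (intro tendsto_divide) simp_all
  then show ?thesis by (simp add: dlim_def)
qed

lemma Re_inverse_one_minus_phi: "Re (1 / (1 - phi t)) = rinv t"
  by (simp add: phi_eq rinv_def Re_divide power2_eq_square)

lemma dlim_symm: "dlim x + dlim (- x) = 2 * fpot (real_of_int x)"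
proof -
  have "(LBINT t:{-pi..pi}. dker x t / (1 - phi t)) + (LBINT t:{-pi..pi}. dker (- x) t / (1 - phi t))
      = (LBINT t:{-pi..pi}. dker x t / (1 - phi t) + dker (- x) t / (1 - phi t))"
    by (rule set_integral_add(2)[symmetric]; rule set_integrable_dker)
  also have "\<dots> = (LBINT t:{-pi..pi}. of_real (2 * (1 - cos (real_of_int x * t))) * (1 / (1 - phi t)))"
    by (simp add: add_divide_distrib[symmetric] dker_symm)
  finally have e: "(LBINT t:{-pi..pi}. dker x t / (1 - phi t)) + (LBINT t:{-pi..pi}. dker (- x) t / (1 - phi t)) = \<dots>" .
  have i: "set_integrable lborel {-pi..pi} (\<lambda>t. of_real (2 * (1 - cos (real_of_int x * t))) * (1 / (1 - phi t)))"
    using set_integral_add(1)[OF set_integrable_dker[of x] set_integrable_dker[of "- x"]]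
    by (simp add: add_divide_distrib[symmetric] dker_symm)
  have "Re (LBINT t:{-pi..pi}. of_real (2 * (1 - cos (real_of_int x * t))) * (1 / (1 - phi t)))
      = (LBINT t:{-pi..pi}. Re (of_real (2 * (1 - cos (real_of_int x * t))) * (1 / (1 - phi t))))"
    using i unfolding set_lebesgue_integral_def set_integrable_def by (subst integral_Re[symmetric]) simp_all
  also have "\<dots> = (LBINT t:{-pi..pi}. 2 * ((1 - cos (real_of_int x * t)) * rinv t))"
  proof (rule set_lebesgue_integral_cong)
    show "\<forall>t. t \<in> {-pi..pi} \<longrightarrow> Re (of_real (2 * (1 - cos (real_of_int x * t))) * (1 / (1 - phi t)))
        = 2 * ((1 - cos (real_of_int x * t)) * rinv t)"
      by (simp only: Re_of_real_times Re_inverse_one_minus_phi mult.assoc) simp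
  qed simp
  also have "\<dots> = 2 * (LBINT t:{-pi..pi}. (1 - cos (real_of_int x * t)) * rinv t)" by simp
  also have "(LBINT t:{-pi..pi}. (1 - cos (real_of_int x * t)) * rinv t) = 2 * (LBINT t:{0..pi}. (1 - cos (real_of_int x * t)) * rinv t)"
    by (rule LBINT_even[OF integrable_fpot]) auto
  finally have "Re (LBINT t:{-pi..pi}. of_real (2 * (1 - cos (real_of_int x * t))) * (1 / (1 - phi t)))
     = 4 * pi * fpot (real_of_int x)" by (simp add: fpot_def)
  then show ?thesis unfolding dlim_def using arg_cong[OF e, of Re]
    by (simp add: add_divide_distrib[symmetric])
qed

text \<open>Nonnegativity of the partial sums at \<open>k\<close> and \<open>-k\<close> squeezes \<open>k * ppot N 1\<close> between quantities that converge to
  \<open>- dlim k\<close> and \<open>dlim (- k)\<close>. These differ by \<open>2 fpot k\<close>, which is \<open>o(k)\<close>.\<close>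

lemma ppot_1_convergent: "convergent (\<lambda>N. ppot N 1)"
proof (rule Cauchy_convergent, rule metric_CauchyI)
  fix e :: real assume e: "0 < e"
  obtain x0 where x0: "\<And>x. x0 \<le> x \<Longrightarrow> fpot x \<le> (e / 8) * x"
    using fpot_sublinear[of "e / 8"] e by auto
  define k where "k = max 1 \<lceil>x0\<rceil>"
  have k: "1 \<le> k" "x0 \<le> real_of_int k" by (auto simp: k_def le_max_iff_disj ceiling_le_iff[symmetric] le_of_int_ceiling intro: order_trans[OF le_of_int_ceiling])
  define K where "K = real_of_int k"
  have K: "1 \<le> K" using k by (simp add: K_def)
  have ak: "fpot K \<le> e / 8 * K" using x0[OF k(2)] by (simp add: K_def)
  have eK: "0 < e / 8 * K" using e K by simp
  have l1: "\<forall>\<^sub>F N in sequentially. \<bar>(ppot N k - K * ppot N 1) - dlim k\<bar> < e / 8 * K"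
    using tendstoD[OF ppot_linear_defect_tendsto[of k] eK] by (simp add: dist_real_def K_def)
  have l2: "\<forall>\<^sub>F N in sequentially. \<bar>(ppot N (- k) + K * ppot N 1) - dlim (- k)\<bar> < e / 8 * K"
    using tendstoD[OF ppot_linear_defect_tendsto[of "- k"] eK] by (simp add: dist_real_def K_def)
  have "\<forall>\<^sub>F N in sequentially. - dlim k - e / 8 * K \<le> K * ppot N 1 \<and> K * ppot N 1 \<le> dlim (- k) + e / 8 * K"
    using l1 l2
  proof eventually_elim
    case (elim N)
    show ?case using elim ppot_nonneg[of N k] ppot_nonneg[of N "- k"] by linarith
  qed
  then obtain N0 where N0: "\<And>N. N0 \<le> N \<Longrightarrow> - dlim k - e / 8 * K \<le> K * ppot N 1 \<and> K * ppot N 1 \<le> dlim (- k) + e / 8 * K"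
    by (auto simp: eventually_sequentially)
  have "dist (ppot m 1) (ppot n 1) < e" if "N0 \<le> m" "N0 \<le> n" for m n
  proof -
    have r: "dlim k + dlim (- k) \<le> e / 4 * K" using dlim_symm[of k] ak by (simp add: K_def)
    have "K * ppot m 1 - K * ppot n 1 \<le> e / 2 * K" "K * ppot n 1 - K * ppot m 1 \<le> e / 2 * K"
      using N0[OF that(1)] N0[OF that(2)] r by linarith+
    then have "\<bar>K * ppot m 1 - K * ppot n 1\<bar> \<le> e / 2 * K"
      unfolding abs_le_iff by linarith
    then have "K * \<bar>ppot m 1 - ppot n 1\<bar> \<le> K * (e / 2)"
      using K by (simp add: right_diff_distrib[symmetric] abs_mult mult_ac)
    then have "\<bar>ppot m 1 - ppot n 1\<bar> \<le> e / 2" using K by simp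
    then show ?thesis using e by (simp add: dist_real_def)
  qed
  then show "\<exists>N0. \<forall>m\<ge>N0. \<forall>n\<ge>N0. dist (ppot m 1) (ppot n 1) < e" by blast
qed

lemma sym_potential_eq_fpot: "sym_potential M X x = fpot (real_of_int x)"
proof -
  obtain b where b: "(\<lambda>N. ppot N 1) \<longlonglongrightarrow> b" using ppot_1_convergent by (auto simp: convergent_def)
  have p: "potential M X y = dlim y + real_of_int y * b" for y
  proof -
    have "(\<lambda>N. (ppot N y - real_of_int y * ppot N 1) + real_of_int y * ppot N 1) \<longlonglongrightarrow> dlim y + real_of_int y * b"
      by (intro tendsto_intros ppot_linear_defect_tendsto b)
    then have "(\<lambda>n. pwalk n 0 - pwalk n (- y)) sums (dlim y + real_of_int y * b)"
      by (simp add: sums_def ppot_def)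
    then show ?thesis unfolding potential_eq_suminf by (rule sums_unique[symmetric])
  qed
  show ?thesis using dlim_symm[of x] by (simp add: sym_potential_def p)
qed

section \<open>The two conditions in terms of expectations\<close>

lemma t_eta_pos: assumes "0 < t" shows "0 < t * eta M (X 0) (1 / t)"
proof (rule ccontr)
  assume "\<not> 0 < t * eta M (X 0) (1 / t)"
  moreover have "0 \<le> expectation (\<lambda>\<omega>. max 0 (\<bar>t * real_of_int (X 0 \<omega>)\<bar> - 1))" by (rule integral_nonneg_AE) auto
  ultimately have "expectation (\<lambda>\<omega>. max 0 (\<bar>t * real_of_int (X 0 \<omega>)\<bar> - 1)) = 0"
    using t_eta_eq[OF assms] by simp
  then have "AE \<omega> in M. max 0 (\<bar>t * real_of_int (X 0 \<omega>)\<bar> - 1) = 0"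
    by (subst (asm) integral_nonneg_eq_0_iff_AE) auto
  then have "AE \<omega> in M. \<bar>real_of_int (X 0 \<omega>)\<bar> \<le> 1 / t"
    by eventually_elim (use assms in \<open>auto simp: max_def abs_mult field_simps split: if_splits\<close>)
  then show False using step_not_bounded_AE by blast
qed

text \<open>\<open>\<eta>\<close> may be replaced by \<open>hmean\<close>: on one side \<open>t \<eta>(1/t) \<le> hmean t\<close>, and on the other \<open>hmean t\<close> is at most three times
  \<open>cdef t + t \<eta>(1/t)\<close>, where the first summand is part of the numerator.\<close>

lemma liminf_pos_iff:
  "Liminf (at_right (0::real)) (\<lambda>t. ereal ((alpha M (X 0) t + \<bar>gamma M (X 0) t\<bar>) / eta M (X 0) (1 / t))) > 0
    \<longleftrightarrow> (\<exists>\<delta>>0. \<exists>\<tau>>0. \<forall>t. 0 < t \<and> t \<le> \<tau> \<longrightarrow> \<delta> * hmean t \<le> cdef t + \<bar>smean t\<bar>)" (is "?L \<longleftrightarrow> ?R")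
proof -
  have quot: "(alpha M (X 0) t + \<bar>gamma M (X 0) t\<bar>) / eta M (X 0) (1 / t) = (cdef t + \<bar>smean t\<bar>) / (t * eta M (X 0) (1 / t))"
    if t: "0 < t" for t
    using t by (simp add: alpha_eq gamma_eq step_mean_zero cdef_def smean_def abs_divide add_divide_distrib[symmetric])
  show ?thesis
  proof
    assume L: ?L
    obtain r where r: "0 < ereal r" "ereal r < Liminf (at_right (0::real)) (\<lambda>t. ereal ((alpha M (X 0) t + \<bar>gamma M (X 0) t\<bar>) / eta M (X 0) (1 / t)))"
      using ereal_dense2[OF L] by blast
    have r0: "0 < r" using r(1) by simp
    have "\<forall>\<^sub>F t in at_right 0. r < (alpha M (X 0) t + \<bar>gamma M (X 0) t\<bar>) / eta M (X 0) (1 / t)"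
      using less_LiminfD[OF r(2)] by simp
    then obtain b where b: "0 < b" "\<And>t. 0 < t \<Longrightarrow> t < b \<Longrightarrow> r < (alpha M (X 0) t + \<bar>gamma M (X 0) t\<bar>) / eta M (X 0) (1 / t)"
      by (auto simp: eventually_at_right[of 0 1])
    have "r / (3 * (1 + r)) * hmean t \<le> cdef t + \<bar>smean t\<bar>" if t: "0 < t" "t \<le> b / 2" for t
    proof -
      have e: "0 < t * eta M (X 0) (1 / t)" by (rule t_eta_pos[OF t(1)])
      have "r < (cdef t + \<bar>smean t\<bar>) / (t * eta M (X 0) (1 / t))"
        using b(2)[of t] t b(1) quot[of t] by simp
      then have "r * (t * eta M (X 0) (1 / t)) \<le> cdef t + \<bar>smean t\<bar>" using e by (simp add: pos_less_divide_eq)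
      moreover have "r * cdef t \<le> r * (cdef t + \<bar>smean t\<bar>)" using r0 by (intro mult_left_mono) auto
      moreover have "r * (hmean t / 3) \<le> r * (cdef t + t * eta M (X 0) (1 / t))"
        using r0 t by (intro mult_left_mono hmean_le_cdef_eta) auto
      ultimately have "r * (hmean t / 3) \<le> (1 + r) * (cdef t + \<bar>smean t\<bar>)" by (simp add: algebra_simps)
      then show ?thesis using r0 by (simp add: field_simps)
    qed
    then show ?R using r0 b by (intro exI[of _ "r / (3 * (1 + r))"] conjI exI[of _ "b / 2"]) auto
  next
    assume ?R
    then obtain \<delta> \<tau> where H: "0 < \<delta>" "0 < \<tau>" "\<And>t. 0 < t \<Longrightarrow> t \<le> \<tau> \<Longrightarrow> \<delta> * hmean t \<le> cdef t + \<bar>smean t\<bar>" by blast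
    have "\<forall>\<^sub>F t in at_right 0. ereal \<delta> \<le> ereal ((alpha M (X 0) t + \<bar>gamma M (X 0) t\<bar>) / eta M (X 0) (1 / t))"
      unfolding eventually_at_right[of 0 1, OF zero_less_one]
    proof (intro exI[of _ \<tau>] conjI allI impI)
      fix t assume t: "0 < t" "t < \<tau>"
      have "\<delta> * (t * eta M (X 0) (1 / t)) \<le> \<delta> * hmean t" using H t by (intro mult_left_mono t_eta_le_hmean) auto
      then have "\<delta> * (t * eta M (X 0) (1 / t)) \<le> cdef t + \<bar>smean t\<bar>" using H(3)[of t] t by simp
      then show "ereal \<delta> \<le> ereal ((alpha M (X 0) t + \<bar>gamma M (X 0) t\<bar>) / eta M (X 0) (1 / t))"
        using t_eta_pos[OF t(1)] by (simp add: quot[OF t(1)] pos_le_divide_eq)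
    qed (use H in simp)
    then have "ereal \<delta> \<le> Liminf (at_right (0::real)) (\<lambda>t. ereal ((alpha M (X 0) t + \<bar>gamma M (X 0) t\<bar>) / eta M (X 0) (1 / t)))"
      by (rule Liminf_bounded)
    from order.strict_trans2[OF _ this, of 0] H(1) show ?L by simp
  qed
qed

lemma potential_bound_iff:
  "Limsup at_top (\<lambda>x::int. ereal (sym_potential M X x * m_total M (X 0) (real_of_int x) / real_of_int x)) < \<infinity>
    \<longleftrightarrow> (\<exists>C x0. \<forall>x::int. x0 \<le> x \<and> 1 \<le> x \<longrightarrow> fpot (real_of_int x) \<le> C * rate (1 / real_of_int x))" (is "?L \<longleftrightarrow> ?R")
proof -
  have quot: "sym_potential M X x * m_total M (X 0) (real_of_int x) / real_of_int x \<le> C \<longleftrightarrow> fpot (real_of_int x) \<le> C * rate (1 / real_of_int x)"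
    if "1 \<le> x" for x :: int and C
    using that hmean_pos[of "1 / real_of_int x"]
    by (simp add: sym_potential_eq_fpot m_total_eq_hmean rate_def field_simps power2_eq_square)
  show ?thesis
  proof
    assume ?L
    then obtain C where C: "Limsup at_top (\<lambda>x::int. ereal (sym_potential M X x * m_total M (X 0) (real_of_int x) / real_of_int x)) < ereal C"
      using ereal_dense2 by blast
    obtain x0 where x0: "\<And>x. x0 \<le> x \<Longrightarrow> sym_potential M X x * m_total M (X 0) (real_of_int x) / real_of_int x < C"
      using Limsup_lessD[OF C] by (auto simp: eventually_at_top_linorder)
    then show ?R using quot by (meson less_imp_le)
  next
    assume ?R
    then obtain C x0 where C: "\<And>x::int. x0 \<le> x \<Longrightarrow> 1 \<le> x \<Longrightarrow> fpot (real_of_int x) \<le> C * rate (1 / real_of_int x)" by blast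
    have "\<forall>\<^sub>F x::int in at_top. ereal (sym_potential M X x * m_total M (X 0) (real_of_int x) / real_of_int x) \<le> ereal C"
      using eventually_ge_at_top[of x0] eventually_ge_at_top[of 1]
      by eventually_elim (use C quot in auto)
    then have "Limsup at_top (\<lambda>x::int. ereal (sym_potential M X x * m_total M (X 0) (real_of_int x) / real_of_int x)) \<le> ereal C"
      by (rule Limsup_bounded)
    then show ?L by (rule order.strict_trans1) simp
  qed
qed

end

theorem corollary4:
  fixes M :: "'w measure" and X :: "nat \<Rightarrow> 'w \<Rightarrow> int"
  assumes "prob_space M"
    and "iid_int M X"
    and "irreducible_walk M X"
    and "integrable M (\<lambda>\<omega>. real_of_int (X 0 \<omega>))"
    and "(\<integral>\<omega>. real_of_int (X 0 \<omega>) \<partial>M) = 0"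
    and "(\<integral>\<^sup>+\<omega>. ennreal ((real_of_int (X 0 \<omega>))\<^sup>2) \<partial>M) = \<infinity>"
    and "((\<lambda>x::real. m_minus M (X 0) x / m_plus M (X 0) x) \<longlongrightarrow> 1) at_top"
  shows "Limsup at_top
           (\<lambda>x::int. ereal (sym_potential M X x * m_total M (X 0) (real_of_int x) / real_of_int x))
           < \<infinity>
     \<longleftrightarrow>
         Liminf (at_right (0::real))
           (\<lambda>t. ereal ((alpha M (X 0) t + \<bar>gamma M (X 0) t\<bar>) / eta M (X 0) (1 / t)))
           > 0"
proof -
  interpret prob_space M by fact
  interpret heavy_walk M X
    by unfold_locales (use assms in auto)
  show ?thesis
    unfolding potential_bound_iff liminf_pos_iff
  proof
    assume "\<exists>C x0. \<forall>x::int. x0 \<le> x \<and> 1 \<le> x \<longrightarrow> fpot (real_of_int x) \<le> C * rate (1 / real_of_int x)"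
    then obtain C x0 where C: "\<And>x::int. x0 \<le> x \<Longrightarrow> 1 \<le> x \<Longrightarrow> fpot (real_of_int x) \<le> C * rate (1 / real_of_int x)" by blast
    have "fpot (real z) \<le> C * rate (1 / real z)" if "nat (max 1 x0) \<le> z" for z :: nat
      using C[of "int z"] that by simp
    then obtain C0 where C0: "0 < C0" "\<And>s. 0 < s \<Longrightarrow> s \<le> 1 \<Longrightarrow> (LBINT t:{s..pi}. rinv t) \<le> C0 * rate s"
      using rinv_integral_le_of_fpot_bound by blast
    obtain \<epsilon> \<tau> where e: "0 < \<epsilon>" "0 < \<tau>" "\<And>t. 0 < t \<Longrightarrow> t \<le> \<tau> \<Longrightarrow> \<epsilon> * hmean t \<le> cdef t"
      using cos_defect_lower_bound[OF C0 smean_small_of_balance[OF assms(7)]] by blast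
    have "\<epsilon> * hmean t \<le> cdef t + \<bar>smean t\<bar>" if "0 < t" "t \<le> \<tau>" for t
      using e(3)[OF that] by linarith
    then show "\<exists>\<delta>>0. \<exists>\<tau>>0. \<forall>t. 0 < t \<and> t \<le> \<tau> \<longrightarrow> \<delta> * hmean t \<le> cdef t + \<bar>smean t\<bar>"
      using e by blast
  next
    assume "\<exists>\<delta>>0. \<exists>\<tau>>0. \<forall>t. 0 < t \<and> t \<le> \<tau> \<longrightarrow> \<delta> * hmean t \<le> cdef t + \<bar>smean t\<bar>"
    then obtain \<delta> \<tau> where H: "0 < \<delta>" "0 < \<tau>" "\<And>t. 0 < t \<Longrightarrow> t \<le> \<tau> \<Longrightarrow> \<delta> * hmean t \<le> cdef t + \<bar>smean t\<bar>" by blast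
    obtain C where "\<And>x. 1 \<le> x \<Longrightarrow> fpot x \<le> C * rate (1 / x)"
      using fpot_upper_bound[of \<delta> "min \<tau> pi"] H by auto
    then show "\<exists>C x0. \<forall>x::int. x0 \<le> x \<and> 1 \<le> x \<longrightarrow> fpot (real_of_int x) \<le> C * rate (1 / real_of_int x)"
      by (intro exI[of _ C] exI[of _ 1]) auto
  qed
qed

end
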